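(* Let $a\in(0,1/2)$. Among directed metrics of finite rate for which the geodesic from $(0,0)$ to $(0,1)$ passes through $(1,a)$, there is a unique metric of minimal rate, and it is of the form $e(F,\rho)$ where: $F:[0,1]\to\mathbb R$ consists of the line segment from $(0,0)$ to $(1,a)$, followed by a line segment from $(1,a)$ to some point $(x_B,t_B)$ with $a<t_B$ and $x_B<\frac{t_B}{a}$, followed by $F(t)=x_B\frac{\sqrt t-t}{\sqrt{t_B}-t_B}$ for $t\in[t_B,1]$; $\rho$ is constant on $[0,t_B]$ and $\rho(t)=\left(\frac{F(t)}{t}-F'(t)\right)^2$ for $t\in[t_B,1]$; $F'$ and $\rho$ are continuous at $t_B$; and $b:=\int_0^a(\rho(t)-F'(t)^2)\,dt+\frac1a$ satisfies $0<b\le\frac{1}{1-a}+\frac1a$.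
   Context: Spacetime points are written $(x,t)$ with $x$ spatial and $t$ time; a curve $F:[0,1]\to\mathbb R$ is identified with the path $t\mapsto(F(t),t)$. A directed metric is a continuous $e:\{(x,s,y,t):s<t\}\to\mathbb R\cup\{-\infty\}$ with $e(x,s,y,t)+e(y,t,z,u)\le e(x,s,z,u)$. The Dirichlet metric is $d(x,s,y,t)=-\frac{(y-x)^2}{t-s}$. For a curve $\gamma$ and a nonnegative density $\rho$, $e_{\gamma,\rho}(x_1,t_1,x_2,t_2)=\int_{t_1}^{t_2}(\rho(t)-\gamma'(t)^2)dt$ if $x_i=\gamma(t_i)$ and $-\infty$ otherwise. Finite-rate metrics are exactly those arising from planting nonnegative densities $\rho_i$ along finitely or countably many curves $\gamma_i$: the metric is the smallest directed metric $e$ with $e\ge d$ and $e\ge e_{\gamma_i,\rho_i}$ for all $i$, and its rate is $I(e)=\sum_i\frac43\int\rho_i^{3/2}dt$; all other metrics have infinite rate. $e(F,\rho)$ denotes the metric obtained by planting $\rho$ along the single curve $F$. A path $\pi$ from $(x,s)$ to $(y,t)$ is a geodesic of $e$ if its length (infimum over partitions $s=t_0<\dots<t_k=t$ of $\sum_i e(\pi(t_{i-1}),t_{i-1},\pi(t_i),t_i)$) equals $e(x,s,y,t)$. *)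

theory Defs
  imports "HOL-Analysis.Analysis"
begin

text \<open>Spacetime points are (x,t), x spatial, t time.  A (directed) metric is a function
  e x s y t, meaningful only for s < t, with values in ereal (never +infinity).\<close>

type_synonym dmetric = "real \<Rightarrow> real \<Rightarrow> real \<Rightarrow> real \<Rightarrow> ereal"

definition dirichlet :: dmetric where
  "dirichlet x s y t = ereal (- ((y - x) ^ 2) / (t - s))"

definition directed_metric :: "dmetric \<Rightarrow> bool" where
  "directed_metric e \<longleftrightarrow>
     continuous_on {(x, s, y, t). s < t} (\<lambda>(x, s, y, t). e x s y t) \<and>
     (\<forall>x s y t. s < t \<longrightarrow> e x s y t \<noteq> \<infinity>) \<and>
     (\<forall>x s y t z u. s < t \<longrightarrow> t < u \<longrightarrow> e x s y t + e y t z u \<le> e x s z u)"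

definition admissible_curve :: "(real \<Rightarrow> real) \<Rightarrow> bool" where
  "admissible_curve \<gamma> \<longleftrightarrow>
     (\<exists>g. set_integrable lebesgue {0..1} g \<and>
          set_integrable lebesgue {0..1} (\<lambda>t. (g t)^2) \<and>
          (\<forall>t\<in>{0..1}. \<gamma> t = \<gamma> 0 + set_lebesgue_integral lebesgue {0..t} g))"

definition admissible_density :: "(real \<Rightarrow> real) \<Rightarrow> bool" where
  "admissible_density \<rho> \<longleftrightarrow> (\<forall>t\<in>{0..1}. 0 \<le> \<rho> t) \<and> set_integrable lebesgue {0..1} \<rho>"

definition curve_metric :: "(real \<Rightarrow> real) \<Rightarrow> (real \<Rightarrow> real) \<Rightarrow> dmetric" where
  "curve_metric \<gamma> \<rho> x1 t1 x2 t2 =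
     (if 0 \<le> t1 \<and> t1 < t2 \<and> t2 \<le> 1 \<and> x1 = \<gamma> t1 \<and> x2 = \<gamma> t2
      then ereal (set_lebesgue_integral lebesgue {t1..t2} (\<lambda>t. \<rho> t - (deriv \<gamma> t)^2))
      else -\<infinity>)"

definition planted_by :: "dmetric \<Rightarrow> nat set \<Rightarrow> (nat \<Rightarrow> real \<Rightarrow> real) \<Rightarrow> (nat \<Rightarrow> real \<Rightarrow> real) \<Rightarrow> bool" where
  "planted_by e I \<gamma> \<rho> \<longleftrightarrow>
     (\<forall>i\<in>I. admissible_curve (\<gamma> i) \<and> admissible_density (\<rho> i)) \<and>
     directed_metric e \<and>
     (\<forall>x s y t. s < t \<longrightarrow> dirichlet x s y t \<le> e x s y t \<and>
        (\<forall>i\<in>I. curve_metric (\<gamma> i) (\<rho> i) x s y t \<le> e x s y t)) \<and>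
     (\<forall>e'. directed_metric e' \<and>
        (\<forall>x s y t. s < t \<longrightarrow> dirichlet x s y t \<le> e' x s y t \<and>
           (\<forall>i\<in>I. curve_metric (\<gamma> i) (\<rho> i) x s y t \<le> e' x s y t))
        \<longrightarrow> (\<forall>x s y t. s < t \<longrightarrow> e x s y t \<le> e' x s y t))"

definition rep_rate :: "nat set \<Rightarrow> (nat \<Rightarrow> real \<Rightarrow> real) \<Rightarrow> ennreal" where
  "rep_rate I \<rho> = (\<Sum>i. if i \<in> I then ennreal (4/3) *
        (\<integral>\<^sup>+ t. indicator {0..1} t * ennreal (\<rho> i t powr (3/2)) \<partial>lebesgue) else 0)"

text \<open>Rate of a metric: infimum over all planting representations (infinity if none).\<close>
definition rate :: "dmetric \<Rightarrow> ennreal" where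
  "rate e = (INF r \<in> {(I, \<gamma>, \<rho>). planted_by e I \<gamma> \<rho>}. (case r of (I, \<gamma>, \<rho>) \<Rightarrow> rep_rate I \<rho>))"

definition finite_rate :: "dmetric \<Rightarrow> bool" where
  "finite_rate e \<longleftrightarrow> rate e < \<infinity>"

definition path_length :: "dmetric \<Rightarrow> (real \<Rightarrow> real) \<Rightarrow> real \<Rightarrow> real \<Rightarrow> ereal" where
  "path_length e \<pi> s t =
     (INF p \<in> {(k, \<tau>). 0 < k \<and> \<tau> 0 = s \<and> \<tau> k = t \<and> (\<forall>i<k. \<tau> i < \<tau> (Suc i))}.
        (case p of (k, \<tau>) \<Rightarrow>
          (\<Sum>i<(k::nat). e (\<pi> (\<tau> i)) (\<tau> i) (\<pi> (\<tau> (Suc i))) (\<tau> (Suc i)))))"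

definition geodesic :: "dmetric \<Rightarrow> (real \<Rightarrow> real) \<Rightarrow> real \<Rightarrow> real \<Rightarrow> real \<Rightarrow> real \<Rightarrow> bool" where
  "geodesic e \<pi> x s y t \<longleftrightarrow> s < t \<and> continuous_on {s..t} \<pi> \<and> \<pi> s = x \<and> \<pi> t = y \<and>
     path_length e \<pi> s t = e x s y t"

definition geodesic_through :: "dmetric \<Rightarrow> real \<Rightarrow> bool" where
  "geodesic_through e a \<longleftrightarrow> (\<exists>\<pi>. geodesic e \<pi> 0 0 0 1 \<and> \<pi> a = 1)"

end

theory Submission
  imports Defs
begin

text \<open>Write a metric of finite rate as planted with densities \<open>\<rho>\<^sub>i\<close> and put
  \<open>R\<^sup>3\<^sup>/\<^sup>2 = \<Sum>\<^sub>i \<rho>\<^sub>i\<^sup>3\<^sup>/\<^sup>2\<close>. No path gains more than \<open>\<integral> R\<close> over the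
  Dirichlet metric, so if \<open>\<pi>\<close> is a geodesic through \<open>(1, a)\<close>, comparing its length up to time \<open>t\<close> with the straight
  segment from the origin bounds \<open>\<integral>\<^sub>0\<^sup>t R\<close> below. In the projective coordinates
  \<open>y = \<pi>(t) / t\<close>, \<open>\<tau> = - 1 / t\<close> the bound is the Dirichlet energy of \<open>y\<close> on \<open>[a, t]\<close>. This leaves a convex
  problem for \<open>(\<pi>, R)\<close>. Its optimum has \<open>t\<^sub>B = 2 a\<close> and \<open>\<rho> = s\<^sup>2\<close> with
  \<open>s(t) = \<beta> q / sqrt (max t (2 a))\<close>, \<open>q = sqrt (2 a)\<close>, and the weight \<open>s\<close> is also the dual certificate.
  Perturbing the certificate shows that a minimizer has the geodesic \<open>F\<close> and the right lengths along it. Only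
  density on \<open>F\<close> itself contributes to short pieces of \<open>F\<close>, so it alone must already have the optimal cost;
  in representations of nearly minimal cost all other density is negligible.\<close>

text \<open>The certificate rests on two inequalities. Young's inequality
  \<open>s * R \<le> 2/3 * R powr (3/2) + s^3 / 3\<close>, with equality at \<open>R = s^2\<close>,
  bounds the rate below by the integral of \<open>s * R\<close>. As \<open>s\<close> is decreasing,
  the lower bounds on the integrals of \<open>R\<close> up to all times t combine by Abel summation
  into a bound by the \<open>s\<close>-weighted energy of y. Its minimizer has constant momentum,
  \<open>s\<close> times the slope of y in the projective time, and this is the Euler-Lagrange
  equation that \<open>F\<close> satisfies after \<open>a\<close>.

  The value 2 a of the matching time T comes from three equations. Let the slope of \<open>F\<close>
  be \<open>s - k\<close> after \<open>a\<close>. Continuity of the density at T gives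
  \<open>k = 2 * \<beta> * sqrt T\<close>; passing through (1, a) and continuity at T give
  \<open>\<beta> * (T + a) = 1 + k * a\<close>; and the total length of the curve must equal 0, the
  Dirichlet value between the end points. Eliminating \<open>k\<close> leaves
  \<open>(T + a)^2 = a^2 + 4 * a * T\<close>.

  The certificate identifies only the combined density R and not where it is planted. Locating it on
  \<open>F\<close> takes a separate argument, in which a short geodesic piece cannot afford a
  detour.\<close>

section \<open>Differentiation of indefinite Lebesgue integrals\<close>

text \<open>Henstock's lemma bounds the total defect over a finite gauge-fine family by
  \<open>c * e\<close>. The bad intervals form a Vitali cover, and a disjoint subfamily that still
  covers almost all of the set consists of intervals whose defect exceeds \<open>c\<close> times
  their length, so its total length is at most \<open>e\<close>.\<close>

lemma interval_defects_negligible: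
  fixes f :: "real \<Rightarrow> real"
  assumes f: "f integrable_on {a..b}" and c: "0 < c"
  shows "negligible {x \<in> {a..b}. \<forall>d>0. \<exists>u v. a \<le> u \<and> u \<le> x \<and> x \<le> v \<and> v \<le> b \<and> u < v \<and> v - u < d \<and>
            c * (v - u) < \<bar>integral {u..v} f - (v - u) * f x\<bar>}" (is "negligible ?E")
proof (unfold negligible_outer_le, intro allI impI)
  fix e :: real assume e: "0 < e"
  have f': "f integrable_on cbox a b" using f by simp
  have ce0: "0 < c * e" using c e by simp
  obtain \<gamma> where \<gamma>: "gauge \<gamma>"
    and hen: "\<And>p. \<lbrakk>p tagged_partial_division_of (cbox a b); \<gamma> fine p\<rbrakk> \<Longrightarrow>
             (\<Sum>(x,k)\<in>p. norm (measure lborel k *\<^sub>R f x - integral k f)) < c * e"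
  proof (rule Henstock_lemma [OF f' ce0])
    fix \<gamma> :: "real \<Rightarrow> real set"
    assume "gauge \<gamma>" "\<And>p. \<lbrakk>p tagged_partial_division_of (cbox a b); \<gamma> fine p\<rbrakk> \<Longrightarrow>
             (\<Sum>(x,k)\<in>p. norm (measure lborel k *\<^sub>R f x - integral k f)) < c * e"
    then show thesis by (rule that)
  qed
  \<comment> \<open>A member of \<open>K\<close> is a tag with a bad interval around it that is fine
    for the gauge; the point itself is the tag, so every short enough bad interval
    qualifies.\<close>
  define K where "K = {(x,u,v). x \<in> {a..b} \<and> a \<le> u \<and> u \<le> x \<and> x \<le> v \<and> v \<le> b \<and> u < v \<and> {u..v} \<subseteq> \<gamma> x \<and>
            c * (v - u) < \<bar>integral {u..v} f - (v - u) * f x\<bar>}"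
  define ce where "ce = (\<lambda>(x::real,u::real,v::real). (u + v) / 2)"
  define ra where "ra = (\<lambda>(x::real,u::real,v::real). (v - u) / 2)"
  have cb: "cball (ce i) (ra i) = {fst (snd i)..snd (snd i)}" for i
    unfolding cball_eq_atLeastAtMost ce_def ra_def by (cases i) (auto simp: field_simps)
  have rpos: "0 < ra i" if "i \<in> K" for i
    using that by (auto simp: K_def ra_def)
  have cov: "\<exists>i. i \<in> K \<and> x \<in> cball (ce i) (ra i) \<and> ra i < d" if x: "x \<in> ?E" and d: "0 < d" for x d
  proof -
    have "open (\<gamma> x)" "x \<in> \<gamma> x" using \<gamma> by (auto simp: gauge_def)
    then obtain r where r: "0 < r" "ball x r \<subseteq> \<gamma> x" by (meson openE)
    with d x obtain u v where uv: "a \<le> u" "u \<le> x" "x \<le> v" "v \<le> b" "u < v" "v - u < min d r"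
        "c * (v - u) < \<bar>integral {u..v} f - (v - u) * f x\<bar>"
      by (smt (verit) mem_Collect_eq)
    have "{u..v} \<subseteq> ball x r" using uv by (auto simp: dist_real_def)
    then have "(x,u,v) \<in> K" using uv r x by (auto simp: K_def)
    moreover have "x \<in> cball (ce (x,u,v)) (ra (x,u,v))" unfolding cb using uv by simp
    moreover have "ra (x,u,v) < d" using uv by (simp add: ra_def)
    ultimately show ?thesis by blast
  qed
  obtain C where C: "countable C" "C \<subseteq> K"
     "pairwise (\<lambda>i j. disjnt (cball (ce i) (ra i)) (cball (ce j) (ra j))) C"
     "negligible (?E - (\<Union>i \<in> C. cball (ce i) (ra i)))"
  proof (rule Vitali_covering_theorem_cballs [where K = K and S = ?E and a = ce and r = ra])
    fix C assume "countable C" "C \<subseteq> K"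
      "pairwise (\<lambda>i j. disjnt (cball (ce i) (ra i)) (cball (ce j) (ra j))) C"
      "negligible (?E - (\<Union>i \<in> C. cball (ce i) (ra i)))"
    then show thesis by (rule that)
  next
    fix i assume "i \<in> K" then show "0 < ra i" by (rule rpos)
  next
    fix x d :: real assume "x \<in> ?E" "0 < d"
    then show "\<exists>i. i \<in> K \<and> x \<in> cball (ce i) (ra i) \<and> ra i < d" by (rule cov)
  qed
  let ?I = "\<lambda>i::real \<times> real \<times> real. {fst (snd i)..snd (snd i)}"
  \<comment> \<open>Henstock's lemma speaks of finite families. The bound is uniform in
    \<open>J\<close> and so passes to the countable union.\<close>
  have fin: "measure lebesgue (\<Union>i\<in>J. ?I i) \<le> e" if J: "J \<subseteq> C" "finite J" for J
  proof -
    define p where "p = (\<lambda>i. (fst i, ?I i)) ` J"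
    have JK: "J \<subseteq> K" using J C by auto
    have inj: "inj_on (\<lambda>i. (fst i, ?I i)) J"
    proof (rule inj_onI)
      fix i j assume ij: "i \<in> J" "j \<in> J" "(fst i, ?I i) = (fst j, ?I j)"
      have "i \<in> K" "j \<in> K" using ij JK by auto
      then show "i = j" using ij
        by (cases i; cases j) (auto simp: K_def Icc_eq_Icc)
    qed
    have disj: "?I i \<inter> ?I j = {}" if "i \<in> J" "j \<in> J" "i \<noteq> j" for i j
      using C(3) J that unfolding cb pairwise_def disjnt_def by blast
    have "p tagged_partial_division_of (cbox a b)"
      unfolding tagged_partial_division_of_def
    proof (intro conjI allI impI)
      show "finite p" using J by (simp add: p_def)
    next
      fix x k assume "(x,k) \<in> p"
      then obtain i where i: "i \<in> J" "x = fst i" "k = ?I i" by (auto simp: p_def)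
      then have "i \<in> K" using JK by auto
      then show "x \<in> k" "k \<subseteq> cbox a b" "\<exists>a b. k = cbox a b" using i
        by (auto simp: K_def)
    next
      fix x1 K1 x2 K2 assume A: "(x1,K1) \<in> p \<and> (x2,K2) \<in> p \<and> (x1,K1) \<noteq> (x2,K2)"
      obtain i where i: "i \<in> J" "(x1,K1) = (fst i, ?I i)" using A unfolding p_def by blast
      obtain j where j: "j \<in> J" "(x2,K2) = (fst j, ?I j)" using A unfolding p_def by blast
      have "i \<noteq> j" "K1 = ?I i" "K2 = ?I j" using i j A by auto
      then have "K1 \<inter> K2 = {}" using disj i j by simp
      then show "interior K1 \<inter> interior K2 = {}"
        using interior_subset by blast
    qed
    moreover have "\<gamma> fine p"
    proof (rule fineI)
      fix x k assume "(x,k) \<in> p"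
      then obtain i where i: "i \<in> J" "x = fst i" "k = ?I i" by (auto simp: p_def)
      then have "i \<in> K" using JK by auto
      then show "k \<subseteq> \<gamma> x" using i by (auto simp: K_def)
    qed
    ultimately have "sum (\<lambda>(x,k). norm(measure lborel k *\<^sub>R f x - integral k f)) p < c * e" by (rule hen)
    then have le: "(\<Sum>i\<in>J. \<bar>measure lborel (?I i) * f (fst i) - integral (?I i) f\<bar>) < c * e"
      unfolding p_def by (subst (asm) sum.reindex [OF inj]) (simp add: o_def)
    have "measure lebesgue (\<Union>i\<in>J. ?I i) \<le> (\<Sum>i\<in>J. measure lebesgue (?I i))"
      by (rule measure_UNION_le) (use J in auto)
    also have "\<dots> \<le> (\<Sum>i\<in>J. \<bar>measure lborel (?I i) * f (fst i) - integral (?I i) f\<bar> / c)"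
    proof (rule sum_mono)
      fix i assume "i \<in> J"
      then have "i \<in> K" using JK by auto
      then have "c * (snd (snd i) - fst (snd i)) < \<bar>measure lborel (?I i) * f (fst i) - integral (?I i) f\<bar>"
        "fst (snd i) < snd (snd i)"
        by (auto simp: K_def abs_minus_commute)
      then show "measure lebesgue (?I i) \<le> \<bar>measure lborel (?I i) * f (fst i) - integral (?I i) f\<bar> / c"
        using c by (simp add: field_simps)
    qed
    also have "\<dots> \<le> e"
      using le c by (simp add: sum_divide_distrib [symmetric] field_simps)
    finally show ?thesis .
  qed
  have T: "(\<Union>i\<in>C. ?I i) \<in> lmeasurable"
    by (rule fmeasurable_UN_bound [OF C(1), where B = e]) (use fin in auto)
  have Tm: "measure lebesgue (\<Union>i\<in>C. ?I i) \<le> e"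
    by (rule measure_UN_bound [OF C(1), where B = e]) (use fin in auto)
  let ?N = "?E - (\<Union>i\<in>C. ?I i)"
  have N: "negligible ?N" using C(4) unfolding cb .
  show "\<exists>T. ?E \<subseteq> T \<and> T \<in> lmeasurable \<and> measure lebesgue T \<le> e"
  proof (intro exI conjI)
    show "?E \<subseteq> (\<Union>i\<in>C. ?I i) \<union> ?N" by blast
    show "(\<Union>i\<in>C. ?I i) \<union> ?N \<in> lmeasurable"
      using T N negligible_imp_measurable by blast
    have "measure lebesgue ((\<Union>i\<in>C. ?I i) \<union> ?N) \<le> measure lebesgue (\<Union>i\<in>C. ?I i) + measure lebesgue ?N"
      using T N negligible_imp_measurable by (intro measure_Un_le) blast+
    then show "measure lebesgue ((\<Union>i\<in>C. ?I i) \<union> ?N) \<le> e"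
      using Tm negligible_imp_measure0 [OF N] by linarith
  qed
qed

lemma abs_quotient_diff_le:
  fixes A h f c :: real
  assumes "0 < h" "\<bar>A - h * f\<bar> \<le> c * h"
  shows "\<bar>A / h - f\<bar> \<le> c"
proof -
  have "A / h - f = (A - h * f) / h" using assms(1) by (simp add: field_simps)
  then have "\<bar>A / h - f\<bar> = \<bar>A - h * f\<bar> / h" using assms(1) by (simp add: abs_divide)
  then show ?thesis using assms by (simp add: pos_divide_le_eq)
qed

text \<open>The exceptional set is the union of the defect sets for \<open>c = 1 / (n + 1)\<close>.
  These admit every interval containing the point, in particular those with the point at one end, so
  both one-sided quotients are controlled.\<close>

theorem lebesgue_differentiation:
  fixes f :: "real \<Rightarrow> real"
  assumes f: "f integrable_on {a..b}"
  obtains N where "negligible N"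
    and "\<And>x. x \<in> {a<..<b} - N \<Longrightarrow> ((\<lambda>t. integral {a..t} f) has_real_derivative f x) (at x)"
proof -
  define E where "E n = {x \<in> {a..b}. \<forall>d>0. \<exists>u v. a \<le> u \<and> u \<le> x \<and> x \<le> v \<and> v \<le> b \<and> u < v \<and> v - u < d \<and>
            inverse (real (Suc n)) * (v - u) < \<bar>integral {u..v} f - (v - u) * f x\<bar>}" for n
  have "negligible (E n)" for n
    unfolding E_def by (rule interval_defects_negligible [OF f]) simp
  then have neg: "negligible (\<Union>n. E n)" using negligible_Union_nat by blast
  show thesis
  proof (rule that [OF neg])
    fix x assume x: "x \<in> {a<..<b} - (\<Union>n. E n)"
    show "((\<lambda>t. integral {a..t} f) has_real_derivative f x) (at x)"
      unfolding has_field_derivative_iff LIM_eq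
    proof (intro allI impI)
      fix r :: real assume "0 < r"
      then obtain n where n: "inverse (real (Suc n)) < r" using reals_Archimedean by blast
      from x have "x \<notin> E n" by blast
      then obtain d where d: "0 < d" and
        D: "\<And>u v. a \<le> u \<Longrightarrow> u \<le> x \<Longrightarrow> x \<le> v \<Longrightarrow> v \<le> b \<Longrightarrow> u < v \<Longrightarrow> v - u < d \<Longrightarrow>
            \<bar>integral {u..v} f - (v - u) * f x\<bar> \<le> inverse (real (Suc n)) * (v - u)"
        unfolding E_def using x by force
      define e where "e = min d (min (x - a) (b - x))"
      have "0 < e" using d x by (auto simp: e_def)
      moreover have "\<bar>(integral {a..y} f - integral {a..x} f) / (y - x) - f x\<bar> < r"
        if y: "y \<noteq> x" "\<bar>y - x\<bar> < e" for y
      proof (cases "x < y")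
        case True
        have "integral {a..x} f + integral {x..y} f = integral {a..y} f"
          using True y x by (intro Henstock_Kurzweil_Integration.integral_combine integrable_subinterval_real [OF f])
             (simp_all add: e_def)
        moreover have "\<bar>integral {x..y} f - (y - x) * f x\<bar> \<le> inverse (real (Suc n)) * (y - x)"
          using True y x by (intro D) (auto simp: e_def)
        ultimately have "\<bar>(integral {a..y} f - integral {a..x} f) / (y - x) - f x\<bar> \<le> inverse (real (Suc n))"
          using True by (intro abs_quotient_diff_le) (simp_all add: algebra_simps)
        then show ?thesis using n by linarith
      next
        case False
        then have lt: "y < x" using y by simp
        have "integral {a..y} f + integral {y..x} f = integral {a..x} f"
          using lt y x by (intro Henstock_Kurzweil_Integration.integral_combine integrable_subinterval_real [OF f])
             (simp_all add: e_def)
        moreover have "\<bar>integral {y..x} f - (x - y) * f x\<bar> \<le> inverse (real (Suc n)) * (x - y)"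
          using lt y x by (intro D) (auto simp: e_def)
        ultimately have "\<bar>(integral {a..x} f - integral {a..y} f) / (x - y) - f x\<bar> \<le> inverse (real (Suc n))"
          using lt by (intro abs_quotient_diff_le) (simp_all add: algebra_simps)
        moreover have "(integral {a..x} f - integral {a..y} f) / (x - y) = (integral {a..y} f - integral {a..x} f) / (y - x)"
          using minus_divide_divide [of "integral {a..x} f - integral {a..y} f" "x - y"] by simp
        ultimately have "\<bar>(integral {a..y} f - integral {a..x} f) / (y - x) - f x\<bar> \<le> inverse (real (Suc n))"
          by simp
        then show ?thesis using n by linarith
      qed
      ultimately show "\<exists>s>0. \<forall>y. y \<noteq> x \<and> norm (y - x) < s \<longrightarrow>
           norm ((integral {a..y} f - integral {a..x} f) / (y - x) - f x) < r"
        by auto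
    qed
  qed
qed

section \<open>Chains of links\<close>

definition parab :: "real \<Rightarrow> real \<Rightarrow> real \<Rightarrow> real \<Rightarrow> real" where
  "parab x s y t = - ((y - x)^2) / (t - s)"

lemma dirichlet_eq_parab: "dirichlet x s y t = ereal (parab x s y t)"
  by (simp add: dirichlet_def parab_def)

lemma square_div_add_le:
  fixes p q h k :: real
  assumes "0 < h" "0 < k"
  shows "(p + q)^2 / (h + k) \<le> p^2 / h + q^2 / k"
proof -
  have "p^2 / h + q^2 / k - (p + q)^2 / (h + k) = (p * k - q * h)^2 / (h * k * (h + k))"
    using assms by (simp add: field_simps power2_eq_square add_nonneg_eq_0_iff)
  also have "\<dots> \<ge> 0" using assms by simp
  finally show ?thesis by simp
qed

lemma parab_triangle:
  assumes "s < t" "t < u"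
  shows "parab x s y t + parab y t z u \<le> parab x s z u"
  using square_div_add_le [of "t - s" "u - t" "y - x" "z - y"] assms by (simp add: parab_def)

lemma parab_nonpos: "s < t \<Longrightarrow> parab x s y t \<le> 0"
  by (simp add: parab_def)

lemma parab_cut:
  assumes "s < r" "r < t"
  obtains z where "parab x s z r + parab z r y t = parab x s y t"
proof
  have "parab x s (x + (y - x) / (t - s) * (r - s)) r = - (((y - x) / (t - s))^2 * (r - s))"
    using assms by (simp add: parab_def power2_eq_square)
  moreover have "y - (x + (y - x) / (t - s) * (r - s)) = (y - x) / (t - s) * (t - r)"
    using assms by (simp add: field_simps)
  then have "parab (x + (y - x) / (t - s) * (r - s)) r y t = - (((y - x) / (t - s))^2 * (t - r))"
    using assms by (simp add: parab_def power2_eq_square)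
  moreover have "parab x s y t = - (((y - x) / (t - s))^2 * (t - s))"
    using assms by (simp add: parab_def power2_eq_square)
  ultimately show "parab x s (x + (y - x) / (t - s) * (r - s)) r + parab (x + (y - x) / (t - s) * (r - s)) r y t = parab x s y t"
    by (simp add: algebra_simps)
qed

text \<open>The metric planted along links is a supremum over finite concatenations of links and
  straight segments. A relation carrying the value allows several links of different value between
  the same two points.\<close>

inductive chain :: "(real \<Rightarrow> real \<Rightarrow> real \<Rightarrow> real \<Rightarrow> real \<Rightarrow> bool) \<Rightarrow>
    real \<Rightarrow> real \<Rightarrow> real \<Rightarrow> real \<Rightarrow> real \<Rightarrow> bool" for B where
  direct: "s < t \<Longrightarrow> chain B x s y t (parab x s y t)"
| link: "B x s y t v \<Longrightarrow> chain B x s y t v"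
| append: "chain B x s y t v \<Longrightarrow> chain B y t z u w \<Longrightarrow> chain B x s z u (v + w)"

section \<open>Continuity of metrics that can be cut at intermediate times\<close>

text \<open>The parabolic scaling of \<^const>\<open>parab\<close> makes the starting point move freely: replace an initial
  piece of a near-optimal path by a straight segment to its position a short time later.\<close>

lemma start_perturbation:
  fixes E :: "real \<Rightarrow> real \<Rightarrow> real \<Rightarrow> real \<Rightarrow> real"
  assumes tri: "\<And>x s y t z u. s < t \<Longrightarrow> t < u \<Longrightarrow> E x s y t + E y t z u \<le> E x s z u"
    and ge: "\<And>x s y t. s < t \<Longrightarrow> parab x s y t \<le> E x s y t"
    and le: "\<And>x s y t. s < t \<Longrightarrow> E x s y t \<le> parab x s y t + M"
    and small: "\<And>e. 0 < e \<Longrightarrow> \<exists>d>0. \<forall>x s y t. s < t \<and> t - s \<le> d \<longrightarrow> E x s y t \<le> parab x s y t + e"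
    and mid: "\<And>x s y t r e. s < r \<Longrightarrow> r < t \<Longrightarrow> 0 < e \<Longrightarrow> \<exists>z. E x s y t - e \<le> E x s z r + E z r y t"
    and lt: "s0 < t0" and e: "0 < e"
  shows "\<exists>h>0. \<forall>x s x' s' y t. \<bar>x - x0\<bar> < h \<and> \<bar>s - s0\<bar> < h \<and> \<bar>x' - x0\<bar> < h \<and> \<bar>s' - s0\<bar> < h \<and>
      \<bar>y - y0\<bar> < h \<and> \<bar>t - t0\<bar> < h \<longrightarrow> s < t \<and> s' < t \<and> E x s y t - e \<le> E x' s' y t"
proof -
  define T where "T = t0 - s0"
  have T: "0 < T" using lt by (simp add: T_def)
  obtain d0 where d0: "0 < d0" and d0e: "\<And>x s y t. s < t \<Longrightarrow> t - s \<le> d0 \<Longrightarrow> E x s y t \<le> parab x s y t + e / 4"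
    using small [of "e/4"] e by auto
  define d where "d = min (T / 4) (d0 / 2)"
  have d: "0 < d" "d \<le> T / 4" "2 * d \<le> d0" using T d0 by (auto simp: d_def)
  define r where "r = s0 + d"
  have M: "0 \<le> M"
    using order_trans [OF ge le, of 0 1 0 0] by simp
  define D where "D = (\<bar>y0 - x0\<bar> + 2)^2 / (T / 2)"
  \<comment> \<open>A near-optimal crossing at time \<open>r\<close> is not far away:
    \<open>E x s y t\<close> is at least \<open>- D\<close> and each piece gains at most
    \<open>M\<close>, so the parabolic cost of the first piece is at most
    \<open>2 * M + D + e\<close>. This confines \<open>z\<close> to a compact set on which
    \<open>parab\<close> is uniformly continuous.\<close>
  define Z where "Z = sqrt (2 * d * (2 * M + D + e))"
  have D: "0 \<le> D" using T by (simp add: D_def)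
  define g where "g = (\<lambda>(x, s, z). parab x s z r)"
  define Kc where "Kc = {x0 - 1..x0 + 1} \<times> {s0 - d / 2..s0 + d / 2} \<times> {x0 - Z - 1..x0 + Z + 1}"
  have "compact Kc" unfolding Kc_def by (intro compact_Times) auto
  moreover have "continuous_on Kc g"
    unfolding g_def parab_def Kc_def case_prod_unfold using d
    by (intro continuous_intros) (auto simp: r_def)
  ultimately have "uniformly_continuous_on Kc g" by (rule compact_uniformly_continuous[rotated])
  then obtain k where k: "0 < k" and kg: "\<And>p p'. p \<in> Kc \<Longrightarrow> p' \<in> Kc \<Longrightarrow> dist p' p < k \<Longrightarrow> dist (g p') (g p) < e / 4"
    unfolding uniformly_continuous_on_def using e by (metis zero_less_divide_iff zero_less_numeral)
  define h where "h = min 1 (min (d / 2) (k / 4))"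
  have h: "0 < h" "h \<le> 1" "h \<le> d / 2" "h \<le> k / 4" using d k by (auto simp: h_def)
  have main: "s < t \<and> s' < t \<and> E x s y t - e \<le> E x' s' y t"
    if A: "\<bar>x - x0\<bar> < h" "\<bar>s - s0\<bar> < h" "\<bar>x' - x0\<bar> < h" "\<bar>s' - s0\<bar> < h" "\<bar>y - y0\<bar> < h" "\<bar>t - t0\<bar> < h"
    for x s x' s' y t
  proof -
    have sr: "s < r" "s' < r" "r - s \<le> 2 * d" "d / 2 \<le> r - s" "r < t" "T / 2 \<le> t - s"
      using A h d by (auto simp: r_def T_def abs_less_iff)
    obtain z where z: "E x s y t - e / 4 \<le> E x s z r + E z r y t"
      using mid [OF sr(1) sr(5), of "e / 4"] e by auto
    have "(y - x)^2 \<le> (\<bar>y0 - x0\<bar> + 2)^2"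
      using A h by (intro power2_le_iff_abs_le [THEN iffD2]) auto
    then have "(y - x)^2 / (t - s) \<le> D"
      unfolding D_def using sr T by (intro frac_le) auto
    then have "- D \<le> E x s y t" using ge [of s t x y] sr by (simp add: parab_def)
    moreover have "E z r y t \<le> M" using le [OF sr(5), of z y] parab_nonpos [OF sr(5), of z y] by linarith
    moreover have "E x s z r \<le> parab x s z r + M" using le sr by blast
    ultimately have "(z - x)^2 / (r - s) \<le> 2 * M + D + e"
      using z e by (simp add: parab_def)
    then have "(z - x)^2 \<le> (2 * M + D + e) * (r - s)"
      using sr by (simp add: pos_divide_le_eq)
    also have "\<dots> \<le> (2 * M + D + e) * (2 * d)"
      using sr M D e by (intro mult_left_mono) auto
    finally have "\<bar>z - x\<bar> \<le> Z"
      unfolding Z_def by (intro real_le_rsqrt) (simp add: mult_ac)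
    then have zK: "z \<in> {x0 - Z - 1..x0 + Z + 1}" using A h by auto
    have "dist (g (x', s', z)) (g (x, s, z)) < e / 4"
    proof (rule kg)
      show "(x, s, z) \<in> Kc" "(x', s', z) \<in> Kc" unfolding Kc_def using A h zK by auto
      have "dist (x', s', z) (x, s, z) \<le> dist x' x + dist s' s"
        unfolding dist_Pair_Pair by (simp add: sqrt_sum_squares_le_sum)
      also have "\<dots> < k" using A h by (auto simp: dist_real_def)
      finally show "dist (x', s', z) (x, s, z) < k" .
    qed
    then have "\<bar>parab x' s' z r - parab x s z r\<bar> < e / 4" by (simp add: g_def dist_real_def)
    then have "parab x s z r - e / 4 \<le> parab x' s' z r" by linarith
    \<comment> \<open>Only the first piece is replaced. It is short, so by \<open>small\<close> it
      gains little over the straight segment.\<close>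
    moreover have "E x s z r \<le> parab x s z r + e / 4" using d0e sr d by force
    moreover have "parab x' s' z r \<le> E x' s' z r" using ge sr by blast
    moreover have "E x' s' z r + E z r y t \<le> E x' s' y t" using tri sr by blast
    ultimately have "E x s y t - e \<le> E x' s' y t" using z e by linarith
    then show ?thesis using sr by linarith
  qed
  show ?thesis using h(1) main by blast
qed

text \<open>The start moves by the perturbation lemma and the end by the same lemma for the
  time-reversed function, because \<open>parab\<close> is invariant under reversing time. Roles of
  the two points are symmetric, which gives both inequalities.\<close>

lemma continuous_of_cuttable:
  fixes E :: "real \<Rightarrow> real \<Rightarrow> real \<Rightarrow> real \<Rightarrow> real"
  assumes tri: "\<And>x s y t z u. s < t \<Longrightarrow> t < u \<Longrightarrow> E x s y t + E y t z u \<le> E x s z u"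
    and ge: "\<And>x s y t. s < t \<Longrightarrow> parab x s y t \<le> E x s y t"
    and le: "\<And>x s y t. s < t \<Longrightarrow> E x s y t \<le> parab x s y t + M"
    and small: "\<And>e. 0 < e \<Longrightarrow> \<exists>d>0. \<forall>x s y t. s < t \<and> t - s \<le> d \<longrightarrow> E x s y t \<le> parab x s y t + e"
    and mid: "\<And>x s y t r e. s < r \<Longrightarrow> r < t \<Longrightarrow> 0 < e \<Longrightarrow> \<exists>z. E x s y t - e \<le> E x s z r + E z r y t"
  shows "continuous_on {(x, s, y, t). s < t} (\<lambda>(x, s, y, t). E x s y t)"
  unfolding continuous_on_iff
proof (clarify)
  fix x0 s0 y0 t0 e :: real assume lt: "s0 < t0" and e: "0 < e"
  have e3: "0 < e / 3" using e by simp
  obtain h1 where h1: "0 < h1" "\<And>x s x' s' y t. \<bar>x - x0\<bar> < h1 \<Longrightarrow> \<bar>s - s0\<bar> < h1 \<Longrightarrow> \<bar>x' - x0\<bar> < h1 \<Longrightarrow> \<bar>s' - s0\<bar> < h1 \<Longrightarrow>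
      \<bar>y - y0\<bar> < h1 \<Longrightarrow> \<bar>t - t0\<bar> < h1 \<Longrightarrow> s < t \<and> s' < t \<and> E x s y t - e / 3 \<le> E x' s' y t"
    using start_perturbation [OF tri ge le small mid lt e3, of x0 y0] by blast
  define E' where "E' x s y t = E y (- t) x (- s)" for x s y t
  have par: "parab y (- t) x (- s) = parab x s y t" for x s y t
    by (simp add: parab_def power2_commute)
  have "\<exists>h>0. \<forall>x s x' s' y t. \<bar>x - y0\<bar> < h \<and> \<bar>s - (- t0)\<bar> < h \<and> \<bar>x' - y0\<bar> < h \<and> \<bar>s' - (- t0)\<bar> < h \<and>
      \<bar>y - x0\<bar> < h \<and> \<bar>t - (- s0)\<bar> < h \<longrightarrow> s < t \<and> s' < t \<and> E' x s y t - e / 3 \<le> E' x' s' y t"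
  proof (rule start_perturbation [where M = M])
    show "E' x s y t + E' y t z u \<le> E' x s z u" if "s < t" "t < u" for x s y t z u
      unfolding E'_def using tri [of "- u" "- t" "- s" z y x] that by simp
    show "parab x s y t \<le> E' x s y t" if "s < t" for x s y t
      unfolding E'_def using ge [of "- t" "- s" y x] par that by simp
    show "E' x s y t \<le> parab x s y t + M" if "s < t" for x s y t
      unfolding E'_def using le [of "- t" "- s" y x] par that by simp
    show "\<exists>d>0. \<forall>x s y t. s < t \<and> t - s \<le> d \<longrightarrow> E' x s y t \<le> parab x s y t + e" if e: "0 < e" for e
    proof -
      obtain d where "0 < d" and d: "\<And>x s y t. s < t \<Longrightarrow> t - s \<le> d \<Longrightarrow> E x s y t \<le> parab x s y t + e"
        using small [OF e] by blast
      have "E' x s y t \<le> parab x s y t + e" if "s < t" "t - s \<le> d" for x s y t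
        unfolding E'_def using d [of "- t" "- s" y x] par that by simp
      with \<open>0 < d\<close> show ?thesis by blast
    qed
    show "\<exists>z. E' x s y t - e \<le> E' x s z r + E' z r y t" if "s < r" "r < t" "0 < e" for x s y t r e
      unfolding E'_def using mid [of "- t" "- r" "- s" e y x] that by (auto simp: add.commute)
  qed (use lt e in auto)
  then obtain h2 where h2: "0 < h2" "\<And>x s x' s' y t. \<bar>x - y0\<bar> < h2 \<Longrightarrow> \<bar>s - (- t0)\<bar> < h2 \<Longrightarrow> \<bar>x' - y0\<bar> < h2 \<Longrightarrow> \<bar>s' - (- t0)\<bar> < h2 \<Longrightarrow>
      \<bar>y - x0\<bar> < h2 \<Longrightarrow> \<bar>t - (- s0)\<bar> < h2 \<Longrightarrow> E' x s y t - e / 3 \<le> E' x' s' y t"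
    by blast
  define h where "h = min h1 h2"
  have close: "E x s y t - 2 * (e / 3) \<le> E x' s' y' t'"
    if "\<bar>x - x0\<bar> < h" "\<bar>s - s0\<bar> < h" "\<bar>x' - x0\<bar> < h" "\<bar>s' - s0\<bar> < h"
       "\<bar>y - y0\<bar> < h" "\<bar>t - t0\<bar> < h" "\<bar>y' - y0\<bar> < h" "\<bar>t' - t0\<bar> < h" for x s x' s' y t y' t'
  proof -
    have "E x s y t - e / 3 \<le> E x' s' y t" using h1(2) [of x s x' s' y t] that by (simp add: h_def)
    moreover have "E' y (- t) x' (- s') - e / 3 \<le> E' y' (- t') x' (- s')"
      using h2(2) [of y "- t" y' "- t'" x' "- s'"] that by (simp add: h_def abs_minus_commute)
    ultimately show ?thesis by (simp add: E'_def)
  qed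
  show "\<exists>d>0. \<forall>p'\<in>{(x, s, y, t). s < t}. dist p' (x0, s0, y0, t0) < d \<longrightarrow>
      dist (case p' of (x, s, y, t) \<Rightarrow> E x s y t) (E x0 s0 y0 t0) < e"
  proof (intro exI conjI ballI impI)
    show "0 < h" using h1(1) h2(1) by (simp add: h_def)
    fix p' assume p': "dist p' (x0, s0, y0, t0) < h"
    obtain x s y t where p: "p' = (x, s, y, t)" by (cases p') auto
    have "\<bar>x - x0\<bar> < h" "\<bar>s - s0\<bar> < h" "\<bar>y - y0\<bar> < h" "\<bar>t - t0\<bar> < h"
      using p' dist_fst_le [of p' "(x0, s0, y0, t0)"] dist_snd_le [of p' "(x0, s0, y0, t0)"]
        dist_fst_le [of "snd p'" "(s0, y0, t0)"] dist_snd_le [of "snd p'" "(s0, y0, t0)"]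
        dist_fst_le [of "snd (snd p')" "(y0, t0)"] dist_snd_le [of "snd (snd p')" "(y0, t0)"]
      by (auto simp: p dist_real_def)
    then have "E x s y t - 2 * (e / 3) \<le> E x0 s0 y0 t0" "E x0 s0 y0 t0 - 2 * (e / 3) \<le> E x s y t"
      using close \<open>0 < h\<close> by auto
    then show "dist (case p' of (x, s, y, t) \<Rightarrow> E x s y t) (E x0 s0 y0 t0) < e"
      using e by (simp add: p dist_real_def abs_less_iff)
  qed
qed

text \<open>\<open>X t - X s\<close> bounds what links may gain over straight segments between the
  times \<open>s\<close> and \<open>t\<close>. \<open>B_cut\<close> makes chains splittable at any
  time, which supplies the midpoints from which continuity of the supremum follows.\<close>

locale links =
  fixes B :: "real \<Rightarrow> real \<Rightarrow> real \<Rightarrow> real \<Rightarrow> real \<Rightarrow> bool" and X :: "real \<Rightarrow> real" and M :: real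
  assumes B_less: "B x s y t v \<Longrightarrow> s < t"
    and B_cut: "B x s y t v \<Longrightarrow> s < r \<Longrightarrow> r < t \<Longrightarrow> \<exists>z v1 v2. B x s z r v1 \<and> B z r y t v2 \<and> v1 + v2 = v"
    and B_le: "B x s y t v \<Longrightarrow> v \<le> parab x s y t + (X t - X s)"
    and X_mono: "s \<le> t \<Longrightarrow> X s \<le> X t"
    and X_bound: "X t - X s \<le> M"
    and X_small: "0 < e \<Longrightarrow> \<exists>d>0. \<forall>s t. s < t \<and> t - s \<le> d \<longrightarrow> X t - X s \<le> e"
begin

definition E :: "real \<Rightarrow> real \<Rightarrow> real \<Rightarrow> real \<Rightarrow> real" where
  "E x s y t = Sup {v. chain B x s y t v}"

lemma chain_less: "chain B x s y t v \<Longrightarrow> s < t"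
  by (induction rule: chain.induct) (auto dest: B_less)

lemma chain_le: "chain B x s y t v \<Longrightarrow> v \<le> parab x s y t + (X t - X s)"
proof (induction rule: chain.induct)
  case (direct s t x y)
  then show ?case using X_mono [of s t] by simp
next
  case (link x s y t v)
  then show ?case by (rule B_le)
next
  case (append x s y t v z u w)
  then show ?case using parab_triangle [of s t u x y z] chain_less by fastforce
qed

lemma chain_cut:
  "chain B x s y t v \<Longrightarrow> s < r \<Longrightarrow> r < t \<Longrightarrow> \<exists>z v1 v2. chain B x s z r v1 \<and> chain B z r y t v2 \<and> v1 + v2 = v"
proof (induction rule: chain.induct)
  case (direct s t x y)
  then show ?case by (metis parab_cut chain.direct)
next
  case (link x s y t v)
  then show ?case using B_cut chain.link by metis
next
  case (append x s y t v z u w)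
  consider "r < t" | "r = t" | "t < r" by linarith
  then show ?case
  proof cases
    case 1
    then obtain z' v1 v2 where "chain B x s z' r v1" "chain B z' r y t v2" "v1 + v2 = v"
      using append by blast
    then show ?thesis using chain.append [OF _ append.hyps(2)] by (metis add.assoc)
  next
    case 2
    then show ?thesis using append.hyps by blast
  next
    case 3
    then obtain z' v1 v2 where "chain B y t z' r v1" "chain B z' r z u v2" "v1 + v2 = w"
      using append by blast
    then show ?thesis using chain.append [OF append.hyps(1)] by (metis add.assoc)
  qed
qed

lemma chain_bdd: "bdd_above {v. chain B x s y t v}"
  using chain_le by (intro bdd_aboveI) auto

lemma chain_le_E: "chain B x s y t v \<Longrightarrow> v \<le> E x s y t"
  unfolding E_def by (intro cSup_upper chain_bdd) simp

lemma E_leI: "s < t \<Longrightarrow> (\<And>v. chain B x s y t v \<Longrightarrow> v \<le> c) \<Longrightarrow> E x s y t \<le> c"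
  unfolding E_def using chain.direct [of s t B x y] by (intro cSup_least) auto

lemma less_E: "s < t \<Longrightarrow> c < E x s y t \<Longrightarrow> \<exists>v. chain B x s y t v \<and> c < v"
  using E_leI [of s t x y c] by force

lemma E_ge: "s < t \<Longrightarrow> parab x s y t \<le> E x s y t"
  by (simp add: chain_le_E chain.direct)

lemma E_le: "s < t \<Longrightarrow> E x s y t \<le> parab x s y t + (X t - X s)"
  by (intro E_leI chain_le)

lemma E_triangle:
  assumes "s < t" "t < u"
  shows "E x s y t + E y t z u \<le> E x s z u"
proof -
  have "v \<le> E x s z u - E y t z u" if v: "chain B x s y t v" for v
  proof -
    have "w \<le> E x s z u - v" if w: "chain B y t z u w" for w
      using chain_le_E [OF chain.append [OF v w]] by simp
    then have "E y t z u \<le> E x s z u - v" by (rule E_leI [OF assms(2)])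
    then show ?thesis by simp
  qed
  then have "E x s y t \<le> E x s z u - E y t z u" by (rule E_leI [OF assms(1)])
  then show ?thesis by simp
qed

lemma E_mid:
  assumes "s < r" "r < t" "0 < e"
  shows "\<exists>z. E x s y t - e \<le> E x s z r + E z r y t"
proof -
  obtain v where v: "chain B x s y t v" "E x s y t - e < v"
    using less_E [of s t "E x s y t - e" x y] assms by auto
  obtain z v1 v2 where "chain B x s z r v1" "chain B z r y t v2" "v1 + v2 = v"
    using chain_cut [OF v(1) assms(1,2)] by blast
  then show ?thesis using v(2) chain_le_E by (intro exI [of _ z]) (smt (verit))
qed

lemma E_continuous: "continuous_on {(x, s, y, t). s < t} (\<lambda>(x, s, y, t). E x s y t)"
proof (rule continuous_of_cuttable [where M = M])
  show "E x s y t \<le> parab x s y t + M" if "s < t" for x s y t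
    using E_le [OF that, of x y] X_bound [of t s] by linarith
  show "\<exists>d>0. \<forall>x s y t. s < t \<and> t - s \<le> d \<longrightarrow> E x s y t \<le> parab x s y t + e" if "0 < e" for e
    using X_small [OF that] E_le by (smt (verit))
qed (use E_triangle E_ge E_mid in auto)

lemma E_directed: "directed_metric (\<lambda>x s y t. ereal (E x s y t))"
  unfolding directed_metric_def
proof (intro conjI allI impI)
  have "(\<lambda>(x, s, y, t). ereal (E x s y t)) = (\<lambda>p. ereal ((\<lambda>(x, s, y, t). E x s y t) p))"
    by auto
  then show "continuous_on {(x, s, y, t). s < t} (\<lambda>(x, s, y, t). ereal (E x s y t))"
    using continuous_on_ereal [OF E_continuous] by simp
qed (auto simp: E_triangle)

lemma E_least:
  assumes e': "directed_metric e'" and dir: "\<And>x s y t. s < t \<Longrightarrow> dirichlet x s y t \<le> e' x s y t"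
    and B: "\<And>x s y t v. B x s y t v \<Longrightarrow> ereal v \<le> e' x s y t" and st: "s < t"
  shows "ereal (E x s y t) \<le> e' x s y t"
proof -
  have chain: "ereal v \<le> e' x s y t" if "chain B x s y t v" for x s y t v
    using that
  proof (induction rule: chain.induct)
    case (direct s t x y)
    then show ?case using dir by (simp add: dirichlet_eq_parab)
  next
    case (link x s y t v)
    then show ?case by (rule B)
  next
    case (append x s y t v z u w)
    then have "s < t" "t < u" using chain_less by blast+
    then have "e' x s y t + e' y t z u \<le> e' x s z u" using e' unfolding directed_metric_def by blast
    moreover have "ereal v + ereal w \<le> e' x s y t + e' y t z u" using append by (intro add_mono)
    ultimately show ?case by (metis order_trans plus_ereal.simps(1))
  qed
  show ?thesis
  proof (cases "e' x s y t")
    case (real c)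
    have "E x s y t \<le> c" using chain real by (intro E_leI [OF st]) force
    then show ?thesis using real by simp
  next
    case PInf
    then show ?thesis by simp
  next
    case MInf
    then show ?thesis using chain [OF chain.direct [OF st], of x y] by simp
  qed
qed

end

section \<open>Metrics planted along curves\<close>

lemma integral_add_adjacent:
  fixes f :: "real \<Rightarrow> real"
  assumes "f integrable_on {0..1}" "0 \<le> s" "s \<le> t" "t \<le> u" "u \<le> 1"
  shows "integral {s..t} f + integral {t..u} f = integral {s..u} f"
  using assms by (intro Henstock_Kurzweil_Integration.integral_combine)
    (auto intro: integrable_subinterval_real)

lemma integral_le_off_negligible:
  fixes f g :: "real \<Rightarrow> real"
  assumes f: "f integrable_on S" and g: "g integrable_on S" and Z: "negligible Z"
    and le: "\<And>x. x \<in> S - Z \<Longrightarrow> f x \<le> g x"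
  shows "integral S f \<le> integral S g"
proof -
  let ?h = "\<lambda>x. if x \<in> Z then g x else f x"
  have "?h integrable_on S" by (rule integrable_spike [OF f Z]) simp
  then have "integral S ?h \<le> integral S g" using g le by (intro integral_le) auto
  moreover have "integral S f = integral S ?h" by (rule integral_spike [OF Z]) simp
  ultimately show ?thesis by simp
qed

text \<open>Expand the integral of \<open>(g - c)^2\<close>, with \<open>c\<close> the mean of
  \<open>g\<close>.\<close>

lemma cauchy_schwarz_interval:
  fixes g :: "real \<Rightarrow> real"
  assumes g: "g integrable_on {s..t}" and g2: "(\<lambda>r. (g r)^2) integrable_on {s..t}" and st: "s < t"
  shows "(integral {s..t} g)^2 / (t - s) \<le> integral {s..t} (\<lambda>r. (g r)^2)"
proof -
  define c where "c = integral {s..t} g / (t - s)"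
  have "((\<lambda>r. (g r)^2 + (c^2 - 2 * c * g r)) has_integral
      (integral {s..t} (\<lambda>r. (g r)^2) + ((t - s) * c^2 - 2 * c * integral {s..t} g))) {s..t}"
    using st has_integral_const_real [of "c^2" s t]
    by (intro has_integral_add has_integral_diff has_integral_mult_right integrable_integral g g2) simp
  then have "0 \<le> integral {s..t} (\<lambda>r. (g r)^2) + ((t - s) * c^2 - 2 * c * integral {s..t} g)"
  proof (rule has_integral_nonneg)
    fix r assume "r \<in> {s..t}"
    have "(g r)^2 + (c^2 - 2 * c * g r) = (g r - c)^2" by (simp add: power2_eq_square algebra_simps)
    then show "0 \<le> (g r)^2 + (c^2 - 2 * c * g r)" by simp
  qed
  moreover have "(t - s) * c^2 - 2 * c * integral {s..t} g = - ((integral {s..t} g)^2 / (t - s))"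
    using st by (simp add: c_def power2_eq_square)
  ultimately show ?thesis by simp
qed

text \<open>Admissibility supplies some weak derivative \<open>g\<close>, whereas
  \<open>curve_metric\<close> refers to \<open>deriv \<gamma>\<close>. Lebesgue differentiation
  identifies the two off a negligible set, so integrals may be computed with either.\<close>

lemma admissible_curve_deriv:
  assumes "admissible_curve \<gamma>"
  shows "deriv \<gamma> absolutely_integrable_on {0..1}"
    and "(\<lambda>t. (deriv \<gamma> t)^2) absolutely_integrable_on {0..1}"
    and "0 \<le> s \<Longrightarrow> s \<le> t \<Longrightarrow> t \<le> 1 \<Longrightarrow> \<gamma> t - \<gamma> s = integral {s..t} (deriv \<gamma>)"
    and "continuous_on {0..1} \<gamma>"
proof -
  obtain g where g: "g absolutely_integrable_on {0..1}" and g2: "(\<lambda>t. (g t)^2) absolutely_integrable_on {0..1}"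
    and \<gamma>: "\<And>t. t \<in> {0..1} \<Longrightarrow> \<gamma> t = \<gamma> 0 + set_lebesgue_integral lebesgue {0..t} g"
    using assms unfolding admissible_curve_def by blast
  have gi: "g integrable_on {0..1}" using g by (rule set_lebesgue_integral_eq_integral)
  have \<gamma>': "\<gamma> t = \<gamma> 0 + integral {0..t} g" if "t \<in> {0..1}" for t
    using \<gamma> [OF that] set_lebesgue_integral_eq_integral(2) [OF absolutely_integrable_on_subinterval [OF g]] that by simp
  obtain N where N: "negligible N"
    and der: "\<And>x. x \<in> {0<..<1} - N \<Longrightarrow> ((\<lambda>t. integral {0..t} g) has_real_derivative g x) (at x)"
    using lebesgue_differentiation [OF gi] by blast
  \<comment> \<open>At 0 and 1 the two-sided derivative depends on values of \<open>\<gamma>\<close>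
    outside the unit interval, so these points join the exceptional set.\<close>
  define N' where "N' = N \<union> {0, 1}"
  have N': "negligible N'" unfolding N'_def using N by (simp add: negligible_insert)
  have dg: "deriv \<gamma> x = g x" if x: "x \<in> {0..1} - N'" for x
  proof (rule DERIV_imp_deriv)
    have x': "x \<in> {0<..<1} - N" using x by (auto simp: N'_def less_le)
    have "((\<lambda>t. \<gamma> 0 + integral {0..t} g) has_real_derivative g x) (at x)"
      using der [OF x'] by (auto intro!: derivative_eq_intros)
    then show "(\<gamma> has_real_derivative g x) (at x)"
    proof (rule has_field_derivative_transform_within_open)
      show "open {0<..<1::real}" "x \<in> {0<..<1}" using x' by auto
      show "\<gamma> 0 + integral {0..y} g = \<gamma> y" if "y \<in> {0<..<1}" for y
        using \<gamma>' [of y] that by simp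
    qed
  qed
  show "deriv \<gamma> absolutely_integrable_on {0..1}"
    by (rule absolutely_integrable_spike [OF g N']) (rule dg)
  show "(\<lambda>t. (deriv \<gamma> t)^2) absolutely_integrable_on {0..1}"
    by (rule absolutely_integrable_spike [OF g2 N']) (simp add: dg)
  show "\<gamma> t - \<gamma> s = integral {s..t} (deriv \<gamma>)" if "0 \<le> s" "s \<le> t" "t \<le> 1"
  proof -
    have "integral {s..t} (deriv \<gamma>) = integral {s..t} g"
      by (rule integral_spike [OF N']) (use dg that in auto)
    moreover have "integral {0..s} g + integral {s..t} g = integral {0..t} g"
      using that by (intro integral_add_adjacent gi) auto
    ultimately show ?thesis using \<gamma>' [of s] \<gamma>' [of t] that by simp
  qed
  have "continuous_on {0..1} (\<lambda>t. \<gamma> 0 + integral {0..t} g)"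
    by (intro continuous_intros indefinite_integral_continuous_1 gi)
  then show "continuous_on {0..1} \<gamma>"
    by (rule continuous_on_eq) (rule \<gamma>' [symmetric])
qed

lemma admissible_curve_energy:
  assumes \<gamma>: "admissible_curve \<gamma>" and "0 \<le> s" "s < t" "t \<le> 1"
  shows "- integral {s..t} (\<lambda>r. (deriv \<gamma> r)^2) \<le> parab (\<gamma> s) s (\<gamma> t) t"
proof -
  have "deriv \<gamma> absolutely_integrable_on {s..t}" "(\<lambda>r. (deriv \<gamma> r)^2) absolutely_integrable_on {s..t}"
    using admissible_curve_deriv(1,2) [OF \<gamma>] assms by (auto intro: absolutely_integrable_on_subinterval)
  then have "(integral {s..t} (deriv \<gamma>))^2 / (t - s) \<le> integral {s..t} (\<lambda>r. (deriv \<gamma> r)^2)"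
    using assms by (intro cauchy_schwarz_interval set_lebesgue_integral_eq_integral(1))
  then show ?thesis
    using admissible_curve_deriv(3) [OF \<gamma>, of s t] assms by (simp add: parab_def)
qed

lemma admissible_density_integrable:
  assumes "admissible_density \<rho>" shows "\<rho> absolutely_integrable_on {0..1}"
  using assms by (simp add: admissible_density_def)

definition curve_gain :: "(real \<Rightarrow> real) \<Rightarrow> (real \<Rightarrow> real) \<Rightarrow> real \<Rightarrow> real \<Rightarrow> real" where
  "curve_gain \<gamma> \<rho> s t = integral {s..t} \<rho> - integral {s..t} (\<lambda>r. (deriv \<gamma> r)^2)"

lemma curve_gain_add:
  assumes "admissible_curve \<gamma>" "admissible_density \<rho>" "0 \<le> s" "s \<le> t" "t \<le> u" "u \<le> 1"
  shows "curve_gain \<gamma> \<rho> s t + curve_gain \<gamma> \<rho> t u = curve_gain \<gamma> \<rho> s u"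
proof -
  have "integral {s..t} \<rho> + integral {t..u} \<rho> = integral {s..u} \<rho>"
    using assms admissible_density_integrable
    by (intro integral_add_adjacent set_lebesgue_integral_eq_integral(1))
  moreover have "integral {s..t} (\<lambda>r. (deriv \<gamma> r)^2) + integral {t..u} (\<lambda>r. (deriv \<gamma> r)^2) = integral {s..u} (\<lambda>r. (deriv \<gamma> r)^2)"
    using assms by (intro integral_add_adjacent set_lebesgue_integral_eq_integral(1) admissible_curve_deriv)
  ultimately show ?thesis by (simp add: curve_gain_def)
qed

lemma curve_metric_eq:
  assumes "admissible_curve \<gamma>" "admissible_density \<rho>"
  shows "curve_metric \<gamma> \<rho> x s y t =
    (if 0 \<le> s \<and> s < t \<and> t \<le> 1 \<and> x = \<gamma> s \<and> y = \<gamma> t then ereal (curve_gain \<gamma> \<rho> s t) else -\<infinity>)"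
proof -
  have "(LINT r:{s..t}|lebesgue. \<rho> r - (deriv \<gamma> r)^2) = curve_gain \<gamma> \<rho> s t" if "0 \<le> s" "s < t" "t \<le> 1"
  proof -
    have a: "\<rho> absolutely_integrable_on {s..t}" "(\<lambda>r. (deriv \<gamma> r)^2) absolutely_integrable_on {s..t}"
      using that by (intro absolutely_integrable_on_subinterval [OF admissible_density_integrable]
          absolutely_integrable_on_subinterval [OF admissible_curve_deriv(2)] assms; simp)+
    then have "(LINT r:{s..t}|lebesgue. \<rho> r - (deriv \<gamma> r)^2) =
        (LINT r:{s..t}|lebesgue. \<rho> r) - (LINT r:{s..t}|lebesgue. (deriv \<gamma> r)^2)"
      by (rule set_integral_diff)
    then show ?thesis
      using a by (simp add: curve_gain_def set_lebesgue_integral_eq_integral(2))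
  qed
  then show ?thesis by (auto simp: curve_metric_def)
qed

lemma planted_by_le:
  assumes e: "planted_by e I \<gamma> \<rho>" and e': "planted_by e' I \<gamma> \<rho>" and st: "s < t"
  shows "e x s y t \<le> e' x s y t"
proof -
  have "directed_metric e' \<and> (\<forall>x s y t. s < t \<longrightarrow> dirichlet x s y t \<le> e' x s y t \<and>
           (\<forall>i\<in>I. curve_metric (\<gamma> i) (\<rho> i) x s y t \<le> e' x s y t))"
    using e' by (simp add: planted_by_def)
  moreover have "\<And>e'. directed_metric e' \<and> (\<forall>x s y t. s < t \<longrightarrow> dirichlet x s y t \<le> e' x s y t \<and>
           (\<forall>i\<in>I. curve_metric (\<gamma> i) (\<rho> i) x s y t \<le> e' x s y t)) \<Longrightarrow> \<forall>x s y t. s < t \<longrightarrow> e x s y t \<le> e' x s y t"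
    using e by (simp add: planted_by_def)
  ultimately show ?thesis using st by blast
qed

section \<open>Plantings whose densities have a common integrable bound\<close>

definition curve_link :: "nat set \<Rightarrow> (nat \<Rightarrow> real \<Rightarrow> real) \<Rightarrow> (nat \<Rightarrow> real \<Rightarrow> real) \<Rightarrow>
    real \<Rightarrow> real \<Rightarrow> real \<Rightarrow> real \<Rightarrow> real \<Rightarrow> bool" where
  "curve_link I \<gamma> \<rho> x s y t v \<longleftrightarrow>
     (\<exists>i\<in>I. 0 \<le> s \<and> s < t \<and> t \<le> 1 \<and> x = \<gamma> i s \<and> y = \<gamma> i t \<and> v = curve_gain (\<gamma> i) (\<rho> i) s t)"

text \<open>One integrable \<open>R\<close> above all densities bounds the gain of every
  concatenation of pieces of different curves, which keeps the supremum finite and continuous. With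
  an empty index set the locale just provides the cumulative function \<open>X\<close> of
  \<open>R\<close>.\<close>

locale dominated_planting =
  fixes I :: "nat set" and \<gamma> \<rho> :: "nat \<Rightarrow> real \<Rightarrow> real" and R :: "real \<Rightarrow> real"
  assumes curve: "i \<in> I \<Longrightarrow> admissible_curve (\<gamma> i)"
    and density: "i \<in> I \<Longrightarrow> admissible_density (\<rho> i)"
    and R_int: "R absolutely_integrable_on {0..1}"
    and R_nonneg: "0 \<le> R t"
    and R_dom: "\<exists>Z. negligible Z \<and> (\<forall>t\<in>{0..1} - Z. \<forall>i\<in>I. \<rho> i t \<le> R t)"
begin

text \<open>Times are clamped because nothing is planted outside the unit interval, while chains run
  over all times.\<close>

definition X :: "real \<Rightarrow> real" where
  "X t = integral {0..max 0 (min 1 t)} R"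

lemma R_integrable: "R integrable_on {0..1}"
  using R_int by (rule set_lebesgue_integral_eq_integral)

lemma R_sub: "0 \<le> s \<Longrightarrow> t \<le> 1 \<Longrightarrow> R integrable_on {s..t}"
  by (intro integrable_subinterval_real [OF R_integrable]) auto

lemma X_diff:
  assumes "0 \<le> s" "s \<le> t" "t \<le> 1"
  shows "X t - X s = integral {s..t} R"
  using integral_add_adjacent [OF R_integrable, of 0 s t] assms by (simp add: X_def)

lemma X_mono: "s \<le> t \<Longrightarrow> X s \<le> X t"
proof -
  assume "s \<le> t"
  then have "integral {0..max 0 (min 1 s)} R + integral {max 0 (min 1 s)..max 0 (min 1 t)} R = integral {0..max 0 (min 1 t)} R"
    by (intro integral_add_adjacent R_integrable) auto
  moreover have "0 \<le> integral {max 0 (min 1 s)..max 0 (min 1 t)} R"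
    by (intro integral_nonneg R_sub R_nonneg) auto
  ultimately show ?thesis by (simp add: X_def)
qed

lemma X_bound: "X t - X s \<le> integral {0..1} R"
proof -
  have "X t \<le> X (max t 1)" "X (min s 0) \<le> X s" by (auto intro: X_mono)
  then show ?thesis by (auto simp: X_def)
qed

lemma X_small:
  assumes "0 < e"
  shows "\<exists>d>0. \<forall>s t. s < t \<and> t - s \<le> d \<longrightarrow> X t - X s \<le> e"
proof -
  have "uniformly_continuous_on {0..1} (\<lambda>t. integral {0..t} R)"
    by (intro compact_uniformly_continuous indefinite_integral_continuous_1 R_integrable) auto
  then obtain d where d: "0 < d" and D: "\<And>s t. s \<in> {0..1} \<Longrightarrow> t \<in> {0..1} \<Longrightarrow> dist t s < d \<Longrightarrow>
      dist (integral {0..t} R) (integral {0..s} R) < e"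
    unfolding uniformly_continuous_on_def using assms by metis
  have "X t - X s \<le> e" if "s < t" "t - s \<le> d / 2" for s t
  proof -
    have "dist (integral {0..max 0 (min 1 t)} R) (integral {0..max 0 (min 1 s)} R) < e"
      using that d by (intro D) (auto simp: dist_real_def)
    then show ?thesis by (simp add: X_def dist_real_def)
  qed
  then show ?thesis using d by (intro exI [of _ "d / 2"]) auto
qed

lemma density_integrable_on: "i \<in> I \<Longrightarrow> 0 \<le> s \<Longrightarrow> t \<le> 1 \<Longrightarrow> \<rho> i integrable_on {s..t}"
  by (intro set_lebesgue_integral_eq_integral(1)
      absolutely_integrable_on_subinterval [OF admissible_density_integrable [OF density]]) auto

lemma integral_density_le:
  assumes "i \<in> I" "0 \<le> s" "s \<le> t" "t \<le> 1"
  shows "integral {s..t} (\<rho> i) \<le> X t - X s"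
proof -
  obtain Z where Z: "negligible Z" "\<And>r. r \<in> {0..1} - Z \<Longrightarrow> \<rho> i r \<le> R r" using R_dom assms by blast
  have "\<rho> i integrable_on {s..t}" using assms by (intro density_integrable_on)
  moreover have "R integrable_on {s..t}" using R_sub assms by blast
  ultimately have "integral {s..t} (\<rho> i) \<le> integral {s..t} R"
    by (rule integral_le_off_negligible [OF _ _ Z(1)]) (use Z assms in auto)
  then show ?thesis using X_diff assms by simp
qed

lemma curve_gain_le:
  assumes "i \<in> I" "0 \<le> s" "s < t" "t \<le> 1"
  shows "curve_gain (\<gamma> i) (\<rho> i) s t \<le> parab (\<gamma> i s) s (\<gamma> i t) t + (X t - X s)"
  using integral_density_le [of i s t] admissible_curve_energy [OF curve, of i s t] assms
  by (simp add: curve_gain_def)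

sublocale links "curve_link I \<gamma> \<rho>" X "integral {0..1} R"
proof
  show "\<exists>z v1 v2. curve_link I \<gamma> \<rho> x s z r v1 \<and> curve_link I \<gamma> \<rho> z r y t v2 \<and> v1 + v2 = v"
    if l: "curve_link I \<gamma> \<rho> x s y t v" and r: "s < r" "r < t" for x s y t v r
  proof -
    obtain i where i: "i \<in> I" "0 \<le> s" "s < t" "t \<le> 1" "x = \<gamma> i s" "y = \<gamma> i t" "v = curve_gain (\<gamma> i) (\<rho> i) s t"
      using l unfolding curve_link_def by blast
    have "curve_link I \<gamma> \<rho> x s (\<gamma> i r) r (curve_gain (\<gamma> i) (\<rho> i) s r)"
      "curve_link I \<gamma> \<rho> (\<gamma> i r) r y t (curve_gain (\<gamma> i) (\<rho> i) r t)"
      unfolding curve_link_def using i r by (auto intro!: bexI [of _ i])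
    moreover have "curve_gain (\<gamma> i) (\<rho> i) s r + curve_gain (\<gamma> i) (\<rho> i) r t = v"
      using curve_gain_add [OF curve density, of i i s r t] i r by simp
    ultimately show ?thesis by blast
  qed
qed (auto simp: curve_link_def X_mono X_bound X_small curve_gain_le)

definition planted :: dmetric where
  "planted x s y t = ereal (E x s y t)"

lemma planted_by_planted: "planted_by planted I \<gamma> \<rho>"
  unfolding planted_by_def
proof (intro conjI ballI allI impI)
  show "directed_metric planted" unfolding planted_def [abs_def] by (rule E_directed)
  show "dirichlet x s y t \<le> planted x s y t" if "s < t" for x s y t
    using E_ge that by (simp add: dirichlet_eq_parab planted_def)
  show "curve_metric (\<gamma> i) (\<rho> i) x s y t \<le> planted x s y t" if "s < t" "i \<in> I" for i x s y t
    using that curve_metric_eq [OF curve density, of i i] unfolding planted_def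
    by (auto intro!: chain_le_E chain.link simp: curve_link_def)
  show "planted x s y t \<le> e' x s y t"
    if A: "directed_metric e' \<and> (\<forall>x s y t. s < t \<longrightarrow> dirichlet x s y t \<le> e' x s y t \<and>
           (\<forall>i\<in>I. curve_metric (\<gamma> i) (\<rho> i) x s y t \<le> e' x s y t))" and st: "s < t" for e' x s y t
    unfolding planted_def
  proof (rule E_least)
    show "ereal v \<le> e' x s y t" if l: "curve_link I \<gamma> \<rho> x s y t v" for x s y t v
    proof -
      obtain i where i: "i \<in> I" "0 \<le> s" "s < t" "t \<le> 1" "x = \<gamma> i s" "y = \<gamma> i t" "v = curve_gain (\<gamma> i) (\<rho> i) s t"
        using l unfolding curve_link_def by blast
      then have "curve_metric (\<gamma> i) (\<rho> i) x s y t = ereal v"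
        using curve_metric_eq [OF curve density] by simp
      moreover have "curve_metric (\<gamma> i) (\<rho> i) x s y t \<le> e' x s y t" using A i(1,3) by simp
      ultimately show ?thesis by simp
    qed
  next
    show "directed_metric e'" using A by simp
    show "dirichlet x s y t \<le> e' x s y t" if "s < t" for x s y t using A that by simp
    show "s < t" by (rule st)
  qed
next
  show "admissible_curve (\<gamma> i)" "admissible_density (\<rho> i)" if "i \<in> I" for i
    using curve density that by simp_all
qed

text \<open>Both metrics are least for the same data. From here on, a metric with a given
  representation is computed through chains.\<close>

lemma planted_by_unique:
  assumes "planted_by e I \<gamma> \<rho>" "s < t"
  shows "e x s y t = ereal (E x s y t)"
proof -
  have "e x s y t \<le> planted x s y t" "planted x s y t \<le> e x s y t"
    using planted_by_le [OF assms(1) planted_by_planted assms(2)]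
      planted_by_le [OF planted_by_planted assms] by simp_all
  then have "e x s y t = planted x s y t" by simp
  then show ?thesis by (simp add: planted_def)
qed

end

section \<open>The optimal curve\<close>

locale optimum =
  fixes a :: real
  assumes a_pos: "0 < a" and a_less: "a < 1/2"
begin

definition q :: real where "q = sqrt (2 * a)"
text \<open>\<open>\<beta>\<close> is fixed by \<open>F a = 1\<close>: before \<open>a\<close> the
  slope of \<open>G\<close> is \<open>3 * \<beta>\<close>, and subtracting the drift
  \<open>k\<close> must leave \<open>1 / a\<close>. The drift in turn is fixed by
  \<open>F 1 = 0\<close>.\<close>

definition \<beta> :: real where "\<beta> = 1 / (a * (3 - 2 * q))"
definition k :: real where "k = 2 * q * \<beta>"

definition s :: "real \<Rightarrow> real" where
  "s t = \<beta> * q / sqrt (max t (2 * a))"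

text \<open>Clamping splices three pieces of slopes \<open>3 * \<beta>\<close>,
  \<open>\<beta>\<close> and \<open>\<beta> * q / sqrt t\<close>, which change at \<open>a\<close>
  and at \<open>2 * a\<close>.\<close>

definition G :: "real \<Rightarrow> real" where
  "G t = 3 * \<beta> * min t a + \<beta> * (min (max t a) (2 * a) - a) + 2 * \<beta> * q * (sqrt (max t (2 * a)) - q)"

definition F :: "real \<Rightarrow> real" where "F t = G t - k * t"

definition rho :: "real \<Rightarrow> real" where "rho t = (s t)^2"

text \<open>Length collected along \<open>F\<close> since time 0, the primitive of
  \<open>rho\<close> minus the squared slope. After \<open>a\<close> the slope is
  \<open>s - k\<close>, which leaves \<open>2 * k * s - k^2\<close>; the first summand is the loss
  from the steeper start.\<close>

definition Lam :: "real \<Rightarrow> real" where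
  "Lam t = - 8 * \<beta>^2 * min t a + 2 * k * G t - k^2 * t"

lemma q: "0 < q" "q < 1" "q^2 = 2 * a" "q * q = 2 * a"
  using a_pos a_less by (auto simp: q_def real_sqrt_lt_1_iff)

lemma \<beta>: "0 < \<beta>" "\<beta> * a * (3 - 2 * q) = 1" "3 * \<beta> = 1 / a + k"
proof -
  have "3 - 2 * q \<noteq> 0" using q by linarith
  then show b: "\<beta> * a * (3 - 2 * q) = 1" using a_pos by (simp add: \<beta>_def)
  show "0 < \<beta>" using q a_pos by (simp add: \<beta>_def)
  have "(3 * \<beta> - k) * a = 1" using b by (simp add: k_def algebra_simps)
  then show "3 * \<beta> = 1 / a + k" using a_pos by (simp add: field_simps)
qed

lemma sqrt_q: "2 * a \<le> t \<Longrightarrow> q \<le> sqrt t"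
  by (simp add: q_def)

lemma s_le: "t \<le> 2 * a \<Longrightarrow> s t = \<beta>"
  using q by (simp add: s_def max_def q_def [symmetric])

lemma s_ge: "2 * a \<le> t \<Longrightarrow> s t = \<beta> * q / sqrt t"
  by (simp add: s_def max_def)

lemma s_pos: "0 < s t"
  using q \<beta> a_pos by (simp add: s_def)

lemma s_antimono: "u \<le> v \<Longrightarrow> s v \<le> s u"
  unfolding s_def using q \<beta> a_pos by (intro divide_left_mono) (auto simp: less_max_iff_disj)

lemma s_le_\<beta>: "s t \<le> \<beta>"
  using s_antimono [of "min t a" t] s_le [of "min t a"] a_pos by simp

lemma s_continuous: "continuous_on A s"
  unfolding s_def using a_pos by (intro continuous_intros) (auto simp: less_max_iff_disj)

lemma s_isCont: "isCont s t"
  using s_continuous [of UNIV] by (simp add: continuous_on_eq_continuous_at)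

lemma G_continuous: "continuous_on A G"
  unfolding G_def by (intro continuous_intros)

lemma F_continuous: "continuous_on A F"
  unfolding F_def by (intro continuous_intros G_continuous)

lemma Lam_continuous: "continuous_on A Lam"
  unfolding Lam_def by (intro continuous_intros G_continuous)

lemma rho_continuous: "continuous_on A rho"
  unfolding rho_def by (intro continuous_intros s_continuous)

lemma G_le_a: "t \<le> a \<Longrightarrow> G t = 3 * \<beta> * t"
  using a_pos by (simp add: G_def max_def q_def [symmetric])

lemma G_mid:
  assumes "a \<le> t" "t \<le> 2 * a" shows "G t = \<beta> * (t + 2 * a)"
proof -
  have "sqrt (max t (2 * a)) = q" using assms by (simp add: q_def max_absorb2)
  then show ?thesis using assms by (simp add: G_def algebra_simps)
qed

lemma G_ge: "2 * a \<le> t \<Longrightarrow> G t = 2 * \<beta> * q * sqrt t"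
proof -
  assume t: "2 * a \<le> t"
  then have "G t = 4 * \<beta> * a + 2 * \<beta> * q * sqrt t - 2 * \<beta> * (q * q)"
    using a_pos by (simp add: G_def algebra_simps)
  then show ?thesis unfolding q by simp
qed

lemma F_le_a: "t \<le> a \<Longrightarrow> F t = t / a"
  using \<beta>(3) by (simp add: F_def G_le_a algebra_simps)

lemma F_values: "F 0 = 0" "F a = 1" "F 1 = 0"
  using F_le_a [of 0] F_le_a [of a] G_ge [of 1] a_pos a_less by (auto simp: F_def k_def)

lemma Lam_values: "Lam 0 = 0" "Lam 1 = 0"
proof -
  show "Lam 0 = 0" using a_pos G_le_a [of 0] by (simp add: Lam_def)
  have "k^2 = 4 * \<beta>^2 * (q * q)" by (simp add: k_def power2_eq_square)
  then have "k^2 = 8 * \<beta>^2 * a" unfolding q by simp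
  moreover have "G 1 = k" using G_ge [of 1] a_less by (simp add: k_def)
  ultimately show "Lam 1 = 0" using a_less by (simp add: Lam_def power2_eq_square)
qed

lemma G_deriv_lt: "t < a \<Longrightarrow> (G has_real_derivative 3 * \<beta>) (at t)"
  by (rule has_field_derivative_transform_within_open [where f = "\<lambda>t. 3 * \<beta> * t" and S = "{..<a}"])
    (auto intro!: derivative_eq_intros simp: G_le_a)

lemma G_deriv_gt:
  assumes "a < t" shows "(G has_real_derivative s t) (at t)"
proof -
  let ?h = "\<lambda>t. 2 * \<beta> * q * sqrt t"
  have h: "(?h has_real_derivative s t) (at t)" if "2 * a \<le> t" for t
    using that a_pos by (auto intro!: derivative_eq_intros simp: s_ge field_simps)
  have l: "((\<lambda>t. \<beta> * (t + 2 * a)) has_real_derivative s t) (at t)" if "t \<le> 2 * a" for t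
    using that by (auto intro!: derivative_eq_intros simp: s_le)
  consider "t < 2 * a" | "t = 2 * a" | "2 * a < t" by linarith
  then show ?thesis
  proof cases
    case 1
    show ?thesis
      by (rule has_field_derivative_transform_within_open [OF l, where S = "{a<..<2 * a}"])
        (use 1 assms in \<open>auto simp: G_mid\<close>)
  next
    case 2
    have "((\<lambda>y. (G y - G t) / (y - t)) \<longlongrightarrow> s t) (at_left t)"
    proof (rule tendsto_cong [THEN iffD1])
      have "((\<lambda>y. (\<beta> * (y + 2 * a) - \<beta> * (t + 2 * a)) / (y - t)) \<longlongrightarrow> s t) (at t)"
        using l [of t] 2 by (simp add: has_field_derivative_iff)
      then show "((\<lambda>y. (\<beta> * (y + 2 * a) - \<beta> * (t + 2 * a)) / (y - t)) \<longlongrightarrow> s t) (at_left t)"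
        by (simp add: filterlim_at_split)
      have "\<forall>\<^sub>F y in at_left t. y \<in> {a<..<t}"
        using assms by (rule eventually_at_left_real)
      then show "\<forall>\<^sub>F y in at_left t. (\<beta> * (y + 2 * a) - \<beta> * (t + 2 * a)) / (y - t) = (G y - G t) / (y - t)"
        by eventually_elim (use 2 a_pos in \<open>simp add: G_mid\<close>)
    qed
    moreover have "((\<lambda>y. (G y - G t) / (y - t)) \<longlongrightarrow> s t) (at_right t)"
    proof (rule tendsto_cong [THEN iffD1])
      have "((\<lambda>y. (?h y - ?h t) / (y - t)) \<longlongrightarrow> s t) (at t)"
        using h [of t] 2 by (simp add: has_field_derivative_iff)
      then show "((\<lambda>y. (?h y - ?h t) / (y - t)) \<longlongrightarrow> s t) (at_right t)"
        by (simp add: filterlim_at_split)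
      have "\<forall>\<^sub>F y in at_right t. y \<in> {t<..<t + 1}"
        by (rule eventually_at_right_real) simp
      then show "\<forall>\<^sub>F y in at_right t. (?h y - ?h t) / (y - t) = (G y - G t) / (y - t)"
        by eventually_elim (use 2 in \<open>simp add: G_ge\<close>)
    qed
    ultimately show ?thesis
      by (simp add: has_field_derivative_iff filterlim_at_split)
  next
    case 3
    show ?thesis
      by (rule has_field_derivative_transform_within_open [OF h, where S = "{2 * a<..}"])
        (use 3 in \<open>auto simp: G_ge\<close>)
  qed
qed

definition F' :: "real \<Rightarrow> real" where
  "F' t = s t - k + 2 * \<beta> * (if t \<le> a then 1 else 0)"

lemma F_deriv: "t \<noteq> a \<Longrightarrow> (F has_real_derivative F' t) (at t)"
proof -
  assume "t \<noteq> a"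
  have "(G has_real_derivative F' t + k) (at t)"
  proof (cases "t < a")
    case True
    then show ?thesis using G_deriv_lt [OF True] s_le [of t] a_pos by (simp add: F'_def)
  next
    case False
    then show ?thesis using G_deriv_gt [of t] \<open>t \<noteq> a\<close> by (simp add: F'_def)
  qed
  from DERIV_diff [OF this DERIV_cmult [OF DERIV_ident, of k]]
  show ?thesis by (simp add: F_def [abs_def])
qed

lemma deriv_F: "t \<noteq> a \<Longrightarrow> deriv F t = F' t"
  by (intro DERIV_imp_deriv F_deriv)

lemma Lam_deriv:
  assumes "t \<noteq> a" shows "(Lam has_real_derivative rho t - (F' t)^2) (at t)"
proof (cases "t < a")
  case True
  have "((\<lambda>t. - 8 * \<beta>^2 * t + 2 * k * G t - k^2 * t) has_real_derivative rho t - (F' t)^2) (at t)"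
    using True a_pos
    by (auto intro!: derivative_eq_intros G_deriv_lt simp: rho_def F'_def s_le power2_eq_square algebra_simps)
  then show ?thesis
    by (rule has_field_derivative_transform_within_open [where S = "{..<a}"])
      (use True in \<open>auto simp: Lam_def\<close>)
next
  case False
  then have ta: "a < t" using assms by simp
  have "((\<lambda>t. - 8 * \<beta>^2 * a + 2 * k * G t - k^2 * t) has_real_derivative rho t - (F' t)^2) (at t)"
    using ta by (auto intro!: derivative_eq_intros G_deriv_gt simp: rho_def F'_def power2_eq_square algebra_simps)
  then show ?thesis
    by (rule has_field_derivative_transform_within_open [where S = "{a<..}"])
      (use ta in \<open>auto simp: Lam_def\<close>)
qed

section \<open>Admissibility of the optimal curve and its length\<close>

lemma step_integrable: "(\<lambda>t. if t \<le> a then 1 else 0 :: real) absolutely_integrable_on {0..1}"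
proof -
  have "((\<lambda>t. if t \<le> a then 1 else 0 :: real) has_integral (min 1 a - min 0 a)) {0..1}"
  proof (rule fundamental_theorem_of_calculus_interior_strong [where S = "{a}"])
    show "((\<lambda>t. min t a) has_vector_derivative (if t \<le> a then 1 else 0)) (at t)" if "t \<in> {0<..<1} - {a}" for t
    proof (cases "t < a")
      case True
      have "((\<lambda>t. min t a) has_real_derivative 1) (at t)"
        by (rule has_field_derivative_transform_within_open [where f = "\<lambda>t. t" and S = "{..<a}"])
          (use True in \<open>auto intro!: derivative_eq_intros\<close>)
      then show ?thesis using True by (simp add: has_real_derivative_iff_has_vector_derivative)
    next
      case False
      then have "a < t" using that by auto
      have "((\<lambda>t. min t a) has_real_derivative 0) (at t)"
        by (rule has_field_derivative_transform_within_open [where f = "\<lambda>t. a" and S = "{a<..}"])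
          (use \<open>a < t\<close> in \<open>auto intro!: derivative_eq_intros\<close>)
      then show ?thesis using \<open>a < t\<close> by (simp add: has_real_derivative_iff_has_vector_derivative)
    qed
  qed (auto intro!: continuous_intros)
  then show ?thesis by (subst absolutely_integrable_on_iff_nonneg) (auto simp: integrable_on_def)
qed

lemma F'_integrable:
  "F' absolutely_integrable_on {0..1}" "(\<lambda>t. (F' t)^2) absolutely_integrable_on {0..1}"
proof -
  have s: "(\<lambda>t. s t - k) absolutely_integrable_on {0..1}" "(\<lambda>t. (s t - k)^2) absolutely_integrable_on {0..1}"
    by (intro absolutely_integrable_continuous_real continuous_intros s_continuous)+
  have c: "(\<lambda>t. c * (if t \<le> a then 1 else 0 :: real)) absolutely_integrable_on {0..1}" for c
    by (rule set_integrable_mult_right) (rule step_integrable)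
  show "F' absolutely_integrable_on {0..1}"
    unfolding F'_def [abs_def] by (rule set_integral_add(1) [OF s(1) c])
  have "(\<lambda>t. (F' t)^2) = (\<lambda>t. (s t - k)^2 + (4 * \<beta> * (\<beta> - k) + 4 * \<beta>^2) * (if t \<le> a then 1 else 0))"
    using a_pos by (auto simp: F'_def fun_eq_iff s_le power2_eq_square algebra_simps)
  then show "(\<lambda>t. (F' t)^2) absolutely_integrable_on {0..1}"
    using set_integral_add(1) [OF s(2) c [of "4 * \<beta> * (\<beta> - k) + 4 * \<beta>^2"]] by simp
qed

lemma F_admissible: "admissible_curve F"
  unfolding admissible_curve_def
proof (intro exI conjI ballI)
  show "set_integrable lebesgue {0..1} F'" "set_integrable lebesgue {0..1} (\<lambda>t. (F' t)^2)"
    using F'_integrable by simp_all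
  fix t :: real assume t: "t \<in> {0..1}"
  have "(F' has_integral (F t - F 0)) {0..t}"
    by (rule fundamental_theorem_of_calculus_interior_strong [where S = "{a}"])
      (use t F_deriv F_continuous in \<open>auto simp: has_real_derivative_iff_has_vector_derivative [symmetric]\<close>)
  then have "integral {0..t} F' = F t - F 0" by (rule integral_unique)
  moreover have "set_lebesgue_integral lebesgue {0..t} F' = integral {0..t} F'"
    using t by (intro set_lebesgue_integral_eq_integral(2) absolutely_integrable_on_subinterval [OF F'_integrable(1)]) auto
  ultimately show "F t = F 0 + set_lebesgue_integral lebesgue {0..t} F'" by simp
qed

lemma rho_integrable: "rho absolutely_integrable_on {0..1}"
  by (intro absolutely_integrable_continuous_real rho_continuous)

lemma rho_integrable_on: "rho integrable_on {u..v}"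
  by (intro integrable_continuous_real rho_continuous)

lemma rho_admissible: "admissible_density rho"
  using rho_integrable by (simp add: admissible_density_def rho_def)

lemma curve_gain_F:
  assumes "0 \<le> u" "u \<le> v" "v \<le> 1"
  shows "curve_gain F rho u v = Lam v - Lam u"
proof -
  have d2: "(\<lambda>t. (deriv F t)^2) integrable_on {u..v}"
    using assms by (intro set_lebesgue_integral_eq_integral(1)
      absolutely_integrable_on_subinterval [OF admissible_curve_deriv(2) [OF F_admissible]]) auto
  have "((\<lambda>t. rho t - (deriv F t)^2) has_integral (Lam v - Lam u)) {u..v}"
    by (rule fundamental_theorem_of_calculus_interior_strong [where S = "{a}"])
      (use assms Lam_deriv Lam_continuous deriv_F in \<open>auto simp: has_real_derivative_iff_has_vector_derivative [symmetric]\<close>)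
  then have "integral {u..v} (\<lambda>t. rho t - (deriv F t)^2) = Lam v - Lam u" by (rule integral_unique)
  then show ?thesis
    using Henstock_Kurzweil_Integration.integral_diff [OF rho_integrable_on d2] by (simp add: curve_gain_def)
qed

section \<open>Chords of the optimal curve\<close>

text \<open>Adding the drift \<^term>\<open>k * t\<close> turns \<^const>\<open>F\<close> into \<^const>\<open>G\<close>, whose slope equals
  \<^const>\<open>s\<close> after time \<^term>\<open>a\<close>, so that following \<^const>\<open>G\<close> there neither gains nor loses.\<close>

lemma parab_shear:
  assumes "u < v"
  shows "parab (F u) u (F v) v = - ((G v - G u)^2 / (v - u)) + 2 * k * (G v - G u) - k^2 * (v - u)"
proof -
  have "F v - F u = (G v - G u) - k * (v - u)" by (simp add: F_def algebra_simps)
  then have "(F v - F u)^2 = ((G v - G u) - k * (v - u))^2" by simp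
  also have "\<dots> = (G v - G u)^2 - (2 * k * (G v - G u) - k^2 * (v - u)) * (v - u)"
    by (simp add: power2_eq_square algebra_simps)
  finally have "(F v - F u)^2 / (v - u) = (G v - G u)^2 / (v - u) - (2 * k * (G v - G u) - k^2 * (v - u))"
    using assms by (simp add: diff_divide_distrib)
  then show ?thesis by (simp add: parab_def)
qed

text \<open>For \<open>v \<le> 2 * a\<close> the two sides differ by
  \<open>\<beta>^2 * (2 * a - u - v)^2\<close>. Later the difference vanishes at
  \<open>u = 0\<close>: from time \<open>2 * a\<close> on, straight segments from the origin tie
  with the curve, so there the constraint of the dual problem is active.\<close>

lemma G_chord_bound:
  assumes "0 \<le> u" "u \<le> a" "a \<le> v"
  shows "\<beta>^2 * (8 * ((a - u) * (v - u))) \<le> (G v - G u)^2"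
proof (cases "v \<le> 2 * a")
  case True
  have eq: "G v - G u = \<beta> * (v + 2 * a - 3 * u)"
    using G_mid [of v] G_le_a [of u] True assms by (simp add: algebra_simps)
  have "8 * ((a - u) * (v - u)) \<le> (v + 2 * a - 3 * u)^2"
    using zero_le_power2 [of "2 * a - u - v"] by (simp add: power2_eq_square algebra_simps)
  then show ?thesis unfolding eq power_mult_distrib by (rule mult_left_mono) simp
next
  case False
  define w where "w = sqrt v"
  have w: "q \<le> w" "w * w = v" using False sqrt_q [of v] a_pos by (auto simp: w_def)
  have eq: "G v - G u = \<beta> * (2 * q * w - 3 * u)"
    using G_ge [of v] G_le_a [of u] False assms by (simp add: w_def algebra_simps)
  have "(2 * q * w - 3 * u)^2 - 8 * ((a - u) * (v - u)) = u * (u + 4 * ((w - q) * (2 * w - q)))"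
    using q(4) w(2) by algebra
  moreover have "0 \<le> u * (u + 4 * ((w - q) * (2 * w - q)))"
    using assms(1) w(1) q(1) by (intro mult_nonneg_nonneg add_nonneg_nonneg) auto
  ultimately have "8 * ((a - u) * (v - u)) \<le> (2 * q * w - 3 * u)^2" by linarith
  then show ?thesis unfolding eq power_mult_distrib by (rule mult_left_mono) simp
qed

text \<open>No straight shortcut between points of the curve beats following it, which will make
  \<open>F\<close> a geodesic. After shearing, the chord energy of \<open>G\<close> is compared with
  the loss \<open>8 * \<beta>^2\<close> per unit of time before \<open>a\<close>.\<close>

lemma parab_le_Lam:
  assumes "0 \<le> u" "u < v" "v \<le> 1"
  shows "parab (F u) u (F v) v \<le> Lam v - Lam u"
proof -
  have "8 * \<beta>^2 * (min v a - min u a) \<le> (G v - G u)^2 / (v - u)"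
  proof -
    consider "a \<le> u" | "v \<le> a" | "u \<le> a" "a \<le> v" by linarith
    then have "8 * \<beta>^2 * (min v a - min u a) * (v - u) \<le> (G v - G u)^2"
    proof cases
      case 1
      then show ?thesis using assms by simp
    next
      case 2
      then have "(G v - G u)^2 = 9 * (\<beta>^2 * (v - u)^2)"
        using assms by (simp add: G_le_a power2_eq_square algebra_simps)
      moreover have "0 \<le> \<beta>^2 * (v - u)^2" by simp
      moreover have "8 * \<beta>^2 * (min v a - min u a) * (v - u) = 8 * (\<beta>^2 * (v - u)^2)"
        using 2 assms by (simp add: power2_eq_square)
      ultimately show ?thesis by linarith
    next
      case 3
      have "8 * \<beta>^2 * (a - u) * (v - u) = \<beta>^2 * (8 * ((a - u) * (v - u)))" by simp
      then show ?thesis using 3 G_chord_bound [of u v] assms by simp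
    qed
    then show ?thesis using assms by (simp add: pos_le_divide_eq)
  qed
  then show ?thesis using parab_shear [OF assms(2)] by (simp add: Lam_def algebra_simps)
qed

lemma rho_lipschitz:
  assumes "u \<le> v" shows "rho u - rho v \<le> \<beta>^2 / (2 * a) * (v - u)"
proof -
  define x y where "x = max u (2 * a)" and "y = max v (2 * a)"
  have xy: "2 * a \<le> x" "x \<le> y" "y - x \<le> v - u" using assms by (auto simp: x_def y_def)
  have pos: "0 < x" "0 < y" using xy a_pos by auto
  have r: "rho t = \<beta>^2 * (2 * a) / max t (2 * a)" for t
    using a_pos by (simp add: rho_def s_def power_mult_distrib power_divide q max_def)
  have "rho u - rho v = \<beta>^2 * ((2 * a) * (y - x) / (x * y))"
    unfolding r [of u, folded x_def] r [of v, folded y_def] using pos by (simp add: field_simps)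
  also have "\<dots> \<le> \<beta>^2 * ((v - u) / (2 * a))"
  proof (intro mult_left_mono)
    have "(2 * a) * (2 * a) \<le> x * y" using xy a_pos by (intro mult_mono) auto
    then have "(2 * a) * (y - x) / (x * y) \<le> (2 * a) * (v - u) / ((2 * a) * (2 * a))"
      using xy a_pos assms by (intro frac_le mult_left_mono) auto
    then show "(2 * a) * (y - x) / (x * y) \<le> (v - u) / (2 * a)"
      using mult_divide_mult_cancel_left [of "2 * a" "v - u" "2 * a"] a_pos by linarith
  qed simp
  finally show ?thesis by simp
qed

text \<open>A converse to \<open>parab_le_Lam\<close> with the density added. The error is quadratic
  in the length of the interval and disappears under subdivision. Intervals across \<open>a\<close>
  are excluded because there the chord saves an amount of first order by cutting the corner.\<close>

lemma energy_defect:
  assumes "0 \<le> u" "u < v" "v \<le> 1" "v \<le> a \<or> a \<le> u"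
  shows "integral {u..v} rho + parab (F u) u (F v) v \<le> (Lam v - Lam u) + \<beta>^2 / (2 * a) * (v - u)^2"
proof (cases "v \<le> a")
  case True
  have "integral {u..v} rho = integral {u..v} (\<lambda>_. \<beta>^2)"
    using True a_pos by (intro Henstock_Kurzweil_Integration.integral_cong) (simp add: rho_def s_le)
  also have "\<dots> = \<beta>^2 * (v - u)" using assms by simp
  finally have i: "integral {u..v} rho = \<beta>^2 * (v - u)" .
  have "(G v - G u)^2 / (v - u) = 9 * (\<beta>^2 * (v - u))"
    using True assms by (simp add: G_le_a power2_eq_square field_simps)
  moreover have "Lam v - Lam u = - 8 * (\<beta>^2 * (v - u)) + 2 * k * (G v - G u) - k^2 * (v - u)"
    using True assms by (simp add: Lam_def algebra_simps)
  moreover have "0 \<le> \<beta>^2 / (2 * a) * (v - u)^2" using a_pos by simp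
  ultimately show ?thesis using parab_shear [OF assms(2)] i by linarith
next
  case False
  then have au: "a \<le> u" using assms by simp
  have "integral {u..v} rho \<le> integral {u..v} (\<lambda>_. rho u)"
  proof (intro integral_le rho_integrable_on integrable_const_ivl)
    show "rho x \<le> rho u" if "x \<in> {u..v}" for x
      unfolding rho_def using that s_antimono [of u x] s_pos [of x] by (intro power_mono) auto
  qed
  then have i: "integral {u..v} rho \<le> rho u * (v - u)" using assms by (simp add: mult.commute)
  obtain l z where lz: "u < z" "z < v" "(G has_real_derivative l) (at z)" "G v - G u = (v - u) * l"
    using MVT [OF assms(2) G_continuous, unfolded real_differentiable_def] G_deriv_gt au
    by (metis le_less_trans)
  have "l = s z" using DERIV_unique [OF lz(3) G_deriv_gt] lz(1) au by simp
  then have z: "u < z" "z < v" "G v - G u = (v - u) * s z" using lz by simp_all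
  have "rho v * (v - u) \<le> (G v - G u)^2 / (v - u)"
  proof -
    have "(s v)^2 \<le> (s z)^2" using s_antimono [of z v] z s_pos [of v] by (intro power_mono) auto
    moreover have "(G v - G u)^2 / (v - u) = (s z)^2 * (v - u)"
      using assms by (simp add: z(3) power2_eq_square)
    ultimately show ?thesis using assms by (simp add: rho_def)
  qed
  moreover have "(rho u - rho v) * (v - u) \<le> \<beta>^2 / (2 * a) * (v - u) * (v - u)"
    using rho_lipschitz [of u v] assms by (intro mult_right_mono) auto
  then have "rho u * (v - u) - rho v * (v - u) \<le> \<beta>^2 / (2 * a) * (v - u)^2"
    by (simp only: left_diff_distrib [of "rho u"] power2_eq_square mult.assoc)
  moreover have "Lam v - Lam u = 2 * k * (G v - G u) - k^2 * (v - u)"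
    using au assms by (simp add: Lam_def algebra_simps)
  ultimately show ?thesis
    using parab_shear [OF assms(2)] i by linarith
qed

text \<open>The value agrees with the constant of the dual bound, so that Young's inequality closes
  without a gap.\<close>

lemma s_cube_integral: "((\<lambda>t. (s t)^3) has_integral 2 * \<beta>^2) {0..1}"
proof -
  have 1: "((\<lambda>t. (s t)^3) has_integral \<beta>^3 * (2 * a)) {0..2 * a}"
  proof (rule has_integral_eq)
    show "((\<lambda>t. \<beta>^3) has_integral \<beta>^3 * (2 * a)) {0..2 * a}"
      using has_integral_const_real [of "\<beta>^3" 0 "2 * a"] a_pos by (simp add: mult.commute)
  qed (simp add: s_le)
  have "((\<lambda>t. (s t)^3) has_integral (- 2 * \<beta>^3 * q^3 / sqrt 1 - (- 2 * \<beta>^3 * q^3 / sqrt (2 * a)))) {2 * a..1}"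
  proof (rule fundamental_theorem_of_calculus)
    fix t assume t: "t \<in> {2 * a..1}"
    then have t0: "0 < t" using a_pos by auto
    have "((\<lambda>t. - 2 * \<beta>^3 * q^3 / sqrt t) has_real_derivative (s t)^3) (at t)"
      using t t0 by (auto intro!: derivative_eq_intros simp: s_ge power3_eq_cube field_simps)
    then show "((\<lambda>t. - 2 * \<beta>^3 * q^3 / sqrt t) has_vector_derivative (s t)^3) (at t within {2 * a..1})"
      by (simp add: has_real_derivative_iff_has_vector_derivative has_vector_derivative_at_within)
  qed (use a_less in simp)
  then have 2: "((\<lambda>t. (s t)^3) has_integral (2 * \<beta>^3 * q^2 - 2 * \<beta>^3 * q^3)) {2 * a..1}"
    using q by (simp add: q_def [symmetric] power3_eq_cube power2_eq_square)
  have "\<beta>^3 * (2 * a) + (2 * \<beta>^3 * q^2 - 2 * \<beta>^3 * q^3) = 2 * \<beta>^2 * (\<beta> * a * (3 - 2 * q))"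
    using q(3) by algebra
  then show ?thesis
    using has_integral_combine [OF _ _ 1 2] a_pos a_less \<beta>(2) by simp
qed

text \<open>\<open>s t * t - G t\<close> is \<open>t^2\<close> times the derivative of
  \<open>F t / t\<close>, so up to sign this is a conserved momentum.\<close>

lemma slope_G: "a \<le> t \<Longrightarrow> (G t - s t * t) * s t = 2 * a * \<beta>^2"
proof (cases "t \<le> 2 * a")
  case True
  assume "a \<le> t"
  then show ?thesis using True by (simp add: G_mid s_le power2_eq_square algebra_simps)
next
  case False
  then have "0 < t" using a_pos by auto
  then have "s t * t = \<beta> * q * sqrt t"
    using False by (simp add: s_ge) (metis less_imp_le real_div_sqrt times_divide_eq_right mult.assoc)
  then have "(G t - s t * t) * s t = \<beta> * q * sqrt t * (\<beta> * q / sqrt t)"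
    using False by (simp add: G_ge s_ge)
  also have "\<dots> = \<beta>^2 * (q * q)" using \<open>0 < t\<close> by (simp add: power2_eq_square)
  finally show ?thesis unfolding q by simp
qed

text \<open>In the coordinates \<^term>\<open>F t / t\<close> and \<^term>\<open>- 1 / t\<close> the slope of the optimal curve is
  inversely proportional to \<^const>\<open>s\<close>: the Euler-Lagrange equation.\<close>

lemma projective_mean_value:
  assumes "a \<le> u" "u < v"
  obtains z where "u < z" "z < v" "(F u / u - F v / v) * s z = 2 * a * \<beta>^2 * (1 / u - 1 / v)"
proof -
  have "\<exists>z. u < z \<and> z < v \<and> (F v / v - F u / u) * (1 / z^2) = (- (1 / v) - - (1 / u)) * ((s z * z - G z) / z^2)"
  \<comment> \<open>Cauchy's mean value theorem keeps the relation exact on a finite interval, at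
    the price of evaluating \<open>s\<close> at an intermediate time.\<close>
  proof (rule GMVT' [where f = "\<lambda>t. F t / t" and g = "\<lambda>t. - (1 / t)"])
    fix z assume z: "u \<le> z" "z \<le> v"
    then have z0: "z \<noteq> 0" using assms a_pos by auto
    have "isCont F z" using F_continuous [of UNIV] by (simp add: continuous_on_eq_continuous_at)
    then show "isCont (\<lambda>t. F t / t) z" "isCont (\<lambda>t. - (1 / t)) z"
      using z0 by (auto intro!: continuous_intros)
  next
    fix z assume z: "u < z" "z < v"
    then have z0: "z \<noteq> 0" "a < z" using assms a_pos by auto
    show "((\<lambda>t. - (1 / t)) has_real_derivative 1 / z^2) (at z)"
      using z0 by (auto intro!: derivative_eq_intros simp: power2_eq_square)
    have "(F has_real_derivative s z - k) (at z)"
      using F_deriv [of z] z0 by (simp add: F'_def)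
    then have "((\<lambda>t. F t / t) has_real_derivative ((s z - k) * z - F z * 1) / (z * z)) (at z)"
      using z0 by (intro DERIV_divide DERIV_ident)
    moreover have "(s z - k) * z - F z * 1 = s z * z - G z" by (simp add: F_def algebra_simps)
    ultimately show "((\<lambda>t. F t / t) has_real_derivative (s z * z - G z) / z^2) (at z)"
      by (simp add: power2_eq_square)
  qed (rule assms(2))
  then obtain z where z: "u < z" "z < v"
    and eq: "(F v / v - F u / u) * (1 / z^2) = (1 / u - 1 / v) * ((s z * z - G z) / z^2)" by auto
  have "z \<noteq> 0" "a \<le> z" using z assms a_pos by auto
  then have "F u / u - F v / v = (1 / u - 1 / v) * (G z - s z * z)"
  proof -
    have "A = B * C" if "A * (1 / z^2) = B * (C / z^2)" for A B C :: real
      using that \<open>z \<noteq> 0\<close> by simp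
    from this [OF eq] show ?thesis by (simp add: algebra_simps)
  qed
  then have "(F u / u - F v / v) * s z = (1 / u - 1 / v) * ((G z - s z * z) * s z)" by simp
  then show thesis using that [OF z] slope_G [OF \<open>a \<le> z\<close>] by simp
qed

end

section \<open>Representations of finite rate\<close>

text \<open>\<open>N i\<close> selects the times at which curve \<open>i\<close> counts: all times
  for the total cost, later the times at which it is close to \<open>F\<close>. In
  \<open>ennreal\<close> no summability has to be assumed.\<close>

definition power_sum :: "nat set \<Rightarrow> (nat \<Rightarrow> real \<Rightarrow> real) \<Rightarrow> (nat \<Rightarrow> real set) \<Rightarrow> real \<Rightarrow> ennreal" where
  "power_sum I \<rho> N t = (\<Sum>i. if i \<in> I \<and> t \<in> N i \<and> t \<in> {0..1} then ennreal (\<rho> i t powr (3/2)) else 0)"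

lemma power_sum_ge:
  assumes "i \<in> I" "t \<in> N i" "t \<in> {0..1}"
  shows "ennreal (\<rho> i t powr (3/2)) \<le> power_sum I \<rho> N t"
proof -
  let ?f = "\<lambda>i. if i \<in> I \<and> t \<in> N i \<and> t \<in> {0..1} then ennreal (\<rho> i t powr (3/2)) else 0"
  have "sum ?f {i} \<le> suminf ?f" by (rule sum_le_suminf) auto
  then show ?thesis using assms by (simp add: power_sum_def)
qed

lemma power_sum_mono: "power_sum I \<rho> N t \<le> power_sum I \<rho> (\<lambda>_. UNIV) t"
  unfolding power_sum_def by (intro suminf_le) auto

lemma power_sum_add_le:
  assumes "i \<in> I" "t \<notin> N i" "t \<in> {0..1}"
  shows "power_sum I \<rho> N t + ennreal (\<rho> i t powr (3/2)) \<le> power_sum I \<rho> (\<lambda>_. UNIV) t"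
proof -
  let ?f = "\<lambda>i. if i \<in> I \<and> t \<in> N i \<and> t \<in> {0..1} then ennreal (\<rho> i t powr (3/2)) else 0"
  let ?g = "\<lambda>j. if j = i then ennreal (\<rho> i t powr (3/2)) else 0"
  have "suminf ?g = ennreal (\<rho> i t powr (3/2))"
    using sums_single [of i "\<lambda>_. ennreal (\<rho> i t powr (3/2))"] sums_unique by metis
  then have "power_sum I \<rho> N t + ennreal (\<rho> i t powr (3/2)) = (\<Sum>j. ?f j + ?g j)"
    unfolding power_sum_def using suminf_add [of ?f ?g] by simp
  also have "\<dots> \<le> power_sum I \<rho> (\<lambda>_. UNIV) t"
    unfolding power_sum_def using assms by (intro suminf_le) auto
  finally show ?thesis .
qed

lemma two_thirds_le:
  assumes "0 \<le> (x::real)" shows "x powr (2/3) \<le> 1 + x"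
proof (cases "x \<le> 1")
  case True
  then have "x powr (2/3) \<le> 1 powr (2/3)" using assms by (intro powr_mono2) auto
  then show ?thesis using assms by simp
next
  case False
  then have "x powr (2/3) \<le> x powr 1" by (intro powr_mono) auto
  then show ?thesis using False by simp
qed

lemma powr_three_halves_inverse:
  assumes "0 \<le> (x::real)" shows "(x powr (3/2)) powr (2/3) = x"
  using assms by (simp add: powr_powr)

text \<open>With \<open>y = x powr (1/3)\<close> the difference is half of
  \<open>(y - c)^2 * (2 * y + c)\<close>, so equality holds at \<open>x = c^3\<close>.\<close>

lemma young_two_thirds:
  assumes "0 \<le> (x::real)" "0 \<le> c"
  shows "3 / 2 * (c * x powr (2/3)) \<le> x + c^3 / 2"
proof -
  define y where "y = x powr (1/3)"
  have y0: "0 \<le> y" by (simp add: y_def)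
  have y2: "y^2 = x powr (2/3)" using powr_numeral [OF y0, of "num.Bit0 num.One"] by (simp add: y_def powr_powr)
  have y3: "y^3 = x" using powr_numeral [OF y0, of "num.Bit1 num.One"] assms by (simp add: y_def powr_powr)
  note y = y0 y2 y3
  have "0 \<le> (y - c)^2 * (2 * y + c)" using y assms by simp
  then have "3 * (c * y^2) \<le> 2 * y^3 + c^3"
    by (simp add: power2_eq_square power3_eq_cube algebra_simps)
  then show ?thesis using y by simp
qed

locale finite_planting =
  fixes I :: "nat set" and \<gamma> \<rho> :: "nat \<Rightarrow> real \<Rightarrow> real"
  assumes curve: "i \<in> I \<Longrightarrow> admissible_curve (\<gamma> i)"
    and density: "i \<in> I \<Longrightarrow> admissible_density (\<rho> i)"
    and finite_rep_rate: "rep_rate I \<rho> < \<infinity>"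
begin

definition P :: "(nat \<Rightarrow> real set) \<Rightarrow> real \<Rightarrow> real" where
  "P N t = enn2real (power_sum I \<rho> N t)"

abbreviation S :: "real \<Rightarrow> real" where "S \<equiv> P (\<lambda>_. UNIV)"

text \<open>The norm with exponent 3/2 of the sequence of densities: where the sum is finite it
  dominates each of them, and a single density \<open>R\<close> has the same cost as all
  together.\<close>

definition R :: "real \<Rightarrow> real" where "R t = S t powr (2/3)"

lemma density_nonneg: "i \<in> I \<Longrightarrow> t \<in> {0..1} \<Longrightarrow> 0 \<le> \<rho> i t"
  using density by (simp add: admissible_density_def)

lemma term_measurable:
  assumes N: "N i \<in> sets lebesgue"
  shows "(\<lambda>t. if i \<in> I \<and> t \<in> N i \<and> t \<in> {0..1} then ennreal (\<rho> i t powr (3/2)) else 0) \<in> borel_measurable lebesgue"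
proof (cases "i \<in> I")
  case True
  then have "(\<lambda>t. indicator {0..1} t *\<^sub>R \<rho> i t) \<in> borel_measurable lebesgue"
    using density unfolding admissible_density_def set_integrable_def by blast
  then have "(\<lambda>t. indicator (N i) t * ennreal ((indicator {0..1} t *\<^sub>R \<rho> i t) powr (3/2))) \<in> borel_measurable lebesgue"
    using N by measurable
  moreover have "(\<lambda>t. indicator (N i) t * ennreal ((indicator {0..1} t *\<^sub>R \<rho> i t) powr (3/2))) =
    (\<lambda>t. if i \<in> I \<and> t \<in> N i \<and> t \<in> {0..1} then ennreal (\<rho> i t powr (3/2)) else 0)"
    using True by (auto simp: fun_eq_iff indicator_def)
  ultimately show ?thesis by simp
qed simp

lemma power_sum_measurable:
  assumes "\<And>i. i \<in> I \<Longrightarrow> N i \<in> sets lebesgue"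
  shows "power_sum I \<rho> N \<in> borel_measurable lebesgue"
proof -
  have "(\<lambda>t. if i \<in> I \<and> t \<in> N i \<and> t \<in> {0..1} then ennreal (\<rho> i t powr (3/2)) else 0) \<in> borel_measurable lebesgue" for i
  proof (cases "i \<in> I")
    case True
    show ?thesis by (rule term_measurable) (rule assms [OF True])
  qed simp
  then show ?thesis unfolding power_sum_def [abs_def] by measurable
qed

lemma rep_rate_eq: "rep_rate I \<rho> = ennreal (4/3) * (\<integral>\<^sup>+t. power_sum I \<rho> (\<lambda>_. UNIV) t \<partial>lebesgue)"
proof -
  let ?f = "\<lambda>i t. if i \<in> I \<and> t \<in> UNIV \<and> t \<in> {0..1} then ennreal (\<rho> i t powr (3/2)) else 0"
  have "(\<integral>\<^sup>+t. power_sum I \<rho> (\<lambda>_. UNIV) t \<partial>lebesgue) = (\<Sum>i. \<integral>\<^sup>+t. ?f i t \<partial>lebesgue)"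
    unfolding power_sum_def by (intro nn_integral_suminf term_measurable [where N = "\<lambda>_. UNIV"]) simp
  also have "ennreal (4/3) * \<dots> = (\<Sum>i. ennreal (4/3) * (\<integral>\<^sup>+t. ?f i t \<partial>lebesgue))"
    by simp
  also have "\<dots> = rep_rate I \<rho>"
    unfolding rep_rate_def
  proof (intro suminf_cong)
    fix i
    show "ennreal (4/3) * (\<integral>\<^sup>+t. ?f i t \<partial>lebesgue) =
      (if i \<in> I then ennreal (4/3) * (\<integral>\<^sup>+t. indicator {0..1} t * ennreal (\<rho> i t powr (3/2)) \<partial>lebesgue) else 0)"
      by (auto intro!: arg_cong [where f = "\<lambda>x. ennreal (4/3) * x"] nn_integral_cong simp: indicator_def)
  qed
  finally show ?thesis by simp
qed

lemma power_sum_finite: "AE t in lebesgue. power_sum I \<rho> (\<lambda>_. UNIV) t \<noteq> \<infinity>"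
proof (rule nn_integral_PInf_AE)
  show "power_sum I \<rho> (\<lambda>_. UNIV) \<in> borel_measurable lebesgue" by (rule power_sum_measurable) simp
  show "(\<integral>\<^sup>+t. power_sum I \<rho> (\<lambda>_. UNIV) t \<partial>lebesgue) \<noteq> \<infinity>"
    using finite_rep_rate rep_rate_eq by (auto simp: ennreal_mult_top)
qed

lemma P_integrable:
  assumes N: "\<And>i. i \<in> I \<Longrightarrow> N i \<in> sets lebesgue"
  shows "integrable lebesgue (P N)"
proof (rule integrableI_nonneg)
  have m: "power_sum I \<rho> N \<in> borel_measurable lebesgue" by (rule power_sum_measurable [OF N])
  then show "P N \<in> borel_measurable lebesgue" unfolding P_def [abs_def] by measurable
  show "AE t in lebesgue. 0 \<le> P N t" by (simp add: P_def)
  have "(\<integral>\<^sup>+t. ennreal (P N t) \<partial>lebesgue) \<le> (\<integral>\<^sup>+t. power_sum I \<rho> (\<lambda>_. UNIV) t \<partial>lebesgue)"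
  proof (intro nn_integral_mono)
    fix t
    have "ennreal (P N t) \<le> power_sum I \<rho> N t" unfolding P_def by (cases "power_sum I \<rho> N t") auto
    then show "ennreal (P N t) \<le> power_sum I \<rho> (\<lambda>_. UNIV) t" using power_sum_mono order_trans by blast
  qed
  also have "\<dots> < \<infinity>"
    using finite_rep_rate rep_rate_eq by (auto simp: ennreal_mult_top less_top [symmetric])
  finally show "(\<integral>\<^sup>+t. ennreal (P N t) \<partial>lebesgue) < \<infinity>" .
qed

lemma P_nonneg: "0 \<le> P N t"
  by (simp add: P_def)

lemma P_absolutely_integrable:
  assumes N: "\<And>i. i \<in> I \<Longrightarrow> N i \<in> sets lebesgue"
  shows "P N absolutely_integrable_on {0..1}"
  using integrable_mult_indicator [of "{0..1}" lebesgue, OF _ P_integrable [OF N]]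
  by (simp add: set_integrable_def)

lemma P_outside: "t \<notin> {0..1} \<Longrightarrow> P N t = 0"
  unfolding P_def power_sum_def by (simp only: simp_thms if_False) simp

lemma rep_rate_integral: "rep_rate I \<rho> = ennreal (4/3 * integral {0..1} S)"
proof -
  have "(\<integral>\<^sup>+t. power_sum I \<rho> (\<lambda>_. UNIV) t \<partial>lebesgue) = (\<integral>\<^sup>+t. ennreal (S t) \<partial>lebesgue)"
    using power_sum_finite by (intro nn_integral_cong_AE) (auto simp: P_def less_top [symmetric])
  also have "\<dots> = ennreal (integral\<^sup>L lebesgue S)"
    by (intro nn_integral_eq_integral P_integrable) (auto simp: P_def)
  also have "integral\<^sup>L lebesgue S = set_lebesgue_integral lebesgue {0..1} S"
    unfolding set_lebesgue_integral_def
  proof (intro Bochner_Integration.integral_cong)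
    show "S t = indicator {0..1} t *\<^sub>R S t" for t
      by (cases "t \<in> {0..1}") (simp_all add: P_outside del: atLeastAtMost_iff)
  qed simp
  also have "\<dots> = integral {0..1} S"
    by (intro set_lebesgue_integral_eq_integral(2) P_absolutely_integrable) simp
  finally have eq: "(\<integral>\<^sup>+t. power_sum I \<rho> (\<lambda>_. UNIV) t \<partial>lebesgue) = ennreal (integral {0..1} S)" .
  show ?thesis
    unfolding rep_rate_eq eq by (rule ennreal_mult' [symmetric]) simp
qed

lemma P_two_thirds_integrable:
  assumes N: "\<And>i. i \<in> I \<Longrightarrow> N i \<in> sets lebesgue"
  shows "(\<lambda>t. P N t powr (2/3)) absolutely_integrable_on {0..1}"
proof (rule measurable_bounded_by_integrable_imp_absolutely_integrable)
  have "P N \<in> borel_measurable lebesgue"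
    using P_integrable [OF N] by (rule borel_measurable_integrable)
  then have "(\<lambda>t. P N t powr (2/3)) \<in> borel_measurable lebesgue" by measurable
  then show "(\<lambda>t. P N t powr (2/3)) \<in> borel_measurable (lebesgue_on {0..1})"
    by (rule measurable_restrict_space1)
  have "P N integrable_on {0..1}" by (intro set_lebesgue_integral_eq_integral(1) P_absolutely_integrable N)
  then show "(\<lambda>t. 1 + P N t) integrable_on {0..1}" by (intro integrable_add integrable_const_ivl)
  show "norm (P N t powr (2/3)) \<le> 1 + P N t" for t
    using two_thirds_le [OF P_nonneg] by simp
qed simp

text \<open>Finiteness of the total sum is the only requirement, so one exceptional set serves all
  choices of \<open>N\<close> at once.\<close>

lemma term_bounds:
  obtains Z where "negligible Z"
    and "\<And>i t N. i \<in> I \<Longrightarrow> t \<in> {0..1} - Z \<Longrightarrow> t \<in> N i \<Longrightarrow> \<rho> i t powr (3/2) \<le> P N t"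
    and "\<And>i t N. i \<in> I \<Longrightarrow> t \<in> {0..1} - Z \<Longrightarrow> t \<notin> N i \<Longrightarrow> P N t + \<rho> i t powr (3/2) \<le> S t"
    and "\<And>t N. t \<in> {0..1} - Z \<Longrightarrow> P N t \<le> S t"
proof
  define Z where "Z = {t. power_sum I \<rho> (\<lambda>_. UNIV) t = \<infinity>}"
  have "AE t in lebesgue. t \<notin> Z" using power_sum_finite by (simp add: Z_def)
  moreover have "power_sum I \<rho> (\<lambda>_. UNIV) \<in> borel_measurable lebesgue" by (rule power_sum_measurable) simp
  from measurable_sets [OF this, of "{\<infinity>}"] have "Z \<in> sets lebesgue"
    by (simp add: Z_def vimage_def)
  ultimately show "negligible Z"
    by (simp add: negligible_iff_null_sets AE_iff_null_sets)
  have fin: "power_sum I \<rho> N t < \<infinity>" if "t \<in> {0..1} - Z" for t N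
    using that power_sum_mono [of I \<rho> N t] by (auto simp: Z_def less_top [symmetric] top_unique)
  show "\<rho> i t powr (3/2) \<le> P N t" if "i \<in> I" "t \<in> {0..1} - Z" "t \<in> N i" for i t N
    using enn2real_mono [OF power_sum_ge [of i I t N \<rho>]] fin [of t N] that
    by (simp add: P_def)
  show "P N t + \<rho> i t powr (3/2) \<le> S t" if "i \<in> I" "t \<in> {0..1} - Z" "t \<notin> N i" for i t N
    using enn2real_mono [OF power_sum_add_le [of i I t N \<rho>]] fin [of t "\<lambda>_. UNIV"] fin [of t N] that
    by (simp add: P_def enn2real_plus)
  show "P N t \<le> S t" if "t \<in> {0..1} - Z" for t N
    using enn2real_mono [OF power_sum_mono [of I \<rho> N t]] fin [of t "\<lambda>_. UNIV"] that
    by (simp add: P_def)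
qed

sublocale dominated_planting I \<gamma> \<rho> R
proof
  show "R absolutely_integrable_on {0..1}"
    unfolding R_def [abs_def] by (rule P_two_thirds_integrable) simp
  obtain Z where Z: "negligible Z"
    "\<And>i t N. i \<in> I \<Longrightarrow> t \<in> {0..1} - Z \<Longrightarrow> t \<in> N i \<Longrightarrow> \<rho> i t powr (3/2) \<le> P N t"
    using term_bounds by metis
  have "\<rho> i t \<le> R t" if "i \<in> I" "t \<in> {0..1} - Z" for i t
  proof -
    have "(\<rho> i t powr (3/2)) powr (2/3) \<le> S t powr (2/3)"
      using Z(2) [OF that, of "\<lambda>_. UNIV"] by (intro powr_mono2) auto
    then show ?thesis
      using that density_nonneg by (simp add: powr_three_halves_inverse R_def)
  qed
  then show "\<exists>Z. negligible Z \<and> (\<forall>t\<in>{0..1} - Z. \<forall>i\<in>I. \<rho> i t \<le> R t)" using Z(1) by blast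
qed (use curve density in \<open>auto simp: R_def\<close>)

end

text \<open>Length is an infimum over all partitions. Those with one or two interior times, played
  against the triangle inequality, already force \<open>e\<close> to be additive along the
  path.\<close>

lemma geodesic_potential:
  assumes dm: "directed_metric e"
    and dir: "\<And>x s y t. s < t \<Longrightarrow> dirichlet x s y t \<le> e x s y t"
    and geo: "geodesic e \<pi> x0 0 x1 1"
  obtains \<Lambda> where "\<And>u v. 0 \<le> u \<Longrightarrow> u < v \<Longrightarrow> v \<le> 1 \<Longrightarrow> e (\<pi> u) u (\<pi> v) v = ereal (\<Lambda> v - \<Lambda> u)"
proof -
  define r where "r u v = real_of_ereal (e (\<pi> u) u (\<pi> v) v)" for u v
  have er: "e (\<pi> u) u (\<pi> v) v = ereal (r u v)" if "u < v" for u v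
  proof -
    have "e (\<pi> u) u (\<pi> v) v \<noteq> \<infinity>" using dm that by (simp add: directed_metric_def)
    moreover have "e (\<pi> u) u (\<pi> v) v \<noteq> - \<infinity>" using dir [OF that, of "\<pi> u" "\<pi> v"] by (auto simp: dirichlet_def)
    ultimately show ?thesis unfolding r_def by (cases "e (\<pi> u) u (\<pi> v) v") auto
  qed
  have tri: "r u v + r v w \<le> r u w" if "u < v" "v < w" for u v w
  proof -
    have "e (\<pi> u) u (\<pi> v) v + e (\<pi> v) v (\<pi> w) w \<le> e (\<pi> u) u (\<pi> w) w"
      using dm that unfolding directed_metric_def by blast
    then show ?thesis using er that by simp
  qed
  have len: "ereal (r 0 1) \<le> (\<Sum>i<k. e (\<pi> (\<tau> i)) (\<tau> i) (\<pi> (\<tau> (Suc i))) (\<tau> (Suc i)))"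
    if "0 < k" "\<tau> 0 = 0" "\<tau> k = 1" "\<forall>i<k. \<tau> i < \<tau> (Suc i)" for k :: nat and \<tau>
  proof -
    have "path_length e \<pi> 0 1 = ereal (r 0 1)" using geo er [of 0 1] by (simp add: geodesic_def)
    moreover have "path_length e \<pi> 0 1 \<le> (\<Sum>i<k. e (\<pi> (\<tau> i)) (\<tau> i) (\<pi> (\<tau> (Suc i))) (\<tau> (Suc i)))"
      unfolding path_length_def by (rule INF_lower2 [where i = "(k, \<tau>)"]) (use that in auto)
    ultimately show ?thesis by simp
  qed
  have two: "r 0 1 = r 0 v + r v 1" if v: "0 < v" "v < 1" for v
  proof -
    define \<tau> :: "nat \<Rightarrow> real" where "\<tau> i = (if i = 0 then 0 else if i = 1 then v else 1)" for i
    have "ereal (r 0 1) \<le> (\<Sum>i<2. e (\<pi> (\<tau> i)) (\<tau> i) (\<pi> (\<tau> (Suc i))) (\<tau> (Suc i)))"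
      by (rule len) (use v in \<open>auto simp: \<tau>_def less_2_cases_iff\<close>)
    also have "\<dots> = ereal (r 0 v + r v 1)"
      using v er [of 0 v] er [of v 1] by (simp add: numeral_2_eq_2 \<tau>_def)
    finally show ?thesis using tri [OF v] by simp
  qed
  have three: "r 0 v = r 0 u + r u v" if uv: "0 < u" "u < v" "v < 1" for u v
  proof -
    define \<tau> :: "nat \<Rightarrow> real" where "\<tau> i = (if i = 0 then 0 else if i = 1 then u else if i = 2 then v else 1)" for i
    have "ereal (r 0 1) \<le> (\<Sum>i<3. e (\<pi> (\<tau> i)) (\<tau> i) (\<pi> (\<tau> (Suc i))) (\<tau> (Suc i)))"
      by (rule len) (use uv in \<open>auto simp: \<tau>_def numeral_3_eq_3 less_Suc_eq\<close>)
    also have "\<dots> = ereal (r 0 u + r u v + r v 1)"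
      using uv er [of 0 u] er [of u v] er [of v 1] by (simp add: numeral_3_eq_3 \<tau>_def)
    finally show ?thesis using tri [of 0 u v] two [of v] uv by simp
  qed
  show thesis
  proof (rule that [of "\<lambda>t. if t = 0 then 0 else r 0 t"])
    fix u v :: real assume uv: "0 \<le> u" "u < v" "v \<le> 1"
    have "r u v = r 0 v - r 0 u" if "u \<noteq> 0"
      using three [of u v] two [of u] that uv by (cases "v = 1") auto
    then show "e (\<pi> u) u (\<pi> v) v = ereal ((if v = 0 then 0 else r 0 v) - (if u = 0 then 0 else r 0 u))"
      using er [of u v] uv by auto
  qed
qed

section \<open>The dual bound\<close>

text \<open>Summation by parts gives each difference \<open>X j - E j\<close> a nonnegative weight,
  since \<open>\<sigma>\<close> decreases and stays nonnegative. The induction carries the last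
  difference with its full weight.\<close>

lemma abel_summation_mono:
  fixes \<sigma> X E :: "nat \<Rightarrow> real"
  assumes "\<And>j. j < N \<Longrightarrow> \<sigma> (Suc j) \<le> \<sigma> j" "\<And>j. j \<le> N \<Longrightarrow> E j \<le> X j" "0 \<le> \<sigma> N"
  shows "\<sigma> 0 * E 0 + (\<Sum>j<N. \<sigma> (Suc j) * (E (Suc j) - E j)) \<le> \<sigma> 0 * X 0 + (\<Sum>j<N. \<sigma> (Suc j) * (X (Suc j) - X j))"
proof -
  have "\<sigma> 0 * E 0 + (\<Sum>j<n. \<sigma> (Suc j) * (E (Suc j) - E j)) + \<sigma> n * (X n - E n)
      \<le> \<sigma> 0 * X 0 + (\<Sum>j<n. \<sigma> (Suc j) * (X (Suc j) - X j))" if "n \<le> N" for n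
    using that
  proof (induction n)
    case 0
    then show ?case by (simp add: algebra_simps)
  next
    case (Suc n)
    have "\<sigma> (Suc n) * (X n - E n) \<le> \<sigma> n * (X n - E n)"
      using Suc.prems assms(1) [of n] assms(2) [of n] by (intro mult_right_mono) auto
    then show ?case using Suc by (simp add: algebra_simps)
  qed
  from this [of N] show ?thesis
    using mult_nonneg_nonneg [OF assms(3), of "X N - E N"] assms(2) [of N] by simp
qed

text \<open>The partition meets \<open>m\<close> so that a dual slope can change exactly
  there.\<close>

lemma partition_through:
  fixes l m r d :: real
  assumes "l < m" "m < r" "0 < d"
  obtains t :: "nat \<Rightarrow> real" and K N where "t 0 = l" "t K = m" "t N = r" "K \<le> N"
    "\<And>j. j < N \<Longrightarrow> t j < t (Suc j)" "\<And>j. j < N \<Longrightarrow> t (Suc j) - t j < d"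
proof -
  obtain n :: nat where "(r - l) / d < real n" using reals_Archimedean2 by blast
  moreover have "0 < (r - l) / d" using assms by simp
  ultimately have n0: "0 < real n" and "(r - l) / d < real n" by linarith+
  then have "(r - l) / real n < d" using assms by (simp add: pos_divide_less_eq mult.commute)
  with n0 have n: "0 < real n" "(r - l) / real n < d" .
  define p1 p2 where "p1 = (m - l) / n" and "p2 = (r - m) / n"
  have p: "0 < p1" "0 < p2" using assms n by (auto simp: p1_def p2_def)
  have "p1 \<le> (r - l) / n" "p2 \<le> (r - l) / n"
    unfolding p1_def p2_def using assms by (auto intro!: divide_right_mono)
  then have q: "p1 < d" "p2 < d" using n(2) by linarith+
  have np: "real n * p1 = m - l" "real n * p2 = r - m" using n by (auto simp: p1_def p2_def)
  define t :: "nat \<Rightarrow> real" where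
    "t j = (if j \<le> n then l + real j * p1 else m + (real j - n) * p2)" for j
  have step: "t (Suc j) - t j = (if j < n then p1 else p2)" for j
  proof -
    consider "j < n" | "j = n" | "n < j" by linarith
    then show ?thesis using np by cases (auto simp: t_def algebra_simps)
  qed
  show thesis
  proof (rule that [of t n "2 * n"])
    show "t 0 = l" "t n = m" "t (2 * n) = r" "n \<le> 2 * n" using n np by (auto simp: t_def)
    show "t j < t (Suc j)" "t (Suc j) - t j < d" for j
      using step [of j] p q by (auto split: if_splits)
  qed
qed

text \<open>The boundary terms are the costs of straight segments from the origin. They telescope
  and cancel in a comparison with such segments, leaving the energy of \<open>y / v\<close> in the
  time \<open>- 1 / v\<close>.\<close>

lemma parab_projective:
  assumes "0 < u" "u < v"
  shows "parab x u y v = - ((y / v - x / u)^2 / (1 / u - 1 / v)) + x^2 / u - y^2 / v"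
proof -
  have "0 < 1 / u - 1 / v" using assms by (simp add: frac_less2)
  have "1 / u - 1 / v = (v - u) / (u * v)" using assms by (simp add: field_simps)
  moreover have "(y / v - x / u)^2 = (u * y - v * x)^2 / (u * v)^2"
    using assms by (simp add: power_divide [symmetric] field_simps)
  ultimately have "(y / v - x / u)^2 / (1 / u - 1 / v) = (u * y - v * x)^2 / (u * v * (v - u))"
    using assms by (simp add: power2_eq_square)
  moreover have "- ((y - x)^2) / (v - u) + (u * y - v * x)^2 / (u * v * (v - u)) = x^2 / u - y^2 / v"
    using assms by (simp add: divide_simps) (simp add: power2_eq_square algebra_simps)
  ultimately show ?thesis by (simp add: parab_def)
qed

context optimum
begin

text \<open>The conserved momentum of \<open>slope_G\<close>.\<close>

definition m :: real where "m = 2 * a * \<beta>^2"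

lemma m: "0 < m" "m / a = 2 * \<beta>^2"
  using a_pos \<beta> by (auto simp: m_def)

lemma s_mult_integrable:
  assumes "f absolutely_integrable_on {0..1}"
  shows "(\<lambda>t. s t * f t) integrable_on {0..1}"
proof (rule set_lebesgue_integral_eq_integral(1), rule absolutely_integrable_bounded_measurable_product_real [OF _ _ _ assms])
  show "s \<in> borel_measurable (lebesgue_on {0..1})"
    by (rule continuous_imp_measurable_on_sets_lebesgue [OF s_continuous]) simp
  have "s ` {0..1} \<subseteq> {0..\<beta>}" using s_le_\<beta> less_imp_le [OF s_pos] by auto
  then show "bounded (s ` {0..1})" by (rule bounded_subset [OF bounded_closed_interval])
qed simp

text \<open>\<open>x\<close> records extra cost before time \<open>a\<close>, and
  \<open>\<theta>\<close> perturbs the dual slope between \<open>a\<close> and \<open>T\<close>.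
  With both equal to 0 this is the dual bound \<open>2 * \<beta>^2\<close>; otherwise it measures
  how far \<open>\<pi>\<close> is from \<open>F\<close>. Energies are taken along partitions because
  \<open>\<pi>\<close> need not be differentiable.\<close>

theorem weighted_density_bound:
  fixes R \<pi> \<Lambda> :: "real \<Rightarrow> real"
  assumes R: "R absolutely_integrable_on {0..1}" and R0: "\<And>t. 0 \<le> R t"
    and \<pi>: "\<pi> a = 1" "\<pi> 1 = 0"
    and lower: "\<And>t. a \<le> t \<Longrightarrow> t \<le> 1 \<Longrightarrow> - ((\<pi> t)^2 / t) \<le> \<Lambda> t - \<Lambda> 0"
    and upper: "\<And>u v. a \<le> u \<Longrightarrow> u < v \<Longrightarrow> v \<le> 1 \<Longrightarrow> \<Lambda> v - \<Lambda> u \<le> parab (\<pi> u) u (\<pi> v) v + integral {u..v} R"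
    and start: "\<Lambda> a - \<Lambda> 0 \<le> - (1 / a) - x + integral {0..a} R"
    and T: "a < T" "T < 1"
  shows "2 * \<beta>^2 + \<beta> * x + 2 * \<theta> * (\<pi> T / T - F T / T) - \<theta>^2 / m * (1 / a - F T / T)
    \<le> integral {0..1} (\<lambda>t. s t * R t)" (is "?K \<le> ?I")
proof -
  have Ri: "R integrable_on {0..1}" using R by (rule set_lebesgue_integral_eq_integral)
  have sRi: "(\<lambda>t. s t * R t) integrable_on {0..1}" by (rule s_mult_integrable [OF R])
  define Xf where "Xf t = integral {0..t} R" for t
  have Xd: "Xf v - Xf u = integral {u..v} R" if "0 \<le> u" "u \<le> v" "v \<le> 1" for u v
    using integral_add_adjacent [OF Ri, of 0 u v] that by (simp add: Xf_def)
  have Xinc: "0 \<le> Xf v - Xf u" if "0 \<le> u" "u \<le> v" "v \<le> 1" for u v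
    unfolding Xd [OF that] using that
    by (intro integral_nonneg integrable_subinterval_real [OF Ri] R0) auto
  have sR_ge: "s v * (Xf v - Xf u) \<le> integral {u..v} (\<lambda>t. s t * R t)" if "0 \<le> u" "u \<le> v" "v \<le> 1" for u v
  proof -
    have "s v * (Xf v - Xf u) = integral {u..v} (\<lambda>t. s v * R t)" unfolding Xd [OF that] by simp
    also have "\<dots> \<le> integral {u..v} (\<lambda>t. s t * R t)"
    proof (intro integral_le)
      show "(\<lambda>t. s v * R t) integrable_on {u..v}"
        by (intro integrable_on_mult_right integrable_subinterval_real [OF Ri]) (use that in auto)
      show "(\<lambda>t. s t * R t) integrable_on {u..v}"
        by (intro integrable_subinterval_real [OF sRi]) (use that in auto)
      show "s v * R t \<le> s t * R t" if "t \<in> {u..v}" for t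
        using s_antimono [of t v] that by (intro mult_right_mono R0) auto
    qed
    finally show ?thesis .
  qed
  \<comment> \<open>The error comes only from evaluating \<open>s\<close> at an intermediate point
    of each cell.\<close>
  have approx: "?K - e * Xf 1 \<le> ?I" if e: "0 < e" for e
  proof -
    have "uniformly_continuous_on {0..1} s"
      by (intro compact_uniformly_continuous s_continuous) auto
    then obtain d where d: "0 < d" and sd: "\<And>u v. u \<in> {0..1} \<Longrightarrow> v \<in> {0..1} \<Longrightarrow> dist v u < d \<Longrightarrow> dist (s v) (s u) < e"
      unfolding uniformly_continuous_on_def using e by metis
    obtain t :: "nat \<Rightarrow> real" and K N where t: "t 0 = a" "t K = T" "t N = 1" "K \<le> N"
      "\<And>j. j < N \<Longrightarrow> t j < t (Suc j)" "\<And>j. j < N \<Longrightarrow> t (Suc j) - t j < d"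
      using partition_through [OF T d] by metis
    have t_mono: "t i \<le> t j" if "i \<le> j" "j \<le> N" for i j
      using that
    proof (induction j)
      case (Suc j)
      then show ?case using t(5) [of j] by (cases "i = Suc j") auto
    qed simp
    have t_range: "a \<le> t j" "t j \<le> 1" "0 < t j" if "j \<le> N" for j
      using t_mono [of 0 j] t_mono [of j N] t that a_pos by auto
    have "\<exists>z. \<forall>j<N. t j < z j \<and> z j < t (Suc j) \<and>
        (F (t j) / t j - F (t (Suc j)) / t (Suc j)) * s (z j) = m * (1 / t j - 1 / t (Suc j))"
    proof (intro choice allI)
      fix j show "\<exists>z. j < N \<longrightarrow> t j < z \<and> z < t (Suc j) \<and>
        (F (t j) / t j - F (t (Suc j)) / t (Suc j)) * s z = m * (1 / t j - 1 / t (Suc j))"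
        using projective_mean_value [of "t j" "t (Suc j)"] t_range(1) [of j] t(5) [of j] unfolding m_def
        by (metis less_imp_le_nat)
    qed
    then obtain z where z: "\<And>j. j < N \<Longrightarrow> t j < z j" "\<And>j. j < N \<Longrightarrow> z j < t (Suc j)"
      "\<And>j. j < N \<Longrightarrow> (F (t j) / t j - F (t (Suc j)) / t (Suc j)) * s (z j) = m * (1 / t j - 1 / t (Suc j))"
      by blast
    \<comment> \<open>\<open>\<sigma> 0\<close> is the value of \<open>s\<close> throughout the time
      before \<open>a\<close>. On later cells the weight is taken at the point where the
      Euler-Lagrange relation is exact.\<close>
    define \<sigma> where "\<sigma> j = (case j of 0 \<Rightarrow> \<beta> | Suc i \<Rightarrow> s (z i))" for j
    define y where "y j = \<pi> (t j) / t j" for j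
    define Y where "Y j = F (t j) / t j" for j
    define D where "D j = 1 / t j - 1 / t (Suc j)" for j
    define En where "En j = x + (\<Sum>i<j. (y (Suc i) - y i)^2 / D i)" for j
    define X where "X j = Xf (t j)" for j
    have D: "0 < D j" if "j < N" for j
      using t(5) [OF that] t_range(3) [of j] that by (simp add: D_def frac_less2)
    have start_values: "y 0 = 1 / a" "Y 0 = 1 / a" "y N = 0" "Y N = 0" "Y K = F T / T" "y K = \<pi> T / T"
      using \<pi> t F_values by (auto simp: y_def Y_def)
    have dom: "\<Lambda> (t j) - \<Lambda> 0 \<le> X j - En j - (\<pi> (t j))^2 / t j" if "j \<le> N" for j
      using that
    proof (induction j)
      case 0
      then show ?case using start \<pi> t by (simp add: X_def Xf_def En_def)
    next
      case (Suc j)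
      have "\<Lambda> (t (Suc j)) - \<Lambda> (t j) \<le> parab (\<pi> (t j)) (t j) (\<pi> (t (Suc j))) (t (Suc j)) + integral {t j..t (Suc j)} R"
        using Suc.prems t_range [of j] t_range [of "Suc j"] t(5) [of j] by (intro upper) auto
      moreover have "integral {t j..t (Suc j)} R = X (Suc j) - X j"
        unfolding X_def using Suc.prems t_range [of j] t_range [of "Suc j"] t(5) [of j] by (intro Xd [symmetric]) auto
      moreover have "parab (\<pi> (t j)) (t j) (\<pi> (t (Suc j))) (t (Suc j)) =
          - ((y (Suc j) - y j)^2 / D j) + (\<pi> (t j))^2 / t j - (\<pi> (t (Suc j)))^2 / t (Suc j)"
        unfolding y_def D_def using Suc.prems t_range [of j] t(5) [of j] by (intro parab_projective) auto
      moreover have "En (Suc j) = En j + (y (Suc j) - y j)^2 / D j" by (simp add: En_def)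
      ultimately show ?case using Suc by simp
    qed
    \<comment> \<open>The straight segment from the origin carries the same boundary term, which
      cancels and leaves the energy.\<close>
    have EX: "En j \<le> X j" if "j \<le> N" for j
      using dom [OF that] lower [of "t j"] t_range [OF that] by simp
    have \<sigma>_anti: "\<sigma> (Suc j) \<le> \<sigma> j" if "j < N" for j
    proof (cases j)
      case 0 then show ?thesis by (simp add: \<sigma>_def s_le_\<beta>)
    next
      case (Suc i)
      then have "z i \<le> z j" using z(2) [of i] z(1) [of j] that by simp
      then show ?thesis using Suc by (simp add: \<sigma>_def s_antimono)
    qed
    have \<sigma>_pos: "0 < \<sigma> j" for j
      using s_pos \<beta> by (cases j) (auto simp: \<sigma>_def)
    have "\<sigma> 0 * En 0 + (\<Sum>j<N. \<sigma> (Suc j) * (En (Suc j) - En j)) \<le> \<sigma> 0 * X 0 + (\<Sum>j<N. \<sigma> (Suc j) * (X (Suc j) - X j))"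
      by (intro abel_summation_mono \<sigma>_anti EX less_imp_le [OF \<sigma>_pos])
    then have 1: "\<beta> * x + (\<Sum>j<N. \<sigma> (Suc j) * ((y (Suc j) - y j)^2 / D j)) \<le> \<beta> * X 0 + (\<Sum>j<N. \<sigma> (Suc j) * (X (Suc j) - X j))"
      by (simp add: En_def \<sigma>_def)
    have 2: "\<beta> * X 0 + (\<Sum>j<n. \<sigma> (Suc j) * (X (Suc j) - X j)) \<le> integral {0..t n} (\<lambda>t. s t * R t) + e * (X n - X 0)"
      if "n \<le> N" for n
      using that
    proof (induction n)
      case 0
      have "\<beta> * X 0 \<le> integral {0..a} (\<lambda>t. s t * R t)"
        using sR_ge [of 0 a] s_le [of a] a_pos a_less t(1) by (simp add: X_def Xf_def)
      then show ?case using t(1) by simp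
    next
      case (Suc n)
      have tt: "0 \<le> t n" "t n \<le> t (Suc n)" "t (Suc n) \<le> 1"
        using Suc.prems t_range [of n] t_range [of "Suc n"] t(5) [of n] by auto
      have "dist (s (z n)) (s (t (Suc n))) < e"
      proof (rule sd)
        show "t (Suc n) \<in> {0..1}" "z n \<in> {0..1}" "dist (z n) (t (Suc n)) < d"
          using tt z(1) [of n] z(2) [of n] t(6) [of n] Suc.prems by (auto simp: dist_real_def)
      qed
      then have "\<sigma> (Suc n) \<le> s (t (Suc n)) + e" by (simp add: \<sigma>_def dist_real_def)
      then have "\<sigma> (Suc n) * (X (Suc n) - X n) \<le> (s (t (Suc n)) + e) * (X (Suc n) - X n)"
        using Xinc [OF tt] by (intro mult_right_mono) (auto simp: X_def)
      also have "\<dots> \<le> integral {t n..t (Suc n)} (\<lambda>t. s t * R t) + e * (X (Suc n) - X n)"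
        using sR_ge [OF tt] by (simp add: X_def algebra_simps)
      finally have "\<sigma> (Suc n) * (X (Suc n) - X n) \<le> integral {t n..t (Suc n)} (\<lambda>t. s t * R t) + e * (X (Suc n) - X n)" .
      moreover have "integral {0..t n} (\<lambda>t. s t * R t) + integral {t n..t (Suc n)} (\<lambda>t. s t * R t) = integral {0..t (Suc n)} (\<lambda>t. s t * R t)"
        using tt by (intro integral_add_adjacent sRi) auto
      ultimately show ?case using Suc by (simp add: algebra_simps)
    qed
    \<comment> \<open>The optimal path has momentum \<open>- m\<close> on every cell;
      \<open>\<theta>\<close> shifts it on the cells before \<open>T\<close>.\<close>
    define \<phi> where "\<phi> j = - m + (if j < K then \<theta> else 0)" for j
    have 3: "2 * \<phi> j * (y (Suc j) - y j) - (\<phi> j)^2 * ((Y j - Y (Suc j)) / m) \<le> \<sigma> (Suc j) * ((y (Suc j) - y j)^2 / D j)"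
      if "j < N" for j
    proof -
      have YD: "(Y j - Y (Suc j)) * \<sigma> (Suc j) = m * D j"
        using z(3) [OF that] by (simp add: Y_def D_def \<sigma>_def)
      have "(Y j - Y (Suc j)) / m = D j / \<sigma> (Suc j)"
        using YD m(1) \<sigma>_pos [of "Suc j"] by (simp add: field_simps)
      \<comment> \<open>A convex parabola lies above its tangent lines, here parametrized by the
        slope.\<close>
      moreover have "2 * p * c - p^2 * (Dj / g) \<le> g * (c^2 / Dj)" if "0 < Dj" "0 < g" for p c Dj g :: real
      proof -
        have "g * (c^2 / Dj) - (2 * p * c - p^2 * (Dj / g)) = (g * c - p * Dj)^2 / (g * Dj)"
          using that by (simp add: field_simps power2_eq_square)
        moreover have "0 \<le> (g * c - p * Dj)^2 / (g * Dj)" using that by simp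
        ultimately show ?thesis by linarith
      qed
      ultimately show ?thesis using D [OF that] \<sigma>_pos by simp
    qed
    \<comment> \<open>The quadratic terms are multiples of increments of \<open>Y\<close>, so the
      sum telescopes, with one break at \<open>K\<close> where the slope changes.\<close>
    have 4: "(\<Sum>j<n. 2 * \<phi> j * (y (Suc j) - y j) - (\<phi> j)^2 * ((Y j - Y (Suc j)) / m)) =
       - 2 * m * (y n - y 0) + 2 * \<theta> * (y (min n K) - y 0) - m * (Y 0 - Y n) - (\<theta>^2 / m - 2 * \<theta>) * (Y 0 - Y (min n K))" for n
    proof (induction n)
      case 0 then show ?case by simp
    next
      case (Suc n)
      have sq: "(- m + \<theta>)^2 * (c / m) = m * c + (\<theta>^2 / m - 2 * \<theta>) * c" "(- m)^2 * (c / m) = m * c" for c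
        using m(1) by (simp_all add: field_simps power2_eq_square)
      show ?case
      proof (cases "n < K")
        case True
        then have "min n K = n" "min (Suc n) K = Suc n" by auto
        moreover have "\<phi> n = - m + \<theta>" using True by (simp add: \<phi>_def)
        ultimately show ?thesis unfolding sum.lessThan_Suc Suc.IH by (simp only: sq) (simp add: algebra_simps diff_divide_distrib)
      next
        case False
        then have "min n K = K" "min (Suc n) K = K" by auto
        moreover have "\<phi> n = - m" using False by (simp add: \<phi>_def)
        ultimately show ?thesis unfolding sum.lessThan_Suc Suc.IH by (simp only: sq) (simp add: algebra_simps diff_divide_distrib)
      qed
    qed
    have "(\<Sum>j<N. 2 * \<phi> j * (y (Suc j) - y j) - (\<phi> j)^2 * ((Y j - Y (Suc j)) / m)) \<le> (\<Sum>j<N. \<sigma> (Suc j) * ((y (Suc j) - y j)^2 / D j))"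
      by (intro sum_mono 3) simp
    moreover have "min N K = K" using t(4) by simp
    then have "(\<Sum>j<N. 2 * \<phi> j * (y (Suc j) - y j) - (\<phi> j)^2 * ((Y j - Y (Suc j)) / m)) =
       m / a + 2 * \<theta> * (\<pi> T / T - F T / T) - \<theta>^2 / m * (1 / a - F T / T)"
      unfolding 4 using start_values by (simp add: algebra_simps)
    moreover have "\<beta> * X 0 + (\<Sum>j<N. \<sigma> (Suc j) * (X (Suc j) - X j)) \<le> ?I + e * (X N - X 0)"
      using 2 [of N] t(3) by simp
    moreover have "e * (X N - X 0) \<le> e * Xf 1"
    proof -
      have "0 \<le> X 0" using Xinc [of 0 a] a_pos a_less t(1) by (simp add: X_def Xf_def)
      moreover have "X N = Xf 1" using t(3) by (simp add: X_def)
      ultimately show ?thesis using e by simp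
    qed
    ultimately show ?thesis using 1 m(2) by linarith
  qed
  show ?thesis
  proof (rule field_le_epsilon)
    fix e :: real assume e: "0 < e"
    have X1: "0 \<le> Xf 1" using Xinc [of 0 1] by (simp add: Xf_def)
    have "?K - e / (Xf 1 + 1) * Xf 1 \<le> ?I" using e X1 by (intro approx) simp
    moreover have "e / (Xf 1 + 1) * Xf 1 \<le> e" using e X1 by (simp add: field_simps)
    ultimately show "?K \<le> ?I + e" by linarith
  qed
qed

end

section \<open>Lower bound on the rate\<close>

definition causal :: "real \<Rightarrow> real \<Rightarrow> real \<Rightarrow> real \<Rightarrow> bool" where
  "causal x s y t \<longleftrightarrow> s < t \<or> s = t \<and> x = y"

text \<open>Because \<open>x / 0 = 0\<close>, \<^const>\<open>parab\<close> vanishes at coinciding times.\<close>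

lemma parab_causal_triangle:
  assumes "causal x s y t" "causal y t z u"
  shows "parab x s y t + parab y t z u \<le> parab x s z u"
  using assms parab_triangle [of s t u x y z] by (auto simp: causal_def parab_def)

lemma parab_causal_nonpos: "causal x s y t \<Longrightarrow> parab x s y t \<le> 0"
  by (auto simp: causal_def parab_def)

lemma causal_trans: "causal x s y t \<Longrightarrow> causal y t z u \<Longrightarrow> causal x s z u"
  by (auto simp: causal_def)

text \<open>Over \<open>n\<close> equal pieces the errors add up to order
  \<open>1 / n\<close>.\<close>

lemma antimono_of_quadratic_increments:
  fixes D :: "real \<Rightarrow> real"
  assumes D: "\<And>u v. l \<le> u \<Longrightarrow> u < v \<Longrightarrow> v \<le> r \<Longrightarrow> D v - D u \<le> K * (v - u)^2" and lr: "l \<le> r"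
  shows "D r \<le> D l"
proof (cases "l < r")
  case True
  have le: "D r - D l \<le> K * (r - l)^2 / real n" if n: "0 < n" for n :: nat
  proof -
    define h where "h = (r - l) / n"
    have h: "0 < h" "real n * h = r - l" using True n by (auto simp: h_def)
    have "D (l + real j * h) - D l \<le> real j * (K * h^2)" if "j \<le> n" for j
      using that
    proof (induction j)
      case (Suc j)
      have "real (Suc j) * h \<le> real n * h" using Suc.prems h by (intro mult_right_mono) auto
      then have "D (l + real (Suc j) * h) - D (l + real j * h) \<le> K * ((l + real (Suc j) * h) - (l + real j * h))^2"
        using h by (intro D) (auto simp: algebra_simps)
      then show ?case using Suc by (simp add: algebra_simps)
    qed simp
    from this [of n] have "D r - D l \<le> real n * (K * h^2)" using h by simp
    also have "\<dots> = K * (r - l)^2 / real n" using n by (simp add: h_def power2_eq_square)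
    finally show ?thesis .
  qed
  have "(\<lambda>n. K * (r - l)^2 / real n) \<longlonglongrightarrow> 0" by (rule lim_const_over_n)
  moreover have "\<forall>\<^sub>F n in sequentially. D r - D l \<le> K * (r - l)^2 / real n"
    using eventually_gt_at_top [of "0::nat"] by eventually_elim (rule le)
  ultimately have "D r - D l \<le> 0" by (intro tendsto_lowerbound) auto
  then show ?thesis by simp
qed (use lr in simp)

context optimum
begin

section \<open>Rate and geodesic of the planted optimal curve\<close>

lemma opt_planting: "dominated_planting {0} (\<lambda>_. F) (\<lambda>_. rho) rho"
proof
  show "\<exists>Z. negligible Z \<and> (\<forall>t\<in>{0..1} - Z. \<forall>i\<in>{0::nat}. rho t \<le> rho t)"
    by (intro exI [of _ "{}"]) simp
qed (auto simp: F_admissible rho_admissible rho_integrable rho_def)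

sublocale opt: dominated_planting "{0}" "\<lambda>_. F" "\<lambda>_. rho" rho
  by (rule opt_planting)

lemma rho_powr: "rho t powr (3/2) = (s t)^3"
  using s_pos [of t] by (simp add: rho_def powr_powr powr_numeral [symmetric] del: powr_numeral)

lemma rep_rate_opt: "rep_rate {0} (\<lambda>_. rho) = ennreal (4/3 * (2 * \<beta>^2))"
proof -
  have cube_int: "(\<integral>\<^sup>+t. indicator {0..1} t * ennreal ((s t)^3) \<partial>lebesgue) = ennreal (2 * \<beta>^2)"
  proof -
    have "indicator {0..1} t * ennreal ((s t)^3) = ennreal (indicator {0..1} t * (s t)^3)" for t
      by (simp add: indicator_def)
    then show ?thesis
      using nn_integral_has_integral_lebesgue [OF _ s_cube_integral] s_pos
      by (simp add: less_imp_le nn_integral_completion)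
  qed
  have "(\<lambda>i. if i = 0 then ennreal (4/3) * (\<integral>\<^sup>+t. indicator {0..1} t * ennreal (rho t powr (3/2)) \<partial>lebesgue) else 0)
      sums (ennreal (4/3) * ennreal (2 * \<beta>^2))"
    unfolding rho_powr cube_int using sums_single [of 0 "\<lambda>_. ennreal (4/3) * ennreal (2 * \<beta>^2)"] by simp
  then have "rep_rate {0} (\<lambda>_. rho) = ennreal (4/3) * ennreal (2 * \<beta>^2)"
    unfolding rep_rate_def by (simp add: sums_unique [symmetric])
  also have "\<dots> = ennreal (4/3 * (2 * \<beta>^2))" by (rule ennreal_mult' [symmetric]) simp
  finally show ?thesis .
qed

lemma opt_E_curve: "0 \<le> u \<Longrightarrow> u < v \<Longrightarrow> v \<le> 1 \<Longrightarrow> Lam v - Lam u \<le> opt.E (F u) u (F v) v"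
  by (intro opt.chain_le_E chain.link) (auto simp: curve_link_def curve_gain_F)

text \<open>Invariant along chains: nothing beats following \<open>F\<close> up to some time
  \<open>u'\<close> and then leaving it by one straight segment. When a link returns to
  \<open>F\<close>, the preceding excursion is absorbed by \<open>parab_le_Lam\<close>.\<close>

lemma opt_chain_from_curve:
  "chain (curve_link {0} (\<lambda>_. F) (\<lambda>_. rho)) x \<sigma> y \<tau> v \<Longrightarrow> 0 \<le> u \<Longrightarrow> u \<le> 1 \<Longrightarrow> causal (F u) u x \<sigma> \<Longrightarrow>
    \<exists>u'. 0 \<le> u' \<and> u' \<le> 1 \<and> causal (F u') u' y \<tau> \<and> Lam u + parab (F u) u x \<sigma> + v \<le> Lam u' + parab (F u') u' y \<tau>"
proof (induction arbitrary: u rule: chain.induct)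
  case (direct \<sigma> \<tau> x y)
  have "causal x \<sigma> y \<tau>" using direct by (simp add: causal_def)
  then show ?case
    using direct causal_trans parab_causal_triangle by (intro exI [of _ u]) (smt (verit))
next
  case (link x \<sigma> y \<tau> v)
  then have l: "0 \<le> \<sigma>" "\<sigma> < \<tau>" "\<tau> \<le> 1" "x = F \<sigma>" "y = F \<tau>" "v = Lam \<tau> - Lam \<sigma>"
    by (auto simp: curve_link_def curve_gain_F)
  have "Lam u + parab (F u) u x \<sigma> \<le> Lam \<sigma>"
    using parab_le_Lam [of u \<sigma>] link.prems l by (auto simp: causal_def parab_def)
  then show ?case using l by (intro exI [of _ \<tau>]) (auto simp: causal_def parab_def)
next
  case (append x \<sigma> y \<tau> v z \<upsilon> w)
  obtain u' where "0 \<le> u'" "u' \<le> 1" "causal (F u') u' y \<tau>"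
    "Lam u + parab (F u) u x \<sigma> + v \<le> Lam u' + parab (F u') u' y \<tau>"
    using append.IH(1) append.prems by blast
  moreover from this obtain u'' where "0 \<le> u''" "u'' \<le> 1" "causal (F u'') u'' z \<upsilon>"
    "Lam u' + parab (F u') u' y \<tau> + w \<le> Lam u'' + parab (F u'') u'' z \<upsilon>"
    using append.IH(2) by blast
  ultimately show ?case by (intro exI [of _ u'']) auto
qed

lemma opt_E_total: "opt.E 0 0 0 1 = 0"
proof (rule antisym)
  show "opt.E 0 0 0 1 \<le> 0"
  proof (rule opt.E_leI)
    fix v assume "chain (curve_link {0} (\<lambda>_. F) (\<lambda>_. rho)) 0 0 0 1 v"
    from opt_chain_from_curve [OF this, of 0] obtain u where
      u: "0 \<le> u" "u \<le> 1" "v \<le> Lam u + parab (F u) u 0 1"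
      using F_values Lam_values by (auto simp: causal_def parab_def)
    then show "v \<le> 0"
      using parab_le_Lam [of u 1] F_values Lam_values by (cases "u = 1") (auto simp: parab_def)
  qed simp
  show "0 \<le> opt.E 0 0 0 1" using opt.E_ge [of 0 1 0 0] by (simp add: parab_def)
qed

lemma opt_geodesic: "geodesic_through opt.planted a"
  unfolding geodesic_through_def geodesic_def
proof (intro exI conjI)
  show "path_length opt.planted F 0 1 = opt.planted 0 0 0 1"
  proof (rule antisym)
    show "path_length opt.planted F 0 1 \<le> opt.planted 0 0 0 1"
      unfolding path_length_def
      by (rule INF_lower2 [where i = "(1, real)"]) (use F_values in auto)
    show "opt.planted 0 0 0 1 \<le> path_length opt.planted F 0 1"
      unfolding path_length_def
    proof (rule INF_greatest, clarify)
      fix K :: nat and \<tau> :: "nat \<Rightarrow> real"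
      assume \<tau>: "0 < K" "\<tau> 0 = 0" "\<tau> K = 1" "\<forall>i<K. \<tau> i < \<tau> (Suc i)"
      have mono: "\<tau> i \<le> \<tau> j" if "i \<le> j" "j \<le> K" for i j
        using that
      proof (induction j)
        case (Suc j)
        then have "\<tau> j < \<tau> (Suc j)" using \<tau>(4) by simp
        then show ?case using Suc by (cases "i = Suc j") auto
      qed simp
      have "(\<Sum>i<K. Lam (\<tau> (Suc i)) - Lam (\<tau> i)) = 0"
        using \<tau> Lam_values sum_lessThan_telescope [of "\<lambda>i. Lam (\<tau> i)" K] by simp
      moreover have "(\<Sum>i<K. Lam (\<tau> (Suc i)) - Lam (\<tau> i)) \<le> (\<Sum>i<K. opt.E (F (\<tau> i)) (\<tau> i) (F (\<tau> (Suc i))) (\<tau> (Suc i)))"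
      proof (rule sum_mono)
        fix i assume "i \<in> {..<K}"
        then show "Lam (\<tau> (Suc i)) - Lam (\<tau> i) \<le> opt.E (F (\<tau> i)) (\<tau> i) (F (\<tau> (Suc i))) (\<tau> (Suc i))"
          using mono [of 0 i] mono [of "Suc i" K] \<tau> by (intro opt_E_curve) auto
      qed
      ultimately show "opt.planted 0 0 0 1 \<le> (\<Sum>i<K. opt.planted (F (\<tau> i)) (\<tau> i) (F (\<tau> (Suc i))) (\<tau> (Suc i)))"
        by (simp add: opt.planted_def opt_E_total)
    qed
  qed
qed (use F_values F_continuous in auto)

end

section \<open>Excess rate controls the deviation from the optimum\<close>

locale competitor = optimum a + finite_planting I \<gamma> \<rho>
  for a :: real and I :: "nat set" and \<gamma> \<rho> :: "nat \<Rightarrow> real \<Rightarrow> real" +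
  fixes e :: dmetric and \<pi> \<Lambda> :: "real \<Rightarrow> real"
  assumes planted_e: "planted_by e I \<gamma> \<rho>"
    and \<pi>: "\<pi> 0 = 0" "\<pi> a = 1" "\<pi> 1 = 0"
    and potential: "0 \<le> u \<Longrightarrow> u < v \<Longrightarrow> v \<le> 1 \<Longrightarrow> e (\<pi> u) u (\<pi> v) v = ereal (\<Lambda> v - \<Lambda> u)"
begin

lemma E_potential: "0 \<le> u \<Longrightarrow> u < v \<Longrightarrow> v \<le> 1 \<Longrightarrow> E (\<pi> u) u (\<pi> v) v = \<Lambda> v - \<Lambda> u"
  using planted_by_unique [OF planted_e, of u v "\<pi> u" "\<pi> v"] potential by simp

lemma \<Lambda>_upper:
  assumes "0 \<le> u" "u < v" "v \<le> 1"
  shows "\<Lambda> v - \<Lambda> u \<le> parab (\<pi> u) u (\<pi> v) v + integral {u..v} R"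
  using E_le [OF assms(2), of "\<pi> u" "\<pi> v"] E_potential [OF assms] X_diff [of u v] assms by simp

lemma \<Lambda>_lower:
  assumes "0 \<le> u" "u < v" "v \<le> 1"
  shows "parab (\<pi> u) u (\<pi> v) v \<le> \<Lambda> v - \<Lambda> u"
  using E_ge [OF assms(2), of "\<pi> u" "\<pi> v"] E_potential [OF assms] by simp

definition r :: real where "r = integral {0..1} S"

lemma rep_rate_r: "rep_rate I \<rho> = ennreal (4/3 * r)"
  unfolding r_def by (rule rep_rate_integral)

lemma S_integrable: "S integrable_on {0..1}"
  by (intro set_lebesgue_integral_eq_integral(1) P_absolutely_integrable) simp

lemma integral_s_R_ge:
  assumes start: "\<Lambda> a - \<Lambda> 0 \<le> - (1 / a) - x + integral {0..a} R" and T: "a < T" "T < 1"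
  shows "2 * \<beta>^2 + \<beta> * x + 2 * \<theta> * (\<pi> T / T - F T / T) - \<theta>^2 / m * (1 / a - F T / T)
    \<le> integral {0..1} (\<lambda>t. s t * R t)"
proof (rule weighted_density_bound [OF R_int R_nonneg \<pi>(2,3) _ _ start T])
  show "- ((\<pi> t)^2 / t) \<le> \<Lambda> t - \<Lambda> 0" if "a \<le> t" "t \<le> 1" for t
    using \<Lambda>_lower [of 0 t] that a_pos \<pi>(1) by (simp add: parab_def)
  show "\<Lambda> v - \<Lambda> u \<le> parab (\<pi> u) u (\<pi> v) v + integral {u..v} R" if "a \<le> u" "u < v" "v \<le> 1" for u v
    using that a_pos by (intro \<Lambda>_upper) auto
qed

lemma integral_s_R_le: "3 / 2 * integral {0..1} (\<lambda>t. s t * R t) \<le> r + \<beta>^2"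
proof -
  have "integral {0..1} (\<lambda>t. 3 / 2 * (s t * R t)) \<le> integral {0..1} (\<lambda>t. S t + (s t)^3 / 2)"
  proof (rule integral_le)
    show "(\<lambda>t. 3 / 2 * (s t * R t)) integrable_on {0..1}"
      by (intro integrable_on_mult_right s_mult_integrable [OF R_int])
    show "(\<lambda>t. S t + (s t)^3 / 2) integrable_on {0..1}"
      using s_cube_integral by (intro integrable_add S_integrable integrable_on_divide) (auto simp: integrable_on_def)
    show "3 / 2 * (s t * R t) \<le> S t + (s t)^3 / 2" for t
      unfolding R_def by (intro young_two_thirds P_nonneg less_imp_le s_pos)
  qed
  moreover have "integral {0..1} (\<lambda>t. S t + (s t)^3 / 2) = r + \<beta>^2"
    unfolding r_def using has_integral_add [OF integrable_integral [OF S_integrable] has_integral_divide [OF s_cube_integral, of 2]]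
    by (simp add: integral_unique)
  ultimately show ?thesis by simp
qed

lemma start0: "\<Lambda> a - \<Lambda> 0 \<le> - (1 / a) - 0 + integral {0..a} R"
  using \<Lambda>_upper [of 0 a] \<pi> a_pos a_less by (simp add: parab_def)

text \<open>With \<open>\<theta> = 0\<close> the dual bound does not depend on \<open>T\<close>, so
  any time between \<open>a\<close> and 1 will do.\<close>

lemma half_range: "a < 1/2" "(1/2::real) < 1" using a_less by auto

lemma r_lower: "2 * \<beta>^2 \<le> r"
  using integral_s_R_ge [OF start0 half_range, of 0] integral_s_R_le by simp

text \<open>The left side is linear in the deviation at \<open>T\<close> minus a quadratic in
  \<open>\<theta>\<close>. Choosing \<open>\<theta>\<close> of either sign, a small excess
  \<open>r - 2 * \<beta>^2\<close> confines the path to a neighbourhood of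
  \<open>F T\<close>.\<close>

lemma geodesic_defect:
  assumes T: "a < T" "T < 1"
  shows "2 * \<theta> * (\<pi> T / T - F T / T) - \<theta>^2 / m * (1 / a - F T / T) \<le> 2 / 3 * (r - 2 * \<beta>^2)"
  using integral_s_R_ge [OF start0 T, of \<theta>] integral_s_R_le by argo

text \<open>The first leg is split at \<open>w\<close>, and \<open>x\<close> becomes the extra
  Dirichlet cost of passing through \<open>\<pi> w\<close> instead of going straight.\<close>

lemma initial_defect:
  assumes w: "0 < w" "w < a"
  shows "\<beta> * ((\<pi> w)^2 / w + (1 - \<pi> w)^2 / (a - w) - 1 / a) \<le> 2 / 3 * (r - 2 * \<beta>^2)"
proof -
  have "\<Lambda> w - \<Lambda> 0 \<le> - ((\<pi> w)^2 / w) + integral {0..w} R"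
    using \<Lambda>_upper [of 0 w] w a_less \<pi> by (simp add: parab_def)
  moreover have "\<Lambda> a - \<Lambda> w \<le> - ((1 - \<pi> w)^2 / (a - w)) + integral {w..a} R"
    using \<Lambda>_upper [of w a] w a_less \<pi> by (simp add: parab_def)
  moreover have "integral {0..w} R + integral {w..a} R = integral {0..a} R"
    using w a_less by (intro integral_add_adjacent R_integrable) auto
  ultimately have "\<Lambda> a - \<Lambda> 0 \<le> - (1 / a) - ((\<pi> w)^2 / w + (1 - \<pi> w)^2 / (a - w) - 1 / a) + integral {0..a} R"
    by simp
  from integral_s_R_ge [OF this half_range, of 0] have "2 * \<beta>^2 + \<beta> * ((\<pi> w)^2 / w + (1 - \<pi> w)^2 / (a - w) - 1 / a)
      \<le> integral {0..1} (\<lambda>t. s t * R t)" by simp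
  with integral_s_R_le show ?thesis by argo
qed

text \<open>Young's inequality with weight \<open>s + \<theta>\<close> on \<open>{u..v}\<close> and
  \<open>s\<close> elsewhere. In the expanded cube the term linear in \<open>\<theta>\<close>
  produces \<open>rho\<close>; with \<open>\<theta>\<close> of the order of the square root of the
  excess, all errors vanish in the limit.\<close>

lemma integral_R_le:
  assumes uv: "0 \<le> u" "u \<le> v" "v \<le> 1" and \<theta>: "0 < \<theta>"
  shows "integral {u..v} R \<le> integral {u..v} rho + 2 / 3 * (r - 2 * \<beta>^2) / \<theta> + \<beta> * \<theta> + \<theta>^2 / 3"
proof -
  define j where "j = (\<lambda>(f::real \<Rightarrow> real) t. if t \<in> {u..v} then f t else 0)"
  have ji: "(j f has_integral integral {u..v} f) {0..1}" if "f integrable_on {u..v}" for f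
    unfolding j_def
    using has_integral_restrict [of "{u..v}" "{0..1}" f "integral {u..v} f"] integrable_integral [OF that] uv by auto
  have "((\<lambda>t. 3 / 2 * (s t * R t) + 3 / 2 * \<theta> * j R t) has_integral
      3 / 2 * integral {0..1} (\<lambda>t. s t * R t) + 3 / 2 * \<theta> * integral {u..v} R) {0..1}"
    using uv by (intro has_integral_add has_integral_mult_right ji R_sub integrable_integral s_mult_integrable [OF R_int]) auto
  moreover have "((\<lambda>t. S t + (s t)^3 / 2 + (3 / 2 * \<theta> * j rho t + (3 / 2 * \<beta> * \<theta>^2 + \<theta>^3 / 2) * 1)) has_integral
      r + 2 * \<beta>^2 / 2 + (3 / 2 * \<theta> * integral {u..v} rho + (3 / 2 * \<beta> * \<theta>^2 + \<theta>^3 / 2) * ((1 - 0) * 1))) {0..1}"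
    unfolding r_def using uv has_integral_const_real [of "1::real" 0 1]
    by (intro has_integral_add has_integral_divide has_integral_mult_right ji rho_integrable_on integrable_integral S_integrable s_cube_integral) auto
  moreover have "3 / 2 * (s t * R t) + 3 / 2 * \<theta> * j R t \<le> S t + (s t)^3 / 2 + (3 / 2 * \<theta> * j rho t + (3 / 2 * \<beta> * \<theta>^2 + \<theta>^3 / 2) * 1)"
    if "t \<in> {0..1}" for t
  proof (cases "t \<in> {u..v}")
    case True
    have "3 / 2 * ((s t + \<theta>) * R t) \<le> S t + (s t + \<theta>)^3 / 2"
      unfolding R_def using \<theta> by (intro young_two_thirds P_nonneg add_nonneg_nonneg less_imp_le s_pos)
    moreover have "(s t + \<theta>)^3 = (s t)^3 + 3 * \<theta> * rho t + 3 * s t * \<theta>^2 + \<theta>^3"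
      by (simp add: rho_def power2_eq_square power3_eq_cube algebra_simps)
    moreover have "s t * \<theta>^2 \<le> \<beta> * \<theta>^2" by (intro mult_right_mono s_le_\<beta>) simp
    moreover have "(s t + \<theta>) * R t = s t * R t + \<theta> * R t" "j R t = R t" "j rho t = rho t"
      using True by (simp_all add: j_def algebra_simps)
    ultimately show ?thesis by (simp only:) argo
  next
    case False
    have "3 / 2 * (s t * R t) \<le> S t + (s t)^3 / 2"
      unfolding R_def by (intro young_two_thirds P_nonneg less_imp_le s_pos)
    moreover have "0 \<le> 3 / 2 * \<beta> * \<theta>^2 + \<theta>^3 / 2" using \<beta> \<theta> by simp
    moreover have "j R t = 0" "j rho t = 0" using False by (auto simp: j_def)
    ultimately show ?thesis by (simp only:) argo
  qed
  ultimately have "3 / 2 * integral {0..1} (\<lambda>t. s t * R t) + 3 / 2 * \<theta> * integral {u..v} R \<le>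
      r + 2 * \<beta>^2 / 2 + (3 / 2 * \<theta> * integral {u..v} rho + (3 / 2 * \<beta> * \<theta>^2 + \<theta>^3 / 2) * ((1 - 0) * 1))"
    by (rule has_integral_le)
  moreover have "2 * \<beta>^2 \<le> integral {0..1} (\<lambda>t. s t * R t)"
    using integral_s_R_ge [OF start0 half_range, of 0] by simp
  ultimately have "\<theta> * integral {u..v} R \<le> 2 / 3 * (r - 2 * \<beta>^2) + \<theta> * integral {u..v} rho + \<beta> * \<theta>^2 + \<theta>^3 / 3"
    by (simp add: algebra_simps)
  also have "\<dots> = \<theta> * (integral {u..v} rho + 2 / 3 * (r - 2 * \<beta>^2) / \<theta> + \<beta> * \<theta> + \<theta>^2 / 3)"
  proof -
    have "d + \<theta> * A + B * \<theta>^2 + \<theta>^3 / 3 = \<theta> * (A + d / \<theta> + B * \<theta> + \<theta>^2 / 3)" for A B d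
      using \<theta> by (simp add: power2_eq_square power3_eq_cube field_simps)
    then show ?thesis .
  qed
  finally show ?thesis using \<theta> by simp
qed

end

section \<open>Locality\<close>

lemma compact_coincidence_nbhd:
  fixes f g :: "real \<Rightarrow> real"
  assumes "continuous_on {0..1} f" "continuous_on {0..1} g"
  shows "compact {t \<in> {0..1}. \<bar>f t - g t\<bar> \<le> w}"
proof -
  have "{t \<in> {0..1}. \<bar>f t - g t\<bar> \<le> w} = {0..1} \<inter> (\<lambda>t. \<bar>f t - g t\<bar>) -` {..w}" by auto
  moreover have "closed ({0..1} \<inter> (\<lambda>t. \<bar>f t - g t\<bar>) -` {..w})"
    using assms by (intro continuous_closed_preimage continuous_intros) auto
  moreover have "bounded ({0..1::real} \<inter> (\<lambda>t. \<bar>f t - g t\<bar>) -` {..w})"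
    by (rule bounded_subset [OF bounded_closed_interval]) blast
  ultimately show ?thesis by (simp add: compact_eq_bounded_closed)
qed

context dominated_planting
begin

lemma X_clamp: "X t = X (max 0 (min 1 t))"
  by (simp add: X_def)

lemma X_diff_clamp:
  assumes "s \<le> t" shows "X t - X s = integral {max 0 (min 1 s)..max 0 (min 1 t)} R"
  using X_diff [of "max 0 (min 1 s)" "max 0 (min 1 t)"] assms X_clamp [of s] X_clamp [of t] by simp

lemma curve_gain_causal_le:
  assumes "i \<in> I" "0 \<le> s" "s \<le> t" "t \<le> 1"
  shows "curve_gain (\<gamma> i) (\<rho> i) s t \<le> parab (\<gamma> i s) s (\<gamma> i t) t + (X t - X s)"
  using curve_gain_le [of i s t] assms by (cases "s = t") (auto simp: curve_gain_def parab_def)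

end

section \<open>Other curves collecting the density on the optimal curve\<close>

context optimum
begin

lemma antimono_across_a:
  fixes D :: "real \<Rightarrow> real"
  assumes inc: "\<And>x y. l \<le> x \<Longrightarrow> x < y \<Longrightarrow> y \<le> r \<Longrightarrow> y \<le> a \<or> a \<le> x \<Longrightarrow> D y - D x \<le> K * (y - x)^2"
    and lr: "l \<le> r"
  shows "D r \<le> D l"
proof -
  \<comment> \<open>Clamping \<open>a\<close> to the interval treats a corner inside and outside of
    it alike.\<close>
  have "D r \<le> D (max l (min a r))"
  proof (rule antimono_of_quadratic_increments [where D = D and K = K])
    fix x y assume xy: "max l (min a r) \<le> x" "x < y" "y \<le> r"
    then have "l \<le> x" "a \<le> x" by linarith+
    then show "D y - D x \<le> K * (y - x)^2" using xy by (intro inc) auto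
  qed (use lr in simp)
  also have "\<dots> \<le> D l"
  proof (rule antimono_of_quadratic_increments [where D = D and K = K])
    fix x y assume xy: "l \<le> x" "x < y" "y \<le> max l (min a r)"
    then have "y \<le> r" "y \<le> a" by linarith+
    then show "D y - D x \<le> K * (y - x)^2" using xy by (intro inc) auto
  qed simp
  finally show ?thesis .
qed

text \<open>A planted curve may collect the density on the optimal curve only while it coincides with
  that curve; on a short interval the first and last coincidence times suffice to compare.\<close>

lemma short_curve_le:
  assumes g: "admissible_curve g" and uv: "0 \<le> u" "u < v" "v \<le> 1" "v \<le> a \<or> a \<le> u"
    and f: "f integrable_on {0..1}" "\<And>t. f t = (if g t = F t then rho t else 0)"
  shows "integral {u..v} f - integral {u..v} (\<lambda>t. (deriv g t)^2) \<le> opt.E (g u) u (g v) v + \<beta>^2 / (2 * a) * (v - u)^2"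
proof -
  define en where "en s t = integral {s..t} (\<lambda>t. (deriv g t)^2)" for s t
  define Er where "Er s t = (if s < t then opt.E (g s) s (g t) t else 0)" for s t
  have Er_add: "Er s t + Er t w \<le> Er s w" if "s \<le> t" "t \<le> w" for s t w
    using opt.E_triangle [of s t w "g s" "g t" "g w"] that by (auto simp: Er_def)
  have en_add: "en s t + en t w = en s w" if "0 \<le> s" "s \<le> t" "t \<le> w" "w \<le> 1" for s t w
    unfolding en_def using that
    by (intro integral_add_adjacent set_lebesgue_integral_eq_integral(1) admissible_curve_deriv(2) g)
  have en_le: "- en s t \<le> parab (g s) s (g t) t" if "0 \<le> s" "s \<le> t" "t \<le> 1" for s t
    using admissible_curve_energy [OF g, of s t] that by (cases "s = t") (auto simp: en_def parab_def)
  have en_Er: "- en s t \<le> Er s t" if "0 \<le> s" "s \<le> t" "t \<le> 1" for s t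
    using en_le [OF that] opt.E_ge [of s t "g s" "g t"] that by (cases "s = t") (auto simp: Er_def parab_def)
  define C where "C = {u..v} \<inter> {t \<in> {0..1}. \<bar>g t - F t\<bar> \<le> 0}"
  have "compact C" unfolding C_def
    by (intro closed_Int_compact compact_coincidence_nbhd admissible_curve_deriv(4) g F_continuous) simp
  have K: "0 \<le> \<beta>^2 / (2 * a)" using a_pos by simp
  show ?thesis
  proof (cases "C = {}")
    case True
    have "integral {u..v} f = integral {u..v} (\<lambda>_. 0)"
      using True uv f(2) by (intro Henstock_Kurzweil_Integration.integral_cong) (auto simp: C_def)
    moreover have "- en u v \<le> opt.E (g u) u (g v) v" using en_Er [of u v] uv by (simp add: Er_def)
    moreover have "0 \<le> \<beta>^2 / (2 * a) * (v - u)^2" by (rule mult_nonneg_nonneg [OF K]) simp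
    ultimately show ?thesis by (simp add: en_def)
  next
    case False
    obtain p where p: "p \<in> C" "\<And>t. t \<in> C \<Longrightarrow> p \<le> t" using compact_attains_inf [OF \<open>compact C\<close> False] by blast
    obtain w where w: "w \<in> C" "\<And>t. t \<in> C \<Longrightarrow> t \<le> w" using compact_attains_sup [OF \<open>compact C\<close> False] by blast
    have pw: "u \<le> p" "p \<le> w" "w \<le> v" "0 \<le> p" "w \<le> 1" "g p = F p" "g w = F w"
      using p w by (auto simp: C_def)
    have "integral {u..v} f \<le> integral {u..v} (\<lambda>t. if t \<in> {p..w} then rho t else 0)"
    proof (rule integral_le)
      show "f integrable_on {u..v}" by (rule integrable_subinterval_real [OF f(1)]) (use uv in auto)
      show "(\<lambda>t. if t \<in> {p..w} then rho t else 0) integrable_on {u..v}"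
        using integrable_restrict_Int [of "{p..w}" rho "{u..v}"] rho_integrable_on pw
        by (simp add: Int_absorb2)
      show "f t \<le> (if t \<in> {p..w} then rho t else 0)" if "t \<in> {u..v}" for t
        using p(2) [of t] w(2) [of t] that uv by (auto simp: f(2) C_def rho_def)
    qed
    also have "\<dots> = integral ({p..w} \<inter> {u..v}) rho"
      by (rule Henstock_Kurzweil_Integration.integral_restrict_Int)
    also have "{p..w} \<inter> {u..v} = {p..w}" using pw by auto
    finally have fi: "integral {u..v} f \<le> integral {p..w} rho" .
    have mid: "integral {p..w} rho - en p w \<le> Er p w + \<beta>^2 / (2 * a) * (v - u)^2"
    proof (cases "p < w")
      case True
      have "integral {p..w} rho + parab (F p) p (F w) w \<le> (Lam w - Lam p) + \<beta>^2 / (2 * a) * (w - p)^2"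
        using True pw uv by (intro energy_defect) auto
      moreover have "Lam w - Lam p \<le> Er p w" using opt_E_curve [of p w] True pw by (simp add: Er_def)
      moreover have "\<beta>^2 / (2 * a) * (w - p)^2 \<le> \<beta>^2 / (2 * a) * (v - u)^2"
        using K pw by (intro mult_left_mono power_mono) auto
      moreover have "- en p w \<le> parab (F p) p (F w) w" using en_le [of p w] True pw by simp
      ultimately show ?thesis by linarith
    next
      case False
      then have "p = w" using pw by simp
      moreover have "0 \<le> \<beta>^2 / (2 * a) * (v - u)^2" by (rule mult_nonneg_nonneg [OF K]) simp
      ultimately show ?thesis by (simp add: Er_def en_def)
    qed
    have "- en u p \<le> Er u p" "- en w v \<le> Er w v" using uv pw by (auto intro!: en_Er)
    moreover have "en u p + en p w = en u w" "en u w + en w v = en u v" using uv pw by (auto intro!: en_add)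
    moreover have "Er u p + Er p w \<le> Er u w" "Er u w + Er w v \<le> Er u v" using uv pw by (auto intro!: Er_add)
    ultimately have "integral {u..v} f - en u v \<le> Er u v + \<beta>^2 / (2 * a) * (v - u)^2" using fi mid by linarith
    then show ?thesis using uv by (simp add: en_def Er_def)
  qed
qed

text \<open>The quadratic errors of \<open>short_curve_le\<close> vanish under subdivision, and the
  triangle inequality reassembles the pieces. So sharing the density of \<open>F\<close> gives a
  curve nothing beyond what the planted metric already allows.\<close>

lemma curve_le_opt:
  assumes g: "admissible_curve g" and uv: "0 \<le> u" "u < v" "v \<le> 1"
    and f: "f integrable_on {0..1}" "\<And>t. f t = (if g t = F t then rho t else 0)"
  shows "integral {u..v} f - integral {u..v} (\<lambda>t. (deriv g t)^2) \<le> opt.E (g u) u (g v) v"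
proof -
  define M where "M t = integral {u..t} f - integral {u..t} (\<lambda>t. (deriv g t)^2)" for t
  define D where "D t = M t - (if u < t then opt.E (g u) u (g t) t else 0)" for t
  have M_diff: "M t - M s = integral {s..t} f - integral {s..t} (\<lambda>t. (deriv g t)^2)" if "u \<le> s" "s \<le> t" "t \<le> v" for s t
  proof -
    have "integral {u..s} f + integral {s..t} f = integral {u..t} f"
      using that uv by (intro integral_add_adjacent f) auto
    moreover have "integral {u..s} (\<lambda>t. (deriv g t)^2) + integral {s..t} (\<lambda>t. (deriv g t)^2) = integral {u..t} (\<lambda>t. (deriv g t)^2)"
      using that uv by (intro integral_add_adjacent set_lebesgue_integral_eq_integral(1) admissible_curve_deriv(2) g) auto
    ultimately show ?thesis by (simp add: M_def)
  qed
  have inc: "D t - D s \<le> \<beta>^2 / (2 * a) * (t - s)^2" if "u \<le> s" "s < t" "t \<le> v" "t \<le> a \<or> a \<le> s" for s t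
  proof -
    have "M t - M s \<le> opt.E (g s) s (g t) t + \<beta>^2 / (2 * a) * (t - s)^2"
      using M_diff [of s t] short_curve_le [OF g _ _ _ _ f, of s t] that uv by auto
    moreover have "(if u < s then opt.E (g u) u (g s) s else 0) + opt.E (g s) s (g t) t \<le> opt.E (g u) u (g t) t"
      using opt.E_triangle [of u s t "g u" "g s" "g t"] that by auto
    ultimately show ?thesis using that by (simp add: D_def)
  qed
  have "D v \<le> D u"
    by (rule antimono_across_a [OF inc]) (use uv in auto)
  then show ?thesis using uv by (simp add: D_def M_def)
qed

end

section \<open>Density concentrated on the optimal curve\<close>

locale tight_competitor = competitor a I \<gamma> \<rho> e "optimum.F a" "optimum.Lam a"
  for a :: real and I :: "nat set" and \<gamma> \<rho> :: "nat \<Rightarrow> real \<Rightarrow> real" and e :: dmetric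
begin

definition near :: "real \<Rightarrow> nat \<Rightarrow> real set" where
  "near w i = {t \<in> {0..1}. \<bar>\<gamma> i t - F t\<bar> \<le> w}"

text \<open>The analogue of \<open>R\<close> for curves within \<open>w\<close> of \<open>F\<close>,
  selected at each time separately.\<close>

definition Q :: "real \<Rightarrow> real \<Rightarrow> real" where
  "Q w t = P (near w) t powr (2/3)"

lemma near_measurable: "i \<in> I \<Longrightarrow> near w i \<in> sets lebesgue"
  unfolding near_def
  by (intro fmeasurableD lmeasurable_compact compact_coincidence_nbhd admissible_curve_deriv(4) curve F_continuous)

text \<open>The index set is empty because only the cumulative function of \<open>Q w\<close> is
  wanted.\<close>

lemma Q_planting: "dominated_planting {} \<gamma> \<rho> (Q w)"
proof
  show "Q w absolutely_integrable_on {0..1}"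
    unfolding Q_def [abs_def] by (rule P_two_thirds_integrable) (rule near_measurable)
  show "\<exists>Z. negligible Z \<and> (\<forall>t\<in>{0..1} - Z. \<forall>i\<in>{}. \<rho> i t \<le> Q w t)"
    by (intro exI [of _ "{}"]) simp
qed (auto simp: Q_def)

abbreviation XQ :: "real \<Rightarrow> real \<Rightarrow> real" where
  "XQ w \<equiv> dominated_planting.X (Q w)"

lemma XQ_le_X:
  assumes "\<sigma> \<le> \<tau>" shows "XQ w \<tau> - XQ w \<sigma> \<le> X \<tau> - X \<sigma>"
proof -
  interpret nr: dominated_planting "{}" \<gamma> \<rho> "Q w" by (rule Q_planting)
  obtain Z where Z: "negligible Z" "\<And>t N. t \<in> {0..1} - Z \<Longrightarrow> P N t \<le> S t" using term_bounds by metis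
  show ?thesis
    unfolding nr.X_diff_clamp [OF assms] X_diff_clamp [OF assms]
  proof (rule integral_le_off_negligible [OF _ _ Z(1)])
    show "Q w t \<le> R t" if "t \<in> {max 0 (min 1 \<sigma>)..max 0 (min 1 \<tau>)} - Z" for t
      unfolding Q_def R_def using that Z(2) [of t] P_nonneg by (intro powr_mono2) auto
  qed (auto intro!: nr.R_sub R_sub)
qed

lemma near_link_le:
  assumes i: "i \<in> I" "0 \<le> \<sigma>" "\<sigma> < \<tau>" "\<tau> \<le> 1" and near: "\<And>t. t \<in> {\<sigma>..\<tau>} \<Longrightarrow> \<bar>\<gamma> i t - F t\<bar> \<le> w"
  shows "curve_gain (\<gamma> i) (\<rho> i) \<sigma> \<tau> \<le> parab (\<gamma> i \<sigma>) \<sigma> (\<gamma> i \<tau>) \<tau> + (XQ w \<tau> - XQ w \<sigma>)"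
proof -
  interpret nr: dominated_planting "{}" \<gamma> \<rho> "Q w" by (rule Q_planting)
  obtain Z where Z: "negligible Z"
    "\<And>i t N. i \<in> I \<Longrightarrow> t \<in> {0..1} - Z \<Longrightarrow> t \<in> N i \<Longrightarrow> \<rho> i t powr (3/2) \<le> P N t" using term_bounds by metis
  have "integral {\<sigma>..\<tau>} (\<rho> i) \<le> integral {\<sigma>..\<tau>} (Q w)"
  proof (rule integral_le_off_negligible [OF _ _ Z(1)])
    show "\<rho> i integrable_on {\<sigma>..\<tau>}" using i by (intro density_integrable_on)
    show "Q w integrable_on {\<sigma>..\<tau>}" using i by (intro nr.R_sub) auto
    show "\<rho> i t \<le> Q w t" if t: "t \<in> {\<sigma>..\<tau>} - Z" for t
    proof -
      have t01: "t \<in> {0..1}" using t i by auto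
      have "\<rho> i t powr (3/2) \<le> P (near w) t" using Z(2) [of i t "near w"] near [of t] t t01 i(1) by (auto simp: near_def)
      then have "(\<rho> i t powr (3/2)) powr (2/3) \<le> Q w t" unfolding Q_def by (intro powr_mono2) auto
      then show ?thesis using density_nonneg [OF i(1) t01] by (simp add: powr_three_halves_inverse)
    qed
  qed
  then show ?thesis
    using admissible_curve_energy [OF curve [OF i(1)] i(2-4)] nr.X_diff [of \<sigma> \<tau>] i by (simp add: curve_gain_def)
qed

text \<open>A link within \<open>w\<close> of \<open>F\<close> is charged to \<open>Q w\<close>; any
  other is cut at a far point, and then its gain is bounded by \<open>X\<close> while the visit
  stays on record. Concatenation keeps one far point and straightens the rest by the triangle
  inequality.\<close>

lemma chain_near_or_far:
  "chain (curve_link I \<gamma> \<rho>) x \<sigma> y \<tau> v \<Longrightarrow>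
    v \<le> parab x \<sigma> y \<tau> + (XQ w \<tau> - XQ w \<sigma>) \<or>
    (\<exists>z t. causal x \<sigma> z t \<and> causal z t y \<tau> \<and> t \<in> {0..1} \<and> w < \<bar>z - F t\<bar> \<and>
       v \<le> parab x \<sigma> z t + parab z t y \<tau> + (X \<tau> - X \<sigma>))"
proof (induction rule: chain.induct)
  case (direct \<sigma> \<tau> x y)
  interpret nr: dominated_planting "{}" \<gamma> \<rho> "Q w" by (rule Q_planting)
  show ?case using nr.X_mono [of \<sigma> \<tau>] direct by simp
next
  case (link x \<sigma> y \<tau> v)
  then obtain i where i: "i \<in> I" "0 \<le> \<sigma>" "\<sigma> < \<tau>" "\<tau> \<le> 1" "x = \<gamma> i \<sigma>" "y = \<gamma> i \<tau>" "v = curve_gain (\<gamma> i) (\<rho> i) \<sigma> \<tau>"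
    unfolding curve_link_def by blast
  show ?case
  proof (cases "\<forall>t\<in>{\<sigma>..\<tau>}. \<bar>\<gamma> i t - F t\<bar> \<le> w")
    case True
    then show ?thesis using near_link_le [of i \<sigma> \<tau> w] i by simp
  next
    case False
    then obtain t where t: "\<sigma> \<le> t" "t \<le> \<tau>" "w < \<bar>\<gamma> i t - F t\<bar>" by (auto simp: not_le)
    have "v = curve_gain (\<gamma> i) (\<rho> i) \<sigma> t + curve_gain (\<gamma> i) (\<rho> i) t \<tau>"
      using curve_gain_add [OF curve density, of i i \<sigma> t \<tau>] i t by simp
    also have "\<dots> \<le> (parab x \<sigma> (\<gamma> i t) t + (X t - X \<sigma>)) + (parab (\<gamma> i t) t y \<tau> + (X \<tau> - X t))"
      unfolding i(5,6) using i t by (intro add_mono curve_gain_causal_le) auto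
    finally have "v \<le> parab x \<sigma> (\<gamma> i t) t + parab (\<gamma> i t) t y \<tau> + (X \<tau> - X \<sigma>)" by simp
    moreover have "causal x \<sigma> (\<gamma> i t) t" "causal (\<gamma> i t) t y \<tau>" using t i by (auto simp: causal_def)
    ultimately show ?thesis using t i by (intro disjI2 exI [of _ "\<gamma> i t"] exI [of _ t]) auto
  qed
next
  case (append x \<sigma> y \<tau> v z \<upsilon> u)
  have lt: "\<sigma> < \<tau>" "\<tau> < \<upsilon>" using append.hyps chain_less by blast+
  have c: "causal x \<sigma> y \<tau>" "causal y \<tau> z \<upsilon>" using lt by (auto simp: causal_def)
  have XQ: "XQ w \<tau> - XQ w \<sigma> \<le> X \<tau> - X \<sigma>" "XQ w \<upsilon> - XQ w \<tau> \<le> X \<upsilon> - X \<tau>"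
    using lt by (auto intro!: XQ_le_X)
  have v_le: "v \<le> parab x \<sigma> y \<tau> + (X \<tau> - X \<sigma>)" "u \<le> parab y \<tau> z \<upsilon> + (X \<upsilon> - X \<tau>)"
    using chain_le append.hyps by blast+
  show ?case
  proof (cases "v \<le> parab x \<sigma> y \<tau> + (XQ w \<tau> - XQ w \<sigma>)")
    case v: True
    show ?thesis
    proof (cases "u \<le> parab y \<tau> z \<upsilon> + (XQ w \<upsilon> - XQ w \<tau>)")
      case True
      then show ?thesis using v parab_causal_triangle [OF c] by linarith
    next
      case False
      then obtain z' t where zt: "causal y \<tau> z' t" "causal z' t z \<upsilon>" "t \<in> {0..1}" "w < \<bar>z' - F t\<bar>"
        "u \<le> parab y \<tau> z' t + parab z' t z \<upsilon> + (X \<upsilon> - X \<tau>)"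
        using append.IH(2) by blast
      have "v + u \<le> parab x \<sigma> z' t + parab z' t z \<upsilon> + (X \<upsilon> - X \<sigma>)"
        using v_le(1) zt(5) parab_causal_triangle [OF c(1) zt(1)] by linarith
      then show ?thesis using zt causal_trans [OF c(1) zt(1)] by blast
    qed
  next
    case False
    then obtain z' t where zt: "causal x \<sigma> z' t" "causal z' t y \<tau>" "t \<in> {0..1}" "w < \<bar>z' - F t\<bar>"
      "v \<le> parab x \<sigma> z' t + parab z' t y \<tau> + (X \<tau> - X \<sigma>)"
      using append.IH(1) by blast
    have "v + u \<le> parab x \<sigma> z' t + parab z' t z \<upsilon> + (X \<upsilon> - X \<sigma>)"
      using v_le(2) zt(5) parab_causal_triangle [OF zt(2) c(2)] by linarith
    then show ?thesis using zt causal_trans [OF zt(2) c(2)] by blast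
  qed
qed

text \<open>Over a short time, the detour to a point at distance \<^term>\<open>w\<close> from the optimal curve costs more
  than all planted density can return.\<close>

lemma short_time_bound:
  assumes w: "0 < w"
  shows "\<exists>d>0. \<forall>u v. 0 \<le> u \<and> u < v \<and> v \<le> 1 \<and> v - u \<le> d \<longrightarrow>
    Lam v - Lam u \<le> parab (F u) u (F v) v + integral {u..v} (Q w)"
proof -
  \<comment> \<open>A detour of cost \<open>M\<close> loses even against the energy of all of
    \<open>F\<close>, and hence against the chord, after collecting every density.\<close>
  define M where "M = integral {0..1} R + integral {0..1} (\<lambda>t. (deriv F t)^2) + 1"
  have "0 \<le> integral {0..1} R" using X_bound [of 0 0] by simp
  moreover have en0: "0 \<le> integral {0..1} (\<lambda>t. (deriv F t)^2)"
    by (intro integral_nonneg set_lebesgue_integral_eq_integral(1) admissible_curve_deriv(2) F_admissible) auto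
  ultimately have M: "0 < M" by (simp add: M_def)
  have "uniformly_continuous_on {0..1} F" by (intro compact_uniformly_continuous F_continuous) auto
  then obtain d0 where d0: "0 < d0" "\<And>u v. u \<in> {0..1} \<Longrightarrow> v \<in> {0..1} \<Longrightarrow> dist v u < d0 \<Longrightarrow> dist (F v) (F u) < w / 2"
    unfolding uniformly_continuous_on_def using w by (metis half_gt_zero)
  \<comment> \<open>Within \<open>d0\<close> the curve moves less than \<open>w / 2\<close>, so a
    far point is at least \<open>w / 2\<close> away from \<open>F u\<close>, and reaching it within
    time \<open>d\<close> costs at least \<open>M\<close>.\<close>
  define d where "d = min (d0 / 2) ((w / 2)^2 / M)"
  have d: "0 < d" "d < d0" "d * M \<le> (w / 2)^2"
  proof -
    have "d \<le> (w / 2)^2 / M" by (simp add: d_def)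
    then show "d * M \<le> (w / 2)^2" using M by (simp add: pos_le_divide_eq)
  qed (use d0 M w in \<open>auto simp: d_def\<close>)
  have "Lam v - Lam u \<le> parab (F u) u (F v) v + integral {u..v} (Q w)"
    if uv: "0 \<le> u" "u < v" "v \<le> 1" "v - u \<le> d" for u v
  proof -
    interpret nr: dominated_planting "{}" \<gamma> \<rho> "Q w" by (rule Q_planting)
    have "E (F u) u (F v) v \<le> parab (F u) u (F v) v + (XQ w v - XQ w u)"
    proof (rule E_leI [OF uv(2)])
      fix b assume b: "chain (curve_link I \<gamma> \<rho>) (F u) u (F v) v b"
      show "b \<le> parab (F u) u (F v) v + (XQ w v - XQ w u)"
      proof (cases "b \<le> parab (F u) u (F v) v + (XQ w v - XQ w u)")
        case False
        then obtain z t where zt: "causal (F u) u z t" "causal z t (F v) v" "t \<in> {0..1}" "w < \<bar>z - F t\<bar>"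
          "b \<le> parab (F u) u z t + parab z t (F v) v + (X v - X u)"
          using chain_near_or_far [OF b, of w] by blast
        \<comment> \<open>\<open>t = u\<close> is impossible, since then \<open>z = F u\<close>
          would lie on the curve.\<close>
        have t: "u < t" "t \<le> v" using zt w by (auto simp: causal_def)
        have "dist (F t) (F u) < w / 2" by (rule d0(2)) (use zt uv t d in \<open>auto simp: dist_real_def\<close>)
        then have "w / 2 \<le> \<bar>z - F u\<bar>" using zt(4) unfolding dist_real_def by linarith
        then have "(w / 2)^2 \<le> (z - F u)^2" using w by (metis abs_le_square_iff abs_of_pos half_gt_zero)
        then have "d * M \<le> (z - F u)^2" using d by linarith
        moreover have "(t - u) * M \<le> d * M" using t uv M by (intro mult_right_mono) auto
        ultimately have "M \<le> (z - F u)^2 / (t - u)" using t by (simp add: pos_le_divide_eq mult.commute)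
        then have "b \<le> - M + (X v - X u)"
          using zt(5) parab_causal_nonpos [OF zt(2)] by (simp add: parab_def)
        also have "\<dots> \<le> - integral {0..1} (\<lambda>t. (deriv F t)^2)"
          using X_bound [of v u] by (simp add: M_def)
        also have "\<dots> \<le> - integral {u..v} (\<lambda>t. (deriv F t)^2)"
        proof -
          have i: "(\<lambda>t. (deriv F t)^2) integrable_on {0..1}"
            by (intro set_lebesgue_integral_eq_integral(1) admissible_curve_deriv(2) F_admissible)
          have "integral {u..v} (\<lambda>t. (deriv F t)^2) \<le> integral {0..1} (\<lambda>t. (deriv F t)^2)"
            using uv by (intro integral_subset_le i integrable_subinterval_real [OF i]) auto
          then show ?thesis by simp
        qed
        also have "\<dots> \<le> parab (F u) u (F v) v"
          using uv by (intro admissible_curve_energy F_admissible) auto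
        also have "\<dots> \<le> parab (F u) u (F v) v + (XQ w v - XQ w u)"
          using nr.X_mono [of u v] uv by simp
        finally show ?thesis .
      qed
    qed
    then show ?thesis using E_potential [OF uv(1-3)] nr.X_diff [of u v] uv by simp
  qed
  then show ?thesis using d(1) by blast
qed

text \<open>Divide the short-time bound by the elapsed time and let it tend to 0. The increments of
  \<open>Lam\<close> give \<open>rho - (F' t)^2\<close>, the chords give \<open>- (F' t)^2\<close>,
  and Lebesgue differentiation turns the integral into \<open>Q w t\<close>.\<close>

lemma rho_le_Q:
  assumes w: "0 < w"
  shows "\<exists>Z. negligible Z \<and> (\<forall>t\<in>{0..1} - Z. rho t \<le> Q w t)"
proof -
  interpret nr: dominated_planting "{}" \<gamma> \<rho> "Q w" by (rule Q_planting)
  obtain d where d: "0 < d" and bound: "\<And>u v. 0 \<le> u \<Longrightarrow> u < v \<Longrightarrow> v \<le> 1 \<Longrightarrow> v - u \<le> d \<Longrightarrow>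
    Lam v - Lam u \<le> parab (F u) u (F v) v + integral {u..v} (Q w)"
    using short_time_bound [OF w] by blast
  obtain N where N: "negligible N"
    and der: "\<And>t. t \<in> {0<..<1} - N \<Longrightarrow> ((\<lambda>t. integral {0..t} (Q w)) has_real_derivative Q w t) (at t)"
    using lebesgue_differentiation [OF nr.R_integrable] by blast
  have "rho t \<le> Q w t" if t: "t \<in> {0..1} - (N \<union> {0, 1, a})" for t
  proof -
    have t': "t \<in> {0<..<1} - N" "t \<noteq> a" using t by auto
    have lim: "((\<lambda>v. (f v - f t) / (v - t)) \<longlongrightarrow> l) (at_right t)" if "(f has_real_derivative l) (at t)" for f l
      using that by (simp add: has_field_derivative_iff filterlim_at_split)
    have "((\<lambda>v. (Lam v - Lam t) / (v - t) + ((F v - F t) / (v - t))^2) \<longlongrightarrow> (rho t - (F' t)^2) + (F' t)^2) (at_right t)"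
      by (intro tendsto_add tendsto_power lim Lam_deriv F_deriv t')
    moreover have "((\<lambda>v. (integral {0..v} (Q w) - integral {0..t} (Q w)) / (v - t)) \<longlongrightarrow> Q w t) (at_right t)"
      by (intro lim der t')
    moreover have "\<forall>\<^sub>F v in at_right t. v \<in> {t<..<min 1 (t + d)}"
      using t' d by (intro eventually_at_right_real) auto
    then have "\<forall>\<^sub>F v in at_right t. (Lam v - Lam t) / (v - t) + ((F v - F t) / (v - t))^2 \<le>
        (integral {0..v} (Q w) - integral {0..t} (Q w)) / (v - t)"
    proof eventually_elim
      case (elim v)
      have "integral {0..t} (Q w) + integral {t..v} (Q w) = integral {0..v} (Q w)"
        using elim t' by (intro integral_add_adjacent nr.R_integrable) auto
      moreover have "Lam v - Lam t \<le> parab (F t) t (F v) v + integral {t..v} (Q w)"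
        using elim t' by (intro bound) auto
      ultimately have "(Lam v - Lam t) + (F v - F t)^2 / (v - t) \<le> integral {0..v} (Q w) - integral {0..t} (Q w)"
        by (simp add: parab_def)
      then have "((Lam v - Lam t) + (F v - F t)^2 / (v - t)) / (v - t) \<le> (integral {0..v} (Q w) - integral {0..t} (Q w)) / (v - t)"
        using elim by (intro divide_right_mono) auto
      then show ?case by (simp add: add_divide_distrib power_divide power2_eq_square)
    qed
    ultimately show ?thesis by (auto dest: tendsto_le [OF trivial_limit_at_right_real, rotated 2])
  qed
  moreover have "negligible (N \<union> {0, 1, a})" using N by simp
  ultimately show ?thesis by blast
qed

text \<open>Curves within any width of \<open>F\<close> already carry the cost \<open>s^3\<close>. A
  curve off \<open>F\<close> at time \<open>t\<close> lies outside some width, so its cost comes on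
  top. Countably many widths keep the exceptional set negligible.\<close>

lemma density_bounds:
  obtains Z where "negligible Z"
    and "\<And>t. t \<in> {0..1} - Z \<Longrightarrow> (s t)^3 \<le> S t"
    and "\<And>i t. i \<in> I \<Longrightarrow> t \<in> {0..1} - Z \<Longrightarrow> \<rho> i t powr (3/2) \<le> S t"
    and "\<And>i t. i \<in> I \<Longrightarrow> t \<in> {0..1} - Z \<Longrightarrow> \<gamma> i t \<noteq> F t \<Longrightarrow> (s t)^3 + \<rho> i t powr (3/2) \<le> S t"
proof -
  obtain Z0 where Z0: "negligible Z0"
    "\<And>i t N. i \<in> I \<Longrightarrow> t \<in> {0..1} - Z0 \<Longrightarrow> t \<in> N i \<Longrightarrow> \<rho> i t powr (3/2) \<le> P N t"
    "\<And>i t N. i \<in> I \<Longrightarrow> t \<in> {0..1} - Z0 \<Longrightarrow> t \<notin> N i \<Longrightarrow> P N t + \<rho> i t powr (3/2) \<le> S t"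
    "\<And>t N. t \<in> {0..1} - Z0 \<Longrightarrow> P N t \<le> S t" using term_bounds by metis
  have "\<exists>Z. \<forall>n::nat. negligible (Z n) \<and> (\<forall>t\<in>{0..1} - Z n. rho t \<le> Q (inverse (Suc n)) t)"
    by (intro choice allI rho_le_Q) simp
  then obtain Z where Z: "\<And>n. negligible (Z n)" "\<And>n t. t \<in> {0..1} - Z n \<Longrightarrow> rho t \<le> Q (inverse (Suc n)) t" by blast
  have cube: "(s t)^3 \<le> P (near (inverse (Suc n))) t" if "t \<in> {0..1} - Z n" for n t
  proof -
    have "rho t powr (3/2) \<le> Q (inverse (Suc n)) t powr (3/2)"
      using Z(2) [OF that] by (intro powr_mono2) (auto simp: rho_def)
    moreover have "Q (inverse (Suc n)) t powr (3/2) = P (near (inverse (Suc n))) t"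
      using P_nonneg by (simp add: Q_def powr_powr)
    ultimately show ?thesis by (simp add: rho_powr)
  qed
  show thesis
  proof (rule that [of "Z0 \<union> (\<Union>n. Z n)"])
    show "negligible (Z0 \<union> (\<Union>n. Z n))" using Z0(1) negligible_Union_nat [of Z] Z(1) by simp
    show "(s t)^3 \<le> S t" if "t \<in> {0..1} - (Z0 \<union> (\<Union>n. Z n))" for t
    proof -
      have "t \<in> {0..1} - Z 0" "t \<in> {0..1} - Z0" using that by auto
      then show ?thesis using cube [of t 0] Z0(4) [of t "near (inverse (Suc 0))"] by linarith
    qed
    show "\<rho> i t powr (3/2) \<le> S t" if "i \<in> I" "t \<in> {0..1} - (Z0 \<union> (\<Union>n. Z n))" for i t
      using Z0(2) [of i t "\<lambda>_. UNIV"] that by simp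
    show "(s t)^3 + \<rho> i t powr (3/2) \<le> S t"
      if t: "i \<in> I" "t \<in> {0..1} - (Z0 \<union> (\<Union>n. Z n))" "\<gamma> i t \<noteq> F t" for i t
    proof -
      obtain n where "inverse (real (Suc n)) < \<bar>\<gamma> i t - F t\<bar>"
        using reals_Archimedean [of "\<bar>\<gamma> i t - F t\<bar>"] t(3) by auto
      then have "t \<notin> near (inverse (Suc n)) i" by (auto simp: near_def)
      then have "P (near (inverse (Suc n))) t + \<rho> i t powr (3/2) \<le> S t"
        using Z0(3) [of i t "near (inverse (Suc n))"] t by blast
      moreover have "(s t)^3 \<le> P (near (inverse (Suc n))) t" using t by (intro cube) auto
      ultimately show ?thesis by linarith
    qed
  qed
qed

text \<open>Density beyond \<open>rho\<close> on \<open>F\<close>, and any density off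
  \<open>F\<close>, is paid for by \<open>S - s^3\<close>, whose integral is the excess
  \<open>r - 2 * \<beta>^2\<close>. The parameter \<open>c\<close> balances the terms: an excess of
  order \<open>c^3\<close> leaves an error of order \<open>c^2\<close>.\<close>

lemma E_le_opt:
  assumes c: "0 < c" "c \<le> s 1" and st: "\<sigma> < \<tau>"
  shows "E x \<sigma> y \<tau> \<le> opt.E x \<sigma> y \<tau> + (c^2 + 2 / (3 * c) * (r - 2 * \<beta>^2))"
proof -
  obtain Z where Z: "negligible Z" "\<And>t. t \<in> {0..1} - Z \<Longrightarrow> (s t)^3 \<le> S t"
    "\<And>i t. i \<in> I \<Longrightarrow> t \<in> {0..1} - Z \<Longrightarrow> \<rho> i t powr (3/2) \<le> S t"
    "\<And>i t. i \<in> I \<Longrightarrow> t \<in> {0..1} - Z \<Longrightarrow> \<gamma> i t \<noteq> F t \<Longrightarrow> (s t)^3 + \<rho> i t powr (3/2) \<le> S t"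
    using density_bounds by metis
  \<comment> \<open>Young's inequality with weight \<open>c\<close> bounds a density by
    \<open>2 / (3 * c)\<close> times its cost plus \<open>c^2 / 3\<close>. The maximum makes
    \<open>H\<close> nonnegative everywhere, as \<open>s^3\<close> is below \<open>S\<close> only
    almost everywhere.\<close>
  define H where "H t = c^2 + 2 / (3 * c) * max 0 (S t - (s t)^3)" for t
  have S3: "(\<lambda>t. S t - (s t)^3) absolutely_integrable_on {0..1}"
    by (intro set_integral_diff(1) P_absolutely_integrable absolutely_integrable_continuous_real continuous_intros s_continuous) simp
  have H_int: "H absolutely_integrable_on {0..1}"
    unfolding H_def [abs_def]
    by (intro set_integral_add(1) set_integrable_mult_right absolutely_integrable_max_1 S3
        absolutely_integrable_continuous_real continuous_intros)
  have H_nonneg: "0 \<le> H t" for t unfolding H_def using c by (intro add_nonneg_nonneg mult_nonneg_nonneg) auto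
  have H_integral: "integral {0..1} H = c^2 + 2 / (3 * c) * (r - 2 * \<beta>^2)"
  proof -
    have "integral {0..1} H = integral {0..1} (\<lambda>t. c^2 * 1 + 2 / (3 * c) * (S t - (s t)^3))"
      by (rule integral_spike [OF Z(1)]) (use Z(2) in \<open>auto simp: H_def max_def\<close>)
    also have "\<dots> = c^2 * ((1 - 0) * 1) + 2 / (3 * c) * (r - 2 * \<beta>^2)"
      unfolding r_def using has_integral_const_real [of "1::real" 0 1]
      by (intro integral_unique has_integral_add has_integral_mult_right has_integral_diff
          integrable_integral S_integrable s_cube_integral) auto
    finally show ?thesis by simp
  qed
  interpret H: dominated_planting "{}" \<gamma> \<rho> H
    by unfold_locales (auto simp: H_int H_nonneg intro!: exI [of _ "{}"])
  have dens: "\<rho> i t \<le> (if \<gamma> i t = F t then rho t else 0) + H t" if i: "i \<in> I" and t: "t \<in> {0..1} - Z" for i t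
  proof -
    define h where "h = S t - (s t)^3"
    have h: "0 \<le> h" "H t = c^2 + 2 / (3 * c) * h" using Z(2) [OF t] by (auto simp: h_def H_def)
    have \<rho>0: "0 \<le> \<rho> i t" using density_nonneg i t by blast
    have young: "3 / 2 * (b * \<rho> i t) \<le> \<rho> i t powr (3/2) + b^3 / 2" if "0 \<le> b" for b
      using young_two_thirds [of "\<rho> i t powr (3/2)" b] that powr_three_halves_inverse [OF \<rho>0] by simp
    show ?thesis
    proof (cases "\<gamma> i t = F t")
      case True
      \<comment> \<open>On \<open>F\<close> the weight is \<open>s t\<close>, for which Young's
        inequality is sharp at \<open>rho t\<close>; as \<open>s\<close> decreases, it is at least
        \<open>c\<close>.\<close>
      have cs: "c \<le> s t" using c s_antimono [of t 1] t by auto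
      have "3 / 2 * (s t * \<rho> i t) \<le> 3 / 2 * (s t)^3 + h"
        using young [OF less_imp_le [OF s_pos [of t]]] Z(3) [OF i t] by (simp add: h_def)
      moreover have "s t * (rho t + 2 / (3 * s t) * h) = (s t)^3 + 2 / 3 * h"
        using s_pos [of t] by (simp add: rho_def power2_eq_square power3_eq_cube field_simps)
      ultimately have "s t * \<rho> i t \<le> s t * (rho t + 2 / (3 * s t) * h)" by linarith
      then have "\<rho> i t \<le> rho t + 2 / (3 * s t) * h" using s_pos [of t] by simp
      also have "\<dots> \<le> rho t + 2 / (3 * c) * h"
        using c cs h by (intro add_left_mono mult_right_mono divide_left_mono) auto
      finally have "\<rho> i t \<le> rho t + H t" unfolding h(2) using zero_le_power2 [of c] by linarith
      then show ?thesis using True by simp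
    next
      case False
      have "3 / 2 * (c * \<rho> i t) \<le> h + c^3 / 2"
        using young [of c] Z(4) [OF i t False] c by (simp add: h_def)
      moreover have "c * (2 / (3 * c) * h + c^2 / 3) = 2 / 3 * h + c^3 / 3"
        using c by (simp add: power2_eq_square power3_eq_cube field_simps)
      ultimately have "c * \<rho> i t \<le> c * (2 / (3 * c) * h + c^2 / 3)" by linarith
      then have "\<rho> i t \<le> 2 / (3 * c) * h + c^2 / 3" using c by simp
      then have "\<rho> i t \<le> H t" unfolding h(2) using zero_le_power2 [of c] by linarith
      then show ?thesis using False by simp
    qed
  qed
  have link_le: "curve_gain (\<gamma> i) (\<rho> i) u v \<le> opt.E (\<gamma> i u) u (\<gamma> i v) v + (H.X v - H.X u)"
    if i: "i \<in> I" and uv: "0 \<le> u" "u < v" "v \<le> 1" for i u v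
  proof -
    define f where "f = (\<lambda>t. indicator {t \<in> {0..1}. \<bar>\<gamma> i t - F t\<bar> \<le> 0} t * rho t)"
    have fa: "f absolutely_integrable_on {0..1}"
      unfolding f_def
    proof (rule absolutely_integrable_bounded_measurable_product_real [OF _ _ _ rho_integrable])
      have "(indicator (near 0 i) :: real \<Rightarrow> real) \<in> borel_measurable lebesgue"
        by (intro borel_measurable_indicator near_measurable i)
      then show "(indicator {t \<in> {0..1}. \<bar>\<gamma> i t - F t\<bar> \<le> 0} :: real \<Rightarrow> real) \<in> borel_measurable (lebesgue_on {0..1})"
        unfolding near_def by (rule measurable_restrict_space1)
      show "bounded ((indicator {t \<in> {0..1}. \<bar>\<gamma> i t - F t\<bar> \<le> 0} :: real \<Rightarrow> real) ` {0..1})"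
        by (rule bounded_subset [of "{0, 1}"]) (auto simp: indicator_def)
    qed simp
    \<comment> \<open>\<open>f\<close> is visibly measurable, while \<open>f'\<close> has the form
      that \<open>curve_le_opt\<close> asks for at every time; they agree on the unit
      interval.\<close>
    define f' where "f' t = (if \<gamma> i t = F t then rho t else 0)" for t
    have ff': "f' t = f t" if "t \<in> {0..1}" for t using that by (simp add: f_def f'_def indicator_def)
    have f'i: "f' integrable_on {0..1}"
      by (rule integrable_eq [OF set_lebesgue_integral_eq_integral(1) [OF fa]]) (rule ff' [symmetric])
    have "integral {u..v} (\<rho> i) \<le> integral {u..v} (\<lambda>t. f' t + H t)"
    proof (rule integral_le_off_negligible [OF _ _ Z(1)])
      show "\<rho> i integrable_on {u..v}" using i uv by (intro density_integrable_on)
      show "(\<lambda>t. f' t + H t) integrable_on {u..v}"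
        using uv by (intro integrable_add H.R_sub integrable_subinterval_real [OF f'i]) auto
      show "\<rho> i t \<le> f' t + H t" if "t \<in> {u..v} - Z" for t
        unfolding f'_def using dens [OF i, of t] that uv by auto
    qed
    also have "\<dots> = integral {u..v} f' + integral {u..v} H"
      using uv by (intro Henstock_Kurzweil_Integration.integral_add H.R_sub integrable_subinterval_real [OF f'i]) auto
    finally have "curve_gain (\<gamma> i) (\<rho> i) u v \<le> (integral {u..v} f' - integral {u..v} (\<lambda>t. (deriv (\<gamma> i) t)^2)) + integral {u..v} H"
      by (simp add: curve_gain_def)
    also have "integral {u..v} f' - integral {u..v} (\<lambda>t. (deriv (\<gamma> i) t)^2) \<le> opt.E (\<gamma> i u) u (\<gamma> i v) v"
      by (rule curve_le_opt [OF curve [OF i] uv f'i]) (simp add: f'_def)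
    finally show ?thesis using H.X_diff [of u v] uv by simp
  qed
  have "v \<le> opt.E x \<sigma> y \<tau> + (H.X \<tau> - H.X \<sigma>)" if "chain (curve_link I \<gamma> \<rho>) x \<sigma> y \<tau> v" for x \<sigma> y \<tau> v
    using that
  proof (induction rule: chain.induct)
    case (direct \<sigma> \<tau> x y)
    then show ?case using opt.E_ge [of \<sigma> \<tau> x y] H.X_mono [of \<sigma> \<tau>] by simp
  next
    case (link x \<sigma> y \<tau> v)
    then obtain i where "i \<in> I" "0 \<le> \<sigma>" "\<sigma> < \<tau>" "\<tau> \<le> 1" "x = \<gamma> i \<sigma>" "y = \<gamma> i \<tau>" "v = curve_gain (\<gamma> i) (\<rho> i) \<sigma> \<tau>"
      unfolding curve_link_def by blast
    then show ?case using link_le [of i \<sigma> \<tau>] by simp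
  next
    case (append x \<sigma> y \<tau> v z \<upsilon> u)
    have "\<sigma> < \<tau>" "\<tau> < \<upsilon>" using append.hyps chain_less by blast+
    then show ?case using append.IH opt.E_triangle [of \<sigma> \<tau> \<upsilon> x y z] by linarith
  qed
  then have "E x \<sigma> y \<tau> \<le> opt.E x \<sigma> y \<tau> + (H.X \<tau> - H.X \<sigma>)" by (intro E_leI [OF st])
  then show ?thesis using H.X_bound [of \<tau> \<sigma>] H_integral by linarith
qed

end

section \<open>Uniqueness of the minimizer\<close>

lemma nonpos_of_linear_le_quadratic:
  fixes x c :: real
  assumes "\<And>t. 0 < t \<Longrightarrow> t * x \<le> t^2 * c"
  shows "x \<le> 0"
proof -
  have "x \<le> t * c" if "0 < t" for t
    using assms [OF that] that by (simp add: power2_eq_square)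
  then have "\<forall>\<^sub>F t in at_right 0. x \<le> t * c" by (simp add: eventually_at_right_less eventually_mono [OF eventually_at_right_less])
  moreover have "((\<lambda>t. t * c) \<longlongrightarrow> 0 * c) (at_right 0)" by (intro tendsto_intros)
  ultimately show ?thesis by (auto dest: tendsto_lowerbound)
qed

text \<open>The rate is an infimum over representations, so one works with a sequence of
  representations of the same metric whose costs approach the minimum.\<close>

locale optimal_metric = optimum a for a :: real +
  fixes e :: dmetric and \<pi> \<Lambda> :: "real \<Rightarrow> real"
  assumes directed: "directed_metric e"
    and above: "\<sigma> < \<tau> \<Longrightarrow> dirichlet x \<sigma> y \<tau> \<le> e x \<sigma> y \<tau>"
    and approx: "0 < d \<Longrightarrow> \<exists>I \<gamma> \<rho>. competitor a I \<gamma> \<rho> e \<pi> \<Lambda> \<and> rep_rate I \<rho> \<le> ennreal (4/3 * (2 * \<beta>^2 + d))"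
begin

lemma approximating_competitor:
  assumes "0 < d"
  obtains I \<gamma> \<rho> where "competitor a I \<gamma> \<rho> e \<pi> \<Lambda>" "competitor.r I \<rho> - 2 * \<beta>^2 \<le> d"
proof -
  obtain I \<gamma> \<rho> where c: "competitor a I \<gamma> \<rho> e \<pi> \<Lambda>" "rep_rate I \<rho> \<le> ennreal (4/3 * (2 * \<beta>^2 + d))"
    using approx [OF assms] by blast
  interpret competitor a I \<gamma> \<rho> e \<pi> \<Lambda> by (rule c(1))
  have "4 / 3 * r \<le> 4/3 * (2 * \<beta>^2 + d)"
    using c(2) assms unfolding rep_rate_r by (simp add: ennreal_le_iff)
  then show thesis using that [OF c(1)] by simp
qed

lemma \<pi>_values: "\<pi> 0 = 0" "\<pi> a = 1" "\<pi> 1 = 0"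
proof -
  obtain I \<gamma> \<rho> where c: "competitor a I \<gamma> \<rho> e \<pi> \<Lambda>"
    using approximating_competitor [of 1] by (metis zero_less_one)
  interpret competitor a I \<gamma> \<rho> e \<pi> \<Lambda> by (rule c)
  show "\<pi> 0 = 0" "\<pi> a = 1" "\<pi> 1 = 0" by (rule \<pi>)+
qed

lemma potential: "0 \<le> u \<Longrightarrow> u < v \<Longrightarrow> v \<le> 1 \<Longrightarrow> e (\<pi> u) u (\<pi> v) v = ereal (\<Lambda> v - \<Lambda> u)"
proof -
  obtain I \<gamma> \<rho> where c: "competitor a I \<gamma> \<rho> e \<pi> \<Lambda>"
    using approximating_competitor [of 1] by (metis zero_less_one)
  interpret competitor a I \<gamma> \<rho> e \<pi> \<Lambda> by (rule c)
  show "0 \<le> u \<Longrightarrow> u < v \<Longrightarrow> v \<le> 1 \<Longrightarrow> e (\<pi> u) u (\<pi> v) v = ereal (\<Lambda> v - \<Lambda> u)" by (rule potential)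
qed

text \<open>The path belongs to the metric and not to a representation, so the excess may tend to 0
  with \<open>\<theta>\<close> fixed. A linear function of \<open>\<theta>\<close> below a quadratic
  one, for both signs, vanishes.\<close>

lemma geodesic_late:
  assumes T: "a < T" "T < 1" shows "\<pi> T = F T"
proof -
  define x C where "x = \<pi> T / T - F T / T" and "C = (1 / a - F T / T) / m"
  have le: "2 * \<theta> * x \<le> \<theta>^2 * C" for \<theta>
  proof (rule field_le_epsilon)
    fix d :: real assume "0 < d"
    then obtain I \<gamma> \<rho> where c: "competitor a I \<gamma> \<rho> e \<pi> \<Lambda>" "competitor.r I \<rho> - 2 * \<beta>^2 \<le> d"
      by (rule approximating_competitor)
    interpret competitor a I \<gamma> \<rho> e \<pi> \<Lambda> by (rule c(1))
    have "2 * \<theta> * x - \<theta>^2 * C \<le> 2 / 3 * (r - 2 * \<beta>^2)"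
      using geodesic_defect [OF T, of \<theta>] by (simp add: x_def C_def)
    then show "2 * \<theta> * x \<le> \<theta>^2 * C + d" using c(2) \<open>0 < d\<close> by argo
  qed
  have "2 * x \<le> 0" by (rule nonpos_of_linear_le_quadratic [where c = C]) (use le in \<open>simp add: mult_ac\<close>)
  moreover have "- 2 * x \<le> 0"
    by (rule nonpos_of_linear_le_quadratic [where c = C]) (use le [of "- t" for t] in \<open>simp add: mult_ac\<close>)
  ultimately have "x = 0" by simp
  then show ?thesis using T a_pos by (simp add: x_def)
qed

text \<open>The extra cost of passing through \<open>\<pi> w\<close> is a multiple of the square
  \<open>(a * \<pi> w - w)^2\<close>, by strict convexity of the Dirichlet cost.\<close>

lemma geodesic_early:
  assumes w: "0 < w" "w < a" shows "\<pi> w = F w"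
proof -
  have "\<beta> * ((\<pi> w)^2 / w + (1 - \<pi> w)^2 / (a - w) - 1 / a) \<le> 0"
  proof (rule field_le_epsilon)
    fix d :: real assume d: "0 < d"
    then obtain I \<gamma> \<rho> where c: "competitor a I \<gamma> \<rho> e \<pi> \<Lambda>" "competitor.r I \<rho> - 2 * \<beta>^2 \<le> d"
      by (rule approximating_competitor)
    interpret competitor a I \<gamma> \<rho> e \<pi> \<Lambda> by (rule c(1))
    show "\<beta> * ((\<pi> w)^2 / w + (1 - \<pi> w)^2 / (a - w) - 1 / a) \<le> 0 + d"
      using initial_defect [OF w] c(2) d by argo
  qed
  then have "(\<pi> w)^2 / w + (1 - \<pi> w)^2 / (a - w) - 1 / a \<le> 0"
    using \<beta>(1) by (simp add: mult_le_0_iff)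
  moreover have "(\<pi> w)^2 / w + (1 - \<pi> w)^2 / (a - w) - 1 / a = (a * \<pi> w - w)^2 / (a * w * (a - w))"
    using w a_pos by (simp add: divide_simps) (simp add: power2_eq_square algebra_simps)
  ultimately have "(a * \<pi> w - w)^2 / (a * w * (a - w)) \<le> 0" by simp
  moreover have "0 < a * w * (a - w)" using w a_pos by simp
  ultimately have "(a * \<pi> w - w)^2 \<le> 0" by (simp add: divide_le_0_iff)
  then have "a * \<pi> w = w" by simp
  then have "\<pi> w = w / a" using a_pos by (simp add: field_simps)
  then show ?thesis using w F_le_a [of w] by simp
qed

lemma geodesic_eq: "0 \<le> t \<Longrightarrow> t \<le> 1 \<Longrightarrow> \<pi> t = F t"
proof -
  assume "0 \<le> t" "t \<le> 1"
  then consider "t = 0" | "0 < t" "t < a" | "t = a" | "a < t" "t < 1" | "t = 1" by linarith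
  then show "\<pi> t = F t"
    using geodesic_late [of t] geodesic_early [of t] \<pi>_values F_values by cases simp_all
qed

text \<open>A representation of excess at most \<open>\<theta>^2\<close> turns
  \<open>integral_R_le\<close> into an error of order \<open>\<theta>\<close>, and the potential
  does not depend on the representation.\<close>

lemma potential_upper:
  assumes uv: "0 \<le> u" "u < v" "v \<le> 1"
  shows "\<Lambda> v - \<Lambda> u \<le> parab (F u) u (F v) v + integral {u..v} rho"
proof -
  define x where "x = (\<Lambda> v - \<Lambda> u) - (parab (F u) u (F v) v + integral {u..v} rho)"
  have "\<theta> * x \<le> \<theta>^2 * (1 + \<beta> + \<theta> / 3)" if \<theta>: "0 < \<theta>" for \<theta>
  proof -
    have "0 < \<theta>^2" using \<theta> by simp
    then obtain I \<gamma> \<rho> where c: "competitor a I \<gamma> \<rho> e \<pi> \<Lambda>" "competitor.r I \<rho> - 2 * \<beta>^2 \<le> \<theta>^2"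
      by (rule approximating_competitor)
    interpret competitor a I \<gamma> \<rho> e \<pi> \<Lambda> by (rule c(1))
    have "x \<le> 2 / 3 * (r - 2 * \<beta>^2) / \<theta> + \<beta> * \<theta> + \<theta>^2 / 3"
      using \<Lambda>_upper [OF uv] integral_R_le [of u v \<theta>] uv \<theta> geodesic_eq [of u] geodesic_eq [of v]
      by (simp add: x_def)
    also have "2 / 3 * (r - 2 * \<beta>^2) / \<theta> \<le> \<theta>^2 / \<theta>"
      using c(2) r_lower \<theta> by (intro divide_right_mono) auto
    finally have "x \<le> \<theta> * (1 + \<beta> + \<theta> / 3)" using \<theta> by (simp add: power2_eq_square algebra_simps)
    then have "\<theta> * x \<le> \<theta> * (\<theta> * (1 + \<beta> + \<theta> / 3))" using \<theta> by (intro mult_left_mono) auto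
    then show ?thesis by (simp add: power2_eq_square mult_ac)
  qed
  then have "x \<le> \<theta> * (1 + \<beta> + \<theta> / 3)" if "0 < \<theta>" for \<theta>
    using that by (simp add: power2_eq_square mult.assoc)
  then have "\<forall>\<^sub>F \<theta> in at_right 0. x \<le> \<theta> * (1 + \<beta> + \<theta> / 3)"
    by (rule eventually_mono [OF eventually_at_right_less])
  moreover have "((\<lambda>\<theta>. \<theta> * (1 + \<beta> + \<theta> / 3)) \<longlongrightarrow> 0 * (1 + \<beta> + 0 / 3)) (at_right 0)"
    by (intro tendsto_intros) auto
  ultimately have "x \<le> 0 * (1 + \<beta> + 0 / 3)" by (intro tendsto_lowerbound) auto
  then show ?thesis by (simp add: x_def)
qed

text \<open>Up to a quadratic error \<open>\<Lambda>\<close> grows no faster than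
  \<open>Lam\<close>, so their difference decreases. The Dirichlet lower bound on the whole interval
  rules out any decrease.\<close>

lemma potential_eq:
  assumes uv: "0 \<le> u" "u < v" "v \<le> 1"
  shows "\<Lambda> v - \<Lambda> u = Lam v - Lam u"
proof -
  define D where "D t = \<Lambda> t - Lam t" for t
  have inc: "D t - D s \<le> \<beta>^2 / (2 * a) * (t - s)^2" if "0 \<le> s" "s < t" "t \<le> 1" "t \<le> a \<or> a \<le> s" for s t
    using potential_upper [of s t] energy_defect [of s t] that by (simp add: D_def)
  have mono: "D t \<le> D s" if st: "0 \<le> s" "s \<le> t" "t \<le> 1" for s t
    by (rule antimono_across_a [OF inc]) (use st in auto)
  have "dirichlet 0 0 0 1 \<le> e (\<pi> 0) 0 (\<pi> 1) 1" using above [of 0 1 0 0] \<pi>_values by simp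
  then have "0 \<le> \<Lambda> 1 - \<Lambda> 0" using potential [of 0 1] by (simp add: dirichlet_def)
  then have "D 0 \<le> D 1" using Lam_values by (simp add: D_def)
  then have "D u = D v" using mono [of 0 u] mono [of u v] mono [of v 1] uv by simp
  then show ?thesis by (simp add: D_def)
qed

lemma tight:
  assumes "0 < d"
  obtains I \<gamma> \<rho> where "tight_competitor a I \<gamma> \<rho> e" "competitor.r I \<rho> - 2 * \<beta>^2 \<le> d"
proof -
  obtain I \<gamma> \<rho> where c: "competitor a I \<gamma> \<rho> e \<pi> \<Lambda>" "competitor.r I \<rho> - 2 * \<beta>^2 \<le> d"
    using approximating_competitor [OF assms] by blast
  interpret competitor a I \<gamma> \<rho> e \<pi> \<Lambda> by (rule c(1))
  have "tight_competitor a I \<gamma> \<rho> e"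
  proof
    show "e (F u) u (F v) v = ereal (Lam v - Lam u)" if "0 \<le> u" "u < v" "v \<le> 1" for u v
      using potential [OF that] potential_eq [OF that] geodesic_eq [of u] geodesic_eq [of v] that by simp
  qed (use planted_e F_values in auto)
  then show thesis using that c(2) by blast
qed

theorem eq_opt:
  assumes "\<sigma> < \<tau>" shows "e x \<sigma> y \<tau> = opt.planted x \<sigma> y \<tau>"
proof (rule antisym)
  obtain E where E: "e x \<sigma> y \<tau> = ereal E"
  proof -
    obtain I \<gamma> \<rho> where c: "competitor a I \<gamma> \<rho> e \<pi> \<Lambda>"
      using approximating_competitor [of 1] by (metis zero_less_one)
    interpret competitor a I \<gamma> \<rho> e \<pi> \<Lambda> by (rule c)
    show thesis using that planted_by_unique [OF planted_e assms] by blast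
  qed
  have le: "E \<le> opt.E x \<sigma> y \<tau> + 2 * c^2" if c: "0 < c" "c \<le> s 1" for c
  proof -
    \<comment> \<open>Excess \<open>c^3\<close> makes the second error term of
      \<open>E_le_opt\<close> at most \<open>c^2\<close>.\<close>
    have "0 < c^3" using c by simp
    then obtain I \<gamma> \<rho> where t: "tight_competitor a I \<gamma> \<rho> e" "competitor.r I \<rho> - 2 * \<beta>^2 \<le> c^3"
      by (rule tight)
    interpret T: tight_competitor a I \<gamma> \<rho> e by (rule t(1))
    have "E = T.E x \<sigma> y \<tau>" using T.planted_by_unique [OF T.planted_e assms] E by simp
    also have "\<dots> \<le> opt.E x \<sigma> y \<tau> + (c^2 + 2 / (3 * c) * (T.r - 2 * \<beta>^2))"
      by (rule T.E_le_opt [OF c assms])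
    also have "2 / (3 * c) * (T.r - 2 * \<beta>^2) \<le> 2 / (3 * c) * c^3"
      using t(2) c by (intro mult_left_mono) auto
    also have "2 / (3 * c) * c^3 \<le> c^2" using c by (simp add: power3_eq_cube power2_eq_square)
    finally show ?thesis by simp
  qed
  have "\<forall>\<^sub>F c in at_right 0. c \<in> {0<..<s 1}" by (rule eventually_at_right_real) (rule s_pos)
  then have "\<forall>\<^sub>F c in at_right 0. E \<le> opt.E x \<sigma> y \<tau> + 2 * c^2"
    by eventually_elim (use le in auto)
  moreover have "((\<lambda>c. opt.E x \<sigma> y \<tau> + 2 * c^2) \<longlongrightarrow> opt.E x \<sigma> y \<tau> + 2 * 0^2) (at_right 0)"
    by (intro tendsto_intros)
  ultimately have "E \<le> opt.E x \<sigma> y \<tau> + 2 * 0^2" by (intro tendsto_lowerbound) auto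
  then show "e x \<sigma> y \<tau> \<le> opt.planted x \<sigma> y \<tau>" by (simp add: E opt.planted_def)
  show "opt.planted x \<sigma> y \<tau> \<le> e x \<sigma> y \<tau>"
    unfolding opt.planted_def
  \<comment> \<open>Since \<open>F\<close> carries the potential \<open>Lam\<close> in
    \<open>e\<close>, the metric \<open>e\<close> dominates the planted curve, and leastness
    applies.\<close>
  proof (rule opt.E_least [OF directed above _ assms])
    fix x s y t v assume "curve_link {0} (\<lambda>_. F) (\<lambda>_. rho) x s y t v"
    then have l: "0 \<le> s" "s < t" "t \<le> 1" "x = F s" "y = F t" "v = Lam t - Lam s"
      by (auto simp: curve_link_def curve_gain_F)
    then show "ereal v \<le> e x s y t"
      using potential [of s t] potential_eq [of s t] geodesic_eq [of s] geodesic_eq [of t] by simp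
  qed
qed

end

section \<open>Minimality, uniqueness and the explicit form of the minimizer\<close>

context optimum
begin

lemma competitor_of_representation:
  assumes "planted_by e I \<gamma> \<rho>" "rep_rate I \<rho> < \<infinity>" "\<pi> 0 = 0" "\<pi> a = 1" "\<pi> 1 = 0"
    and "\<And>u v. 0 \<le> u \<Longrightarrow> u < v \<Longrightarrow> v \<le> 1 \<Longrightarrow> e (\<pi> u) u (\<pi> v) v = ereal (\<Lambda> v - \<Lambda> u)"
  shows "competitor a I \<gamma> \<rho> e \<pi> \<Lambda>"
  using assms by unfold_locales (auto simp: planted_by_def)

lemma rate_opt_le: "rate opt.planted \<le> ennreal (4/3 * (2 * \<beta>^2))"
  unfolding rate_def
  by (rule INF_lower2 [where i = "({0}, \<lambda>_. F, \<lambda>_. rho)"]) (use opt.planted_by_planted rep_rate_opt in auto)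

lemma finite_rate_representation:
  assumes "finite_rate e"
  obtains I \<gamma> \<rho> where "planted_by e I \<gamma> \<rho>"
proof -
  have "rate e < \<infinity>" using assms by (simp add: finite_rate_def)
  then show thesis using that unfolding rate_def by (auto simp: INF_less_iff)
qed

lemma finite_rate_potential:
  assumes e: "finite_rate e" "geodesic_through e a"
  obtains \<pi> \<Lambda> where "\<pi> 0 = 0" "\<pi> a = 1" "\<pi> 1 = 0"
    "\<And>u v. 0 \<le> u \<Longrightarrow> u < v \<Longrightarrow> v \<le> 1 \<Longrightarrow> e (\<pi> u) u (\<pi> v) v = ereal (\<Lambda> v - \<Lambda> u)"
proof -
  obtain \<pi> where \<pi>: "geodesic e \<pi> 0 0 0 1" "\<pi> a = 1" using e(2) by (auto simp: geodesic_through_def)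
  obtain I \<gamma> \<rho> where "planted_by e I \<gamma> \<rho>" using finite_rate_representation [OF e(1)] .
  then have "directed_metric e" "\<And>x s y t. s < t \<Longrightarrow> dirichlet x s y t \<le> e x s y t"
    by (auto simp: planted_by_def)
  then obtain \<Lambda> where "\<And>u v. 0 \<le> u \<Longrightarrow> u < v \<Longrightarrow> v \<le> 1 \<Longrightarrow> e (\<pi> u) u (\<pi> v) v = ereal (\<Lambda> v - \<Lambda> u)"
    using geodesic_potential \<pi>(1) by metis
  then show thesis using that [of \<pi> \<Lambda>] \<pi> by (auto simp: geodesic_def)
qed

lemma rate_lower:
  assumes e: "finite_rate e" "geodesic_through e a"
  shows "ennreal (4/3 * (2 * \<beta>^2)) \<le> rate e"
  unfolding rate_def
proof (rule INF_greatest, clarify)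
  fix I \<gamma> \<rho> assume p: "planted_by e I \<gamma> \<rho>"
  obtain \<pi> \<Lambda> where \<pi>: "\<pi> 0 = 0" "\<pi> a = 1" "\<pi> 1 = 0"
    "\<And>u v. 0 \<le> u \<Longrightarrow> u < v \<Longrightarrow> v \<le> 1 \<Longrightarrow> e (\<pi> u) u (\<pi> v) v = ereal (\<Lambda> v - \<Lambda> u)"
    using finite_rate_potential [OF e] by blast
  show "ennreal (4/3 * (2 * \<beta>^2)) \<le> rep_rate I \<rho>"
  proof (cases "rep_rate I \<rho> < \<infinity>")
    case True
    interpret competitor a I \<gamma> \<rho> e \<pi> \<Lambda> by (rule competitor_of_representation [OF p True \<pi>])
    show ?thesis unfolding rep_rate_r using r_lower by (intro ennreal_leI) simp
  next
    case False
    then have "rep_rate I \<rho> = \<infinity>" by (simp add: less_top [symmetric])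
    then show ?thesis by simp
  qed
qed

lemma opt_finite_rate: "finite_rate opt.planted"
  using rate_opt_le by (auto simp: finite_rate_def intro: le_less_trans)

lemma rate_opt: "rate opt.planted = ennreal (4/3 * (2 * \<beta>^2))"
  by (intro antisym rate_opt_le rate_lower opt_finite_rate opt_geodesic)

lemma rate_opt_minimal: "finite_rate e \<Longrightarrow> geodesic_through e a \<Longrightarrow> rate opt.planted \<le> rate e"
  using rate_lower rate_opt by simp

text \<open>One geodesic and one potential are fixed first; every nearly optimal representation of
  \<open>e\<close> then competes with these same functions.\<close>

lemma minimizer_unique:
  assumes e: "finite_rate e" "geodesic_through e a" and eq: "rate e = rate opt.planted" and st: "\<sigma> < \<tau>"
  shows "e x \<sigma> y \<tau> = opt.planted x \<sigma> y \<tau>"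
proof -
  obtain \<pi> \<Lambda> where \<pi>: "\<pi> 0 = 0" "\<pi> a = 1" "\<pi> 1 = 0"
    "\<And>u v. 0 \<le> u \<Longrightarrow> u < v \<Longrightarrow> v \<le> 1 \<Longrightarrow> e (\<pi> u) u (\<pi> v) v = ereal (\<Lambda> v - \<Lambda> u)"
    using finite_rate_potential [OF e] by blast
  interpret optimal_metric a e \<pi> \<Lambda>
  proof
    obtain I \<gamma> \<rho> where "planted_by e I \<gamma> \<rho>" using finite_rate_representation [OF e(1)] .
    then show "directed_metric e" "\<And>x s y t. s < t \<Longrightarrow> dirichlet x s y t \<le> e x s y t"
      by (auto simp: planted_by_def)
    fix d :: real assume d: "0 < d"
    have "rate e < ennreal (4/3 * (2 * \<beta>^2 + d))"
      unfolding eq rate_opt using d by (intro ennreal_lessI mult_pos_pos add_nonneg_pos) auto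
    then obtain I \<gamma> \<rho> where r: "planted_by e I \<gamma> \<rho>" "rep_rate I \<rho> < ennreal (4/3 * (2 * \<beta>^2 + d))"
      unfolding rate_def by (auto simp: INF_less_iff)
    then have "rep_rate I \<rho> < \<infinity>" by (auto intro: less_trans)
    then have "competitor a I \<gamma> \<rho> e \<pi> \<Lambda>" by (intro competitor_of_representation r(1) \<pi>)
    then show "\<exists>I \<gamma> \<rho>. competitor a I \<gamma> \<rho> e \<pi> \<Lambda> \<and> rep_rate I \<rho> \<le> ennreal (4/3 * (2 * \<beta>^2 + d))"
      using r(2) less_imp_le by blast
  qed
  show ?thesis by (rule eq_opt [OF st])
qed

lemma F_end: "2 * a \<le> t \<Longrightarrow> F t = k * (sqrt t - t)"
  by (simp add: F_def G_ge k_def algebra_simps)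

lemma F_line: "a \<le> t \<Longrightarrow> t \<le> 2 * a \<Longrightarrow> F t = 1 + (F (2 * a) - 1) * (t - a) / (2 * a - a)"
proof -
  assume t: "a \<le> t" "t \<le> 2 * a"
  have "\<beta> * (a + 2 * a) - k * a = 1" using G_mid [of a] F_values a_pos by (simp add: F_def)
  then have "F (2 * a) - 1 = (\<beta> - k) * a" "F t = 1 + (\<beta> - k) * (t - a)"
    using t a_pos G_mid [of "2 * a"] G_mid [of t] by (simp_all add: F_def algebra_simps)
  then show ?thesis using a_pos by simp
qed

text \<open>Up to the factor \<open>2 * \<beta> * a\<close> this is
  \<open>2 * (1 - q) < 3 - 2 * q\<close>.\<close>

lemma F_2a_less: "F (2 * a) < 2"
proof -
  have "F (2 * a) = 4 * \<beta> * a - 2 * k * a" using a_pos by (simp add: F_def G_mid algebra_simps)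
  also have "\<dots> = 4 * (\<beta> * a * (1 - q))" by (simp add: k_def algebra_simps)
  also have "\<dots> < 2 * (\<beta> * a * (3 - 2 * q))" using \<beta>(1) a_pos by (simp add: algebra_simps)
  finally show ?thesis using \<beta>(2) by simp
qed

lemma deriv_F_isCont: "isCont (deriv F) (2 * a)"
proof -
  have "isCont (\<lambda>t. s t - k) (2 * a)" by (intro continuous_intros s_isCont)
  moreover have "\<forall>\<^sub>F t in nhds (2 * a). s t - k = deriv F t"
    using eventually_nhds_in_open [of "{a<..}" "2 * a"] a_pos
    by (auto elim!: eventually_mono simp: deriv_F F'_def)
  ultimately show ?thesis by (simp add: isCont_cong)
qed

lemma rho_isCont: "isCont rho (2 * a)"
  unfolding rho_def [abs_def] by (intro continuous_intros s_isCont)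

lemma rho_slope:
  assumes t: "2 * a \<le> t" "t \<le> 1"
  shows "rho t = (F t / t - vector_derivative F (at t within {2 * a..1}))^2"
proof -
  have t0: "0 < t" "a < t" using t a_pos by auto
  have "(F has_vector_derivative F' t) (at t within {2 * a..1})"
    using F_deriv [of t] t0 by (simp add: has_real_derivative_iff_has_vector_derivative has_vector_derivative_at_within)
  moreover have "at t within {2 * a..1} \<noteq> bot" using t a_less by (simp add: trivial_limit_within islimpt_Icc)
  ultimately have "vector_derivative F (at t within {2 * a..1}) = s t - k"
    using t0 by (simp add: vector_derivative_within F'_def)
  moreover have "F t / t = 2 * s t - k"
  proof -
    have "sqrt t * sqrt t = t" using t0 by simp
    then have "2 * \<beta> * q * sqrt t / t = 2 * (\<beta> * q / sqrt t)" using t0 by (simp add: field_simps)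
    then show ?thesis using t t0 by (simp add: F_def G_ge s_ge diff_divide_distrib)
  qed
  ultimately show ?thesis by (simp add: rho_def)
qed

lemma gain_before_a: "integral {0..a} (\<lambda>t. rho t - (deriv F t)^2) + 1 / a = \<beta>^2 * a"
proof -
  have "integral {0..a} (\<lambda>t. rho t - (deriv F t)^2) = integral {0..a} (\<lambda>t. \<beta>^2 - (1 / a)^2)"
    using \<beta>(3) a_pos by (intro integral_spike [of "{a}"]) (auto simp: deriv_F F'_def rho_def s_le)
  also have "\<dots> = a * (\<beta>^2 - (1 / a)^2)" using a_pos by simp
  finally show ?thesis using a_pos by (simp add: power2_eq_square algebra_simps)
qed

text \<open>From \<open>\<beta> * a * (3 - 2 * q) = 1\<close> and \<open>q < 1\<close> follows
  \<open>\<beta> * a \<le> 1\<close>, that is \<open>\<beta>^2 * a \<le> 1 / a\<close>.\<close>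

lemma gain_bounds: "0 < \<beta>^2 * a" "\<beta>^2 * a \<le> 1 / (1 - a) + 1 / a"
proof -
  show "0 < \<beta>^2 * a" using \<beta> a_pos by simp
  have "\<beta> * a * 1 \<le> \<beta> * a * (3 - 2 * q)" using q \<beta>(1) a_pos by (intro mult_left_mono) auto
  then have "\<beta> * a \<le> 1" using \<beta>(2) by simp
  then have "(\<beta> * a) * (\<beta> * a) \<le> 1 * 1" using \<beta>(1) a_pos by (intro mult_mono) auto
  then have "\<beta>^2 * a \<le> 1 / a" using a_pos by (simp add: power2_eq_square pos_le_divide_eq mult_ac)
  moreover have "0 \<le> 1 / (1 - a)" using a_less by simp
  ultimately show "\<beta>^2 * a \<le> 1 / (1 - a) + 1 / a" by linarith
qed

end

theorem theorem4:
  fixes a :: real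
  assumes "0 < a" and "a < 1/2"
  shows "\<exists>e0 F \<rho> xB tB.
     planted_by e0 {0} (\<lambda>_. F) (\<lambda>_. \<rho>) \<and>
     finite_rate e0 \<and> geodesic_through e0 a \<and>
     (\<forall>e. finite_rate e \<and> geodesic_through e a \<longrightarrow>
        rate e0 \<le> rate e \<and>
        (rate e = rate e0 \<longrightarrow> (\<forall>x s y t. s < t \<longrightarrow> e x s y t = e0 x s y t))) \<and>
     a < tB \<and> tB < 1 \<and> xB < tB / a \<and>
     (\<forall>t\<in>{0..a}. F t = t / a) \<and>
     (\<forall>t\<in>{a..tB}. F t = 1 + (xB - 1) * (t - a) / (tB - a)) \<and>
     (\<forall>t\<in>{tB..1}. F t = xB * (sqrt t - t) / (sqrt tB - tB)) \<and>
     (\<exists>c. \<forall>t\<in>{0..tB}. \<rho> t = c) \<and>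
     (\<forall>t\<in>{tB..1}. \<rho> t = (F t / t - vector_derivative F (at t within {tB..1}))^2) \<and>
     isCont (deriv F) tB \<and> isCont \<rho> tB \<and>
     (let b = integral {0..a} (\<lambda>t. \<rho> t - (deriv F t)^2) + 1 / a
      in 0 < b \<and> b \<le> 1 / (1 - a) + 1 / a)"
proof -
  interpret optimum a using assms by unfold_locales
  have "2 * a < sqrt (2 * a)"
    using q by (simp add: q_def [symmetric]) (metis mult_less_cancel_right2 not_less)
  then have "sqrt (2 * a) - 2 * a \<noteq> 0" by simp
  then have F_root: "F t = F (2 * a) * (sqrt t - t) / (sqrt (2 * a) - 2 * a)" if "t \<in> {2 * a..1}" for t
    using that by (simp add: F_end)
  show ?thesis
  proof (intro exI conjI ballI allI impI)
    show "planted_by opt.planted {0} (\<lambda>_. F) (\<lambda>_. rho)" by (rule opt.planted_by_planted)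
    show "finite_rate opt.planted" by (rule opt_finite_rate)
    show "geodesic_through opt.planted a" by (rule opt_geodesic)
    show "rate opt.planted \<le> rate e" if "finite_rate e \<and> geodesic_through e a" for e
      using that rate_opt_minimal by blast
    show "e x s y t = opt.planted x s y t"
      if "finite_rate e \<and> geodesic_through e a" "rate e = rate opt.planted" "s < t" for e x s y t
      using that minimizer_unique by blast
    show "a < 2 * a" "2 * a < 1" using assms by simp_all
    show "F (2 * a) < 2 * a / a" using F_2a_less assms by simp
    show "F t = t / a" if "t \<in> {0..a}" for t using that by (simp add: F_le_a)
    show "F t = 1 + (F (2 * a) - 1) * (t - a) / (2 * a - a)" if "t \<in> {a..2 * a}" for t
      using that by (intro F_line) auto
    show "F t = F (2 * a) * (sqrt t - t) / (sqrt (2 * a) - 2 * a)" if "t \<in> {2 * a..1}" for t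
      using that by (rule F_root)
    show "rho t = \<beta>^2" if "t \<in> {0..2 * a}" for t using that by (simp add: rho_def s_le)
    show "rho t = (F t / t - vector_derivative F (at t within {2 * a..1}))^2" if "t \<in> {2 * a..1}" for t
      using that by (intro rho_slope) auto
    show "isCont (deriv F) (2 * a)" by (rule deriv_F_isCont)
    show "isCont rho (2 * a)" by (rule rho_isCont)
    show "let b = integral {0..a} (\<lambda>t. rho t - (deriv F t)^2) + 1 / a in 0 < b \<and> b \<le> 1 / (1 - a) + 1 / a"
      using gain_bounds by (simp add: Let_def gain_before_a)
  qed
qed

end
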